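(* Let $\kappa$ be an infinite cardinal and let $m,n$ be natural numbers (possibly $0$). (1) Every $[2^{2^\kappa},2^{2^\kappa}]$-compact logic is $[\mu,\mu]$-compact for some cardinal $\mu$ with $\kappa\leq\mu\leq2^\kappa$. (2) More generally, if $m\geq1$, then every $[\beth_m(\kappa^{+n}),\beth_m(\kappa^{+n})]$-compact logic is $[\mu,\mu]$-compact for some cardinal $\mu$ with $\kappa\leq\mu\leq2^\kappa$. (3) If $\kappa$ is a strong limit cardinal and $U'(\kappa)$ holds, then every $[2^\kappa,2^\kappa]$-compact logic (even, every $[\beth_m(\kappa^{+n}),\beth_m(\kappa^{+n})]$-compact logic) is $[\kappa,\kappa]$-compact.
   Context: We work in ZFC. "Logic" means regular logic in the sense of Ebbinghaus (abstract model theory). That is, a logic $L$ assigns to each vocabulary $\tau$ a set $L[\tau]$ of $\tau$-sentences, together with a satisfaction relation $\models_L$ between $\tau$-structures and elements of $L[\tau]$, such that: $\tau\subseteq\sigma$ implies $L[\tau]\subseteq L[\sigma]$; satisfaction is invariant under isomorphism; satisfaction of $\varphi\in L[\tau]$ in a $\sigma$-structure with $\sigma\supseteq\tau$ depends only on the $\tau$-reduct; and satisfaction is preserved under renaming of the symbols of the vocabulary. The logic is regular if moreover it expresses all atomic sentences; is closed under negation, conjunction and existential quantification (over an element named by a constant symbol); is closed under relativization (for each sentence $\varphi$ there is a sentence expressing that $\varphi$ holds in the substructure whose universe is the set defined by a given formula, when this set is the universe of a substructure); and is closed under substitution of formulas for relation symbols (with the analogous replacement for function and constant symbols). For infinite cardinals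 $\lambda,\mu$, a logic $L$ is $[\lambda,\mu]$-compact if for every pair of sets $\Gamma$ and $\Sigma$ of sentences of $L$ with $|\Sigma|\leq\lambda$: if $\Gamma\cup\Sigma'$ has a model for every $\Sigma'\subseteq\Sigma$ with $|\Sigma'|<\mu$, then $\Gamma\cup\Sigma$ has a model. $\kappa^{+n}$ is the $n$th successor cardinal of $\kappa$; $\beth_0(\lambda)=\lambda$ and $\beth_{n+1}(\lambda)=2^{\beth_n(\lambda)}$. For a limit cardinal $\kappa$, $U'(\kappa)$ is the statement: for every ultrafilter $D$, if for every $\nu'<\kappa$ there is $\nu$ with $\nu'<\nu<\kappa$ such that $D$ is $\nu$-decomposable, then $D$ is $(\kappa,\kappa)$-regular. Here an ultrafilter $D$ over a set $I$ is $\nu$-decomposable if there is a function $f:I\to\nu$ such that $f^{-1}(X)\notin D$ whenever $X\subseteq\nu$ and $|X|<\nu$; and $D$ is $(\kappa,\kappa)$-regular if there is an indexed family $(X_\alpha)_{\alpha<\kappa}$ of members of $D$ such that $\bigcap_{\alpha\in A}X_\alpha=\emptyset$ whenever $A\subseteq\kappa$ and $|A|=\kappa$. *)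

theory Defs
  imports Main
begin

unbundle cardinal_syntax

section \<open>Cardinals and the set-theoretic universe\<close>

definition strong_limit :: "'a rel \<Rightarrow> bool" where
  "strong_limit \<kappa> \<longleftrightarrow>
     Cinfinite \<kappa> \<and> (\<forall>\<nu>::'a rel. Card_order \<nu> \<and> \<nu> <o \<kappa> \<longrightarrow> ctwo ^c \<nu> <o \<kappa>)"

definition inaccessible :: "'a rel \<Rightarrow> bool" where
  "inaccessible \<theta> \<longleftrightarrow> strong_limit \<theta> \<and> natLeq <o \<theta> \<and> regularCard \<theta>"

text \<open>
  The universe of ZFC is rendered by a type \<open>'u\<close> whose cardinality is inaccessible. A collection (of
  elements of any type) is a set if it has fewer elements than \<open>'u\<close>, and a proper class
  otherwise; cardinals are the \<^const>\<open>Card_order\<close>s on \<open>'u\<close> that are smaller than \<open>'u\<close>.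

  Exponentiation and successor of library cardinals leave the type of their argument. So that
  they can be iterated, the values are copied back to the original type.
\<close>

definition card_copy :: "'b rel \<Rightarrow> 'a rel" where
  "card_copy r = (SOME s. Card_order s \<and> s =o r)"

primrec succ_card :: "nat \<Rightarrow> 'a rel \<Rightarrow> 'a rel" where
  "succ_card 0 \<kappa> = \<kappa>"
| "succ_card (Suc n) \<kappa> = card_copy (cardSuc (succ_card n \<kappa>))"

primrec beth :: "nat \<Rightarrow> 'a rel \<Rightarrow> 'a rel" where
  "beth 0 \<kappa> = \<kappa>"
| "beth (Suc n) \<kappa> = card_copy (ctwo ^c beth n \<kappa>)"

lemma card_copy:
  fixes r :: "'b rel"
  assumes "Card_order r" and "r \<le>o |UNIV :: 'a set|"
  shows "Card_order (card_copy r :: 'a rel) \<and> (card_copy r :: 'a rel) =o r"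
proof -
  have *: "|Field r| =o r"
    by (rule card_of_Field_ordIso[OF assms(1)])
  have "|Field r| \<le>o |UNIV :: 'a set|"
    by (rule ordIso_ordLeq_trans[OF * assms(2)])
  then obtain B :: "'a set" where B: "|Field r| =o |B|"
    by (blast dest: internalize_card_of_ordLeq2[THEN iffD1])
  have "Card_order |B| \<and> |B| =o r"
    using card_of_Card_order ordIso_transitive[OF ordIso_symmetric[OF B] *] by (rule conjI)
  then show ?thesis
    unfolding card_copy_def by (rule someI)
qed

lemma ctwo_cexp_less_universe:
  assumes "inaccessible |UNIV :: 'a set|" and "Card_order \<kappa>" and "\<kappa> <o |UNIV :: 'a set|"
  shows "ctwo ^c (\<kappa> :: 'a rel) <o |UNIV :: 'a set|"
  using assms unfolding inaccessible_def strong_limit_def by blast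

lemma cardSuc_less_universe:
  assumes "inaccessible |UNIV :: 'a set|" and "Card_order \<kappa>" and "\<kappa> <o |UNIV :: 'a set|"
  shows "cardSuc (\<kappa> :: 'a rel) <o |UNIV :: 'a set|"
proof -
  have "cardSuc \<kappa> \<le>o ctwo ^c \<kappa>"
    by (rule cardSuc_least[OF assms(2) Card_order_cexp ordLess_ctwo_cexp[OF assms(2)]])
  then show ?thesis
    by (rule ordLeq_ordLess_trans[OF _ ctwo_cexp_less_universe[OF assms]])
qed

lemma card_copy_less_universe:
  assumes "Card_order r" and "r <o |UNIV :: 'a set|"
  shows "Card_order (card_copy r :: 'a rel) \<and> (card_copy r :: 'a rel) <o |UNIV :: 'a set|"
proof -
  have *: "Card_order (card_copy r :: 'a rel) \<and> (card_copy r :: 'a rel) =o r"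
    by (rule card_copy[OF assms(1) ordLess_imp_ordLeq[OF assms(2)]])
  show ?thesis
    by (rule conjI[OF conjunct1[OF *] ordIso_ordLess_trans[OF conjunct2[OF *] assms(2)]])
qed

lemma beth_less_universe:
  assumes "inaccessible |UNIV :: 'a set|" and "Card_order \<kappa>" and "\<kappa> <o |UNIV :: 'a set|"
  shows "Card_order (beth n \<kappa> :: 'a rel) \<and> beth n \<kappa> <o |UNIV :: 'a set|"
proof (induction n)
  case 0
  show ?case unfolding beth.simps by (rule conjI[OF assms(2,3)])
next
  case (Suc n)
  show ?case
    unfolding beth.simps
    by (rule card_copy_less_universe[OF Card_order_cexp
          ctwo_cexp_less_universe[OF assms(1) conjunct1[OF Suc] conjunct2[OF Suc]]])
qed

lemma beth_Suc:
  assumes "inaccessible |UNIV :: 'a set|" and "Card_order \<kappa>" and "\<kappa> <o |UNIV :: 'a set|"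
  shows "beth (Suc n) (\<kappa> :: 'a rel) =o ctwo ^c beth n \<kappa>"
proof -
  note * = beth_less_universe[OF assms, of n]
  show ?thesis
    unfolding beth.simps
    by (rule conjunct2[OF card_copy[OF Card_order_cexp ordLess_imp_ordLeq[OF
            ctwo_cexp_less_universe[OF assms(1) conjunct1[OF *] conjunct2[OF *]]]]])
qed

lemma succ_card_less_universe:
  assumes "inaccessible |UNIV :: 'a set|" and "Card_order \<kappa>" and "\<kappa> <o |UNIV :: 'a set|"
  shows "Card_order (succ_card n \<kappa> :: 'a rel) \<and> succ_card n \<kappa> <o |UNIV :: 'a set|"
proof (induction n)
  case 0
  show ?case unfolding succ_card.simps by (rule conjI[OF assms(2,3)])
next
  case (Suc n)
  show ?case
    unfolding succ_card.simps
    by (rule card_copy_less_universe[OF cardSuc_Card_order[OF conjunct1[OF Suc]]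
          cardSuc_less_universe[OF assms(1) conjunct1[OF Suc] conjunct2[OF Suc]]])
qed

lemma succ_card_Suc:
  assumes "inaccessible |UNIV :: 'a set|" and "Card_order \<kappa>" and "\<kappa> <o |UNIV :: 'a set|"
  shows "succ_card (Suc n) (\<kappa> :: 'a rel) =o cardSuc (succ_card n \<kappa>)"
proof -
  note * = succ_card_less_universe[OF assms, of n]
  show ?thesis
    unfolding succ_card.simps
    by (rule conjunct2[OF card_copy[OF cardSuc_Card_order[OF conjunct1[OF *]] ordLess_imp_ordLeq[OF
            cardSuc_less_universe[OF assms(1) conjunct1[OF *] conjunct2[OF *]]]]])
qed


section \<open>Ultrafilters\<close>

definition ultrafilter_on :: "'a set \<Rightarrow> 'a set set \<Rightarrow> bool" where
  "ultrafilter_on I D \<longleftrightarrow>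
     D \<subseteq> Pow I \<and> I \<in> D \<and> {} \<notin> D \<and>
     (\<forall>X\<in>D. \<forall>Y\<in>D. X \<inter> Y \<in> D) \<and>
     (\<forall>X\<in>D. \<forall>Y. X \<subseteq> Y \<and> Y \<subseteq> I \<longrightarrow> Y \<in> D) \<and>
     (\<forall>X. X \<subseteq> I \<longrightarrow> X \<in> D \<or> I - X \<in> D)"

definition decomposable :: "'b rel \<Rightarrow> 'a set \<Rightarrow> 'a set set \<Rightarrow> bool" where
  "decomposable \<nu> I D \<longleftrightarrow>
     (\<exists>f. f ` I \<subseteq> Field \<nu> \<and>
          (\<forall>X. X \<subseteq> Field \<nu> \<and> |X| <o \<nu> \<longrightarrow> {i\<in>I. f i \<in> X} \<notin> D))"

definition regular_ultrafilter :: "'b rel \<Rightarrow> 'a set set \<Rightarrow> bool" where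
  "regular_ultrafilter \<kappa> D \<longleftrightarrow>
     (\<exists>X. (\<forall>\<alpha>\<in>Field \<kappa>. X \<alpha> \<in> D) \<and>
          (\<forall>A. A \<subseteq> Field \<kappa> \<and> |A| =o \<kappa> \<longrightarrow> (\<Inter>\<alpha>\<in>A. X \<alpha>) = {}))"

definition U' :: "'u rel \<Rightarrow> bool" where
  "U' \<kappa> \<longleftrightarrow>
     (\<forall>(I::'u set) D. |I| <o |UNIV :: 'u set| \<and> ultrafilter_on I D \<and>
        (\<forall>\<nu>'::'u rel. Card_order \<nu>' \<and> \<nu>' <o \<kappa> \<longrightarrow>
           (\<exists>\<nu>::'u rel. Card_order \<nu> \<and> \<nu>' <o \<nu> \<and> \<nu> <o \<kappa> \<and> decomposable \<nu> I D)) \<longrightarrow>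
        regular_ultrafilter \<kappa> D)"


section \<open>Vocabularies and structures\<close>

text \<open>Constant symbols are the function symbols of arity 0.\<close>

datatype kind = Relation nat | Function nat

datatype 'u symbol = Symbol (kind: kind) (name: 'u)

abbreviation is_constant :: "'u symbol \<Rightarrow> bool" where
  "is_constant c \<equiv> kind c = Function 0"

definition vocabulary :: "'u symbol set \<Rightarrow> bool" where
  "vocabulary \<tau> \<longleftrightarrow> |\<tau>| <o |UNIV :: 'u set| \<and> (\<forall>s\<in>\<tau>. kind s \<noteq> Relation 0)"

text \<open>
  Only the values of \<open>rel\<close> and \<open>fn\<close> at symbols of \<open>voc\<close> and at tuples of the right length over
  \<open>univ\<close> are significant; all notions below ignore the other values.
\<close>

record 'u struct =
  voc :: "'u symbol set"
  univ :: "'u set"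
  rel :: "'u symbol \<Rightarrow> 'u list \<Rightarrow> bool"
  fn :: "'u symbol \<Rightarrow> 'u list \<Rightarrow> 'u"

definition tuples :: "nat \<Rightarrow> 'u set \<Rightarrow> 'u list set" where
  "tuples n U = {xs. length xs = n \<and> set xs \<subseteq> U}"

definition closed_under :: "'u struct \<Rightarrow> 'u symbol set \<Rightarrow> 'u set \<Rightarrow> bool" where
  "closed_under A \<tau> U \<longleftrightarrow> (\<forall>s\<in>\<tau>. \<forall>n. kind s = Function n \<longrightarrow> (\<forall>xs\<in>tuples n U. fn A s xs \<in> U))"

definition structures :: "'u symbol set \<Rightarrow> 'u struct set" where
  "structures \<tau> =
     {A. voc A = \<tau> \<and> univ A \<noteq> {} \<and> |univ A| <o |UNIV :: 'u set| \<and> closed_under A \<tau> (univ A)}"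

definition is_isomorphism :: "'u struct \<Rightarrow> 'u struct \<Rightarrow> ('u \<Rightarrow> 'u) \<Rightarrow> bool" where
  "is_isomorphism A B h \<longleftrightarrow>
     voc A = voc B \<and> bij_betw h (univ A) (univ B) \<and>
     (\<forall>s\<in>voc A. case kind s of
        Relation n \<Rightarrow> (\<forall>xs\<in>tuples n (univ A). rel A s xs \<longleftrightarrow> rel B s (map h xs))
      | Function n \<Rightarrow> (\<forall>xs\<in>tuples n (univ A). h (fn A s xs) = fn B s (map h xs)))"

definition reduct :: "'u struct \<Rightarrow> 'u symbol set \<Rightarrow> 'u struct" where
  "reduct A \<tau> = A\<lparr>voc := \<tau>\<rparr>"

definition substructure :: "'u struct \<Rightarrow> 'u set \<Rightarrow> 'u struct" where
  "substructure A U = A\<lparr>univ := U\<rparr>"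

definition expand :: "'u struct \<Rightarrow> 'u symbol list \<Rightarrow> 'u list \<Rightarrow> 'u struct" where
  "expand A cs as =
     A\<lparr>voc := voc A \<union> set cs,
       fn := (\<lambda>s xs. case map_of (zip cs as) s of Some a \<Rightarrow> a | None \<Rightarrow> fn A s xs)\<rparr>"

definition is_renaming :: "('u symbol \<Rightarrow> 'u symbol) \<Rightarrow> 'u symbol set \<Rightarrow> 'u symbol set \<Rightarrow> bool" where
  "is_renaming \<rho> \<sigma> \<tau> \<longleftrightarrow> bij_betw \<rho> \<sigma> \<tau> \<and> (\<forall>s\<in>\<sigma>. kind (\<rho> s) = kind s)"

definition rename :: "('u symbol \<Rightarrow> 'u symbol) \<Rightarrow> 'u struct \<Rightarrow> 'u struct" where
  "rename \<rho> A =
     \<lparr>voc = \<rho> ` voc A, univ = univ A,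
      rel = (\<lambda>s. rel A (inv_into (voc A) \<rho> s)),
      fn = (\<lambda>s. fn A (inv_into (voc A) \<rho> s))\<rparr>"


section \<open>Atomic sentences\<close>

datatype 'u closed_term = App "'u symbol" "'u closed_term list"

fun wf_term :: "'u symbol set \<Rightarrow> 'u closed_term \<Rightarrow> bool" where
  "wf_term \<tau> (App s ts) \<longleftrightarrow>
     s \<in> \<tau> \<and> kind s = Function (length ts) \<and> (\<forall>t\<in>set ts. wf_term \<tau> t)"

primrec term_value :: "'u struct \<Rightarrow> 'u closed_term \<Rightarrow> 'u" where
  "term_value A (App s ts) = fn A s (map (term_value A) ts)"

datatype 'u atomic = Eq "'u closed_term" "'u closed_term" | Rel "'u symbol" "'u closed_term list"

fun wf_atomic :: "'u symbol set \<Rightarrow> 'u atomic \<Rightarrow> bool" where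
  "wf_atomic \<tau> (Eq t u) \<longleftrightarrow> wf_term \<tau> t \<and> wf_term \<tau> u"
| "wf_atomic \<tau> (Rel s ts) \<longleftrightarrow> s \<in> \<tau> \<and> kind s = Relation (length ts) \<and> (\<forall>t\<in>set ts. wf_term \<tau> t)"

fun holds_atomic :: "'u struct \<Rightarrow> 'u atomic \<Rightarrow> bool" where
  "holds_atomic A (Eq t u) \<longleftrightarrow> term_value A t = term_value A u"
| "holds_atomic A (Rel s ts) \<longleftrightarrow> rel A s (map (term_value A) ts)"


section \<open>Logics\<close>

record ('u, 'f) logic =
  sentences :: "'u symbol set \<Rightarrow> 'f set"
  sat :: "'u struct \<Rightarrow> 'f \<Rightarrow> bool"

text \<open>
  A logic is given by its restriction to vocabularies \<open>\<tau>\<close>, to \<open>\<tau>\<close>-structures and to members of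
  \<open>sentences L \<tau>\<close>; other values of the two fields are never used.
\<close>

definition is_logic :: "('u, 'f) logic \<Rightarrow> bool" where
  "is_logic L \<longleftrightarrow>
     (\<forall>\<tau>. vocabulary \<tau> \<longrightarrow> |sentences L \<tau>| <o |UNIV :: 'u set| ) \<and>
     (\<forall>\<tau> \<sigma>. vocabulary \<sigma> \<and> \<tau> \<subseteq> \<sigma> \<longrightarrow> sentences L \<tau> \<subseteq> sentences L \<sigma>) \<and>
     (\<forall>\<tau>. vocabulary \<tau> \<longrightarrow>
        (\<forall>A\<in>structures \<tau>. \<forall>B\<in>structures \<tau>. \<forall>\<phi>\<in>sentences L \<tau>.
           (\<exists>h. is_isomorphism A B h) \<longrightarrow> (sat L A \<phi> \<longleftrightarrow> sat L B \<phi>))) \<and>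
     (\<forall>\<tau> \<sigma>. vocabulary \<sigma> \<and> \<tau> \<subseteq> \<sigma> \<longrightarrow>
        (\<forall>A\<in>structures \<sigma>. \<forall>\<phi>\<in>sentences L \<tau>. sat L A \<phi> \<longleftrightarrow> sat L (reduct A \<tau>) \<phi>)) \<and>
     (\<forall>\<tau> \<sigma> \<rho>. vocabulary \<tau> \<and> vocabulary \<sigma> \<and> is_renaming \<rho> \<tau> \<sigma> \<longrightarrow>
        (\<forall>\<phi>\<in>sentences L \<tau>. \<exists>\<psi>\<in>sentences L \<sigma>.
           \<forall>A\<in>structures \<tau>. sat L A \<phi> \<longleftrightarrow> sat L (rename \<rho> A) \<psi>))"

definition expresses_atomic :: "('u, 'f) logic \<Rightarrow> bool" where
  "expresses_atomic L \<longleftrightarrow>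
     (\<forall>\<tau> \<alpha>. vocabulary \<tau> \<and> wf_atomic \<tau> \<alpha> \<longrightarrow>
        (\<exists>\<psi>\<in>sentences L \<tau>. \<forall>A\<in>structures \<tau>. sat L A \<psi> \<longleftrightarrow> holds_atomic A \<alpha>))"

definition closed_negation :: "('u, 'f) logic \<Rightarrow> bool" where
  "closed_negation L \<longleftrightarrow>
     (\<forall>\<tau>. vocabulary \<tau> \<longrightarrow>
        (\<forall>\<phi>\<in>sentences L \<tau>. \<exists>\<psi>\<in>sentences L \<tau>.
           \<forall>A\<in>structures \<tau>. sat L A \<psi> \<longleftrightarrow> \<not> sat L A \<phi>))"

definition closed_conjunction :: "('u, 'f) logic \<Rightarrow> bool" where
  "closed_conjunction L \<longleftrightarrow>
     (\<forall>\<tau>. vocabulary \<tau> \<longrightarrow>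
        (\<forall>\<phi>\<in>sentences L \<tau>. \<forall>\<chi>\<in>sentences L \<tau>. \<exists>\<psi>\<in>sentences L \<tau>.
           \<forall>A\<in>structures \<tau>. sat L A \<psi> \<longleftrightarrow> sat L A \<phi> \<and> sat L A \<chi>))"

text \<open>
  As in the theory of abstract logics, a formula over \<open>\<tau>\<close> with free variables \<open>x\<^sub>1, \<dots>, x\<^sub>n\<close> is a
  sentence over \<open>\<tau>\<close> and \<open>n\<close> further constant symbols.
\<close>

definition closed_existential :: "('u, 'f) logic \<Rightarrow> bool" where
  "closed_existential L \<longleftrightarrow>
     (\<forall>\<tau> c. vocabulary \<tau> \<and> is_constant c \<and> c \<notin> \<tau> \<longrightarrow>
        (\<forall>\<phi>\<in>sentences L (insert c \<tau>). \<exists>\<psi>\<in>sentences L \<tau>.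
           \<forall>A\<in>structures \<tau>. sat L A \<psi> \<longleftrightarrow> (\<exists>a\<in>univ A. sat L (expand A [c] [a]) \<phi>)))"

definition closed_relativization :: "('u, 'f) logic \<Rightarrow> bool" where
  "closed_relativization L \<longleftrightarrow>
     (\<forall>\<tau> \<sigma> c. vocabulary \<sigma> \<and> \<tau> \<subseteq> \<sigma> \<and> is_constant c \<and> c \<notin> \<sigma> \<longrightarrow>
        (\<forall>\<phi>\<in>sentences L \<tau>. \<forall>\<delta>\<in>sentences L (insert c \<sigma>). \<exists>\<psi>\<in>sentences L \<sigma>.
           \<forall>A\<in>structures \<sigma>.
             let U = {a \<in> univ A. sat L (expand A [c] [a]) \<delta>}
             in U \<noteq> {} \<and> closed_under A \<tau> U \<longrightarrow>
                (sat L A \<psi> \<longleftrightarrow> sat L (substructure (reduct A \<tau>) U) \<phi>)))"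

text \<open>
  All symbols of \<open>\<tau>\<close>, of which there may be infinitely many, are replaced simultaneously:
  \<open>s\<close> is replaced by the formula \<open>\<delta> s\<close> in the variables \<open>vs s\<close>. A function symbol is replaced by
  a definition of its graph, the last variable standing for the value.
\<close>

definition num_vars :: "'u symbol \<Rightarrow> nat" where
  "num_vars s = (case kind s of Relation n \<Rightarrow> n | Function n \<Rightarrow> Suc n)"

definition sat_tuple :: "('u, 'f) logic \<Rightarrow> 'u struct \<Rightarrow> 'f \<Rightarrow> 'u symbol list \<Rightarrow> 'u list \<Rightarrow> bool" where
  "sat_tuple L A \<delta> vs xs \<longleftrightarrow> sat L (expand A vs xs) \<delta>"

definition defined_struct ::
  "('u, 'f) logic \<Rightarrow> 'u symbol set \<Rightarrow> ('u symbol \<Rightarrow> 'f) \<Rightarrow> ('u symbol \<Rightarrow> 'u symbol list) \<Rightarrow>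
   'u struct \<Rightarrow> 'u struct" where
  "defined_struct L \<tau> \<delta> vs A =
     \<lparr>voc = \<tau>, univ = univ A,
      rel = (\<lambda>s xs. sat_tuple L A (\<delta> s) (vs s) xs),
      fn = (\<lambda>s xs. THE y. y \<in> univ A \<and> sat_tuple L A (\<delta> s) (vs s) (xs @ [y]))\<rparr>"

definition closed_substitution :: "('u, 'f) logic \<Rightarrow> bool" where
  "closed_substitution L \<longleftrightarrow>
     (\<forall>\<tau> \<sigma> \<delta> vs. vocabulary \<tau> \<and> vocabulary \<sigma> \<and>
        (\<forall>s\<in>\<tau>. length (vs s) = num_vars s \<and> distinct (vs s) \<and>
           (\<forall>c\<in>set (vs s). is_constant c \<and> c \<notin> \<sigma>) \<and>
           \<delta> s \<in> sentences L (\<sigma> \<union> set (vs s))) \<longrightarrow>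
        (\<forall>\<phi>\<in>sentences L \<tau>. \<exists>\<psi>\<in>sentences L \<sigma>.
           \<forall>A\<in>structures \<sigma>.
             (\<forall>s\<in>\<tau>. \<forall>n. kind s = Function n \<longrightarrow>
                (\<forall>xs\<in>tuples n (univ A). \<exists>!y. y \<in> univ A \<and> sat_tuple L A (\<delta> s) (vs s) (xs @ [y]))) \<longrightarrow>
             (sat L A \<psi> \<longleftrightarrow> sat L (defined_struct L \<tau> \<delta> vs A) \<phi>)))"

definition regular_logic :: "('u, 'f) logic \<Rightarrow> bool" where
  "regular_logic L \<longleftrightarrow>
     is_logic L \<and> expresses_atomic L \<and> closed_negation L \<and> closed_conjunction L \<and>
     closed_existential L \<and> closed_relativization L \<and> closed_substitution L"

definition has_model :: "('u, 'f) logic \<Rightarrow> 'u symbol set \<Rightarrow> 'f set \<Rightarrow> bool" where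
  "has_model L \<tau> \<Gamma> \<longleftrightarrow> (\<exists>A\<in>structures \<tau>. \<forall>\<phi>\<in>\<Gamma>. sat L A \<phi>)"

text \<open>
  Every set of sentences lies in \<open>sentences L \<tau>\<close> for some vocabulary \<open>\<tau>\<close>, and by the reduct
  property it does not matter which such \<open>\<tau>\<close> is used for its models.
\<close>

definition compact_logic :: "'a rel \<Rightarrow> 'b rel \<Rightarrow> ('u, 'f) logic \<Rightarrow> bool" where
  "compact_logic \<nu> \<mu> L \<longleftrightarrow>
     (\<forall>\<tau> \<Gamma> \<Sigma>. vocabulary \<tau> \<and> \<Gamma> \<subseteq> sentences L \<tau> \<and> \<Sigma> \<subseteq> sentences L \<tau> \<and> |\<Sigma>| \<le>o \<nu> \<and>
        (\<forall>\<Sigma>'\<subseteq>\<Sigma>. |\<Sigma>'| <o \<mu> \<longrightarrow> has_model L \<tau> (\<Gamma> \<union> \<Sigma>')) \<longrightarrow>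
        has_model L \<tau> (\<Gamma> \<union> \<Sigma>))"

end

theory Submission
  imports Defs
begin

text \<open>
  Compactness of a regular logic is governed by ultrafilters. Say that \<open>L\<close> is ultra-compact for
  an ultrafilter \<open>D\<close> over \<open>I\<close> if every family of structures indexed by \<open>I\<close> has a limit: a
  structure that satisfies every sentence of \<open>L\<close> true in \<open>D\<close>-almost all members of the family.
  Ultraproducts are limits for first-order logic; for other logics limits need not be
  ultraproducts. If \<open>L\<close> is ultra-compact for a \<open>(\<mu>,\<mu>)\<close>-regular \<open>D\<close>, then \<open>L\<close> is
  \<open>[\<mu>,\<mu>]\<close>-compact: the regular family attaches fewer than \<open>\<mu>\<close> sentences to each index, and a
  limit of models of these satisfies all of them (\<open>ultra_compact_compact_logic\<close>). Conversely, a
  \<open>[\<lambda>,\<lambda>]\<close>-compact \<open>L\<close> is ultra-compact for some \<open>(\<lambda>,\<lambda>)\<close>-regular \<open>D\<close>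
  (\<open>compact_logic_regular_ultrafilter\<close>). Otherwise each candidate \<open>D\<close> has a family without limit;
  all these families are coded in one structure with an index as a parameter, and compactness
  yields a model in which the parameter behaves like a generic index. The sets containing
  the generic index form a candidate \<open>D\<close>, and the structure coded there is a limit
  of the family chosen for this \<open>D\<close>, a contradiction. So the theorem reduces to statements
  about regularity of ultrafilters.

  These are proved by counting functions modulo \<open>D\<close>. If \<open>D\<close> is \<open>(\<lambda>,\<lambda>)\<close>-regular, diagonalization
  gives more than \<open>\<lambda>\<close> functions into \<open>\<lambda>\<close> that differ modulo \<open>D\<close>
  (\<open>regular_ultrafilter_many_functions\<close>). Suppose that \<open>D\<close> is decomposable for no cardinal between
  \<open>\<kappa>\<close> and \<open>2\<^sup>\<kappa>\<close>. Then every function into \<open>2\<^sup>\<kappa>\<close> has fewer than \<open>\<kappa>\<close> values modulo \<open>D\<close>,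
  and an argument of Silver gives one such function through which all others factor
  (\<open>exists_finest_function\<close>); so there are only \<open>2\<^sup>\<kappa>\<close> of them. Such bounds pass from \<open>\<lambda>\<close> to
  \<open>2\<^sup>\<lambda>\<close>, because a function into the subsets of \<open>\<lambda>\<close> is determined modulo \<open>D\<close> by the functions
  that are almost everywhere elements of it (\<open>few_functions_Pow\<close>). The bound for \<open>2\<^sup>\<lambda>\<close>
  also passes from \<open>\<lambda>\<close> to \<open>\<lambda>\<^sup>+\<close>, because functions into \<open>\<lambda>\<^sup>+\<close> are bounded modulo \<open>D\<close>:
  unboundedness descends from a successor to its predecessor if the predecessor is regular
  (\<open>successor_descent\<close>), and an unbounded function into \<open>\<kappa>\<^sup>+ \<le> 2\<^sup>\<kappa>\<close> would decompose \<open>D\<close>.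
  Hence \<open>D\<close> is not regular for \<open>beth m (succ_card n \<kappa>)\<close> if \<open>m \<ge> 1\<close>.

  If \<open>\<kappa>\<close> is a strong limit, \<open>U'(\<kappa>)\<close> holds and \<open>D\<close> is not \<open>(\<kappa>,\<kappa>)\<close>-regular, then functions into
  \<open>\<kappa>\<close> are bounded modulo \<open>D\<close>, and \<open>D\<close> is decomposable for no cardinal in some final segment below
  \<open>\<kappa>\<close>. The bounds now hold below \<open>\<kappa>\<close>, hence at \<open>\<kappa>\<close> by boundedness. They propagate as before,
  since an unbounded function into \<open>\<kappa>\<^sup>+\<close> would descend to \<open>\<kappa>\<close> if \<open>\<kappa>\<close> is regular, and otherwise to
  regular cardinals in the final segment.
\<close>

section \<open>Cardinal preliminaries\<close>

lemma card_order_total: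
  "Card_order r \<Longrightarrow> a \<in> Field r \<Longrightarrow> b \<in> Field r \<Longrightarrow> (a, b) \<in> r \<or> (b, a) \<in> r"
  by (metis card_order_on_well_order_on wo_rel.TOTALS wo_rel_def)

lemma card_order_refl: "Card_order r \<Longrightarrow> a \<in> Field r \<Longrightarrow> (a, a) \<in> r"
  using card_order_total by fast

lemma card_order_antisym: "Card_order r \<Longrightarrow> (a, b) \<in> r \<Longrightarrow> (b, a) \<in> r \<Longrightarrow> a = b"
  by (meson antisymD card_order_on_well_order_on wo_rel.ANTISYM wo_rel.intro)

lemma card_order_transitive: "Card_order r \<Longrightarrow> (a, b) \<in> r \<Longrightarrow> (b, c) \<in> r \<Longrightarrow> (a, c) \<in> r"
  by (meson transD card_order_on_well_order_on wo_rel.TRANS wo_rel.intro)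

lemma card_of_ordLeq_inj: "inj_on f A \<Longrightarrow> f ` A \<subseteq> B \<Longrightarrow> |A| \<le>o |B|"
  using card_of_ordLeq[of A B] by blast

lemma card_of_ordLeq_ex_inj: "|A| \<le>o |B| \<Longrightarrow> \<exists>f. inj_on f A \<and> f ` A \<subseteq> B"
  using card_of_ordLeq[of A B] by blast

lemma card_of_Field_ordIso': "Card_order r \<Longrightarrow> r =o |Field r|"
  by (rule ordIso_symmetric[OF card_of_Field_ordIso])

lemma card_order_not_ordLeq_ordLess:
  "Card_order r \<Longrightarrow> Card_order s \<Longrightarrow> \<not> r \<le>o s \<Longrightarrow> s <o r"
  by (rule not_ordLeq_iff_ordLess[OF card_order_on_well_order_on card_order_on_well_order_on, THEN iffD1])

lemma card_of_Pow_mono: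
  assumes "|A| \<le>o |B|"
  shows "|Pow A| \<le>o |Pow B|"
proof -
  obtain f where f: "inj_on f A" "f ` A \<subseteq> B"
    using assms card_of_ordLeq by metis
  have "inj_on ((`) f) (Pow A)"
    using f(1) by (auto simp: inj_on_def) (metis inj_onI f(1) inj_on_image_eq_iff subset_iff)+
  moreover have "((`) f) ` Pow A \<subseteq> Pow B" using f(2) by blast
  ultimately show ?thesis by (rule card_of_ordLeq_inj)
qed

lemma card_of_Pow_cong: "|A| =o |B| \<Longrightarrow> |Pow A| =o |Pow B|"
  unfolding ordIso_iff_ordLeq by (simp add: card_of_Pow_mono)

lemma ctwo_cexp_Pow: "ctwo ^c r =o |Pow (Field r)|"
  unfolding cexp_def ctwo_def Field_card_of by (rule ordIso_symmetric[OF card_of_Pow_Func])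

lemma card_of_Times_ordLess_infinite:
  assumes "Cinfinite r" "|A| <o r"
  shows "|A \<times> A| <o r"
proof (cases "finite A")
  case True
  then show ?thesis
    using assms(1) unfolding cinfinite_def
    by (intro Cfinite_ordLess_Cinfinite assms(1) conjI card_of_Card_order)
      (simp add: cfinite_def Field_card_of)
next
  case False
  then show ?thesis
    by (rule ordIso_ordLess_trans[OF card_of_Times_same_infinite assms(2)])
qed

section \<open>Functions modulo an ultrafilter\<close>

lemma ultrafilter_subset: "ultrafilter_on I D \<Longrightarrow> X \<in> D \<Longrightarrow> X \<subseteq> I"
  unfolding ultrafilter_on_def by (elim conjE) (drule (1) subsetD, erule PowD)

lemma ultrafilter_empty: "ultrafilter_on I D \<Longrightarrow> {} \<notin> D"
  unfolding ultrafilter_on_def by (elim conjE)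

lemma ultrafilter_Int: "ultrafilter_on I D \<Longrightarrow> X \<in> D \<Longrightarrow> Y \<in> D \<Longrightarrow> X \<inter> Y \<in> D"
  unfolding ultrafilter_on_def by (elim conjE) (drule (1) bspec, drule (1) bspec, assumption)

lemma ultrafilter_mono: "ultrafilter_on I D \<Longrightarrow> X \<in> D \<Longrightarrow> X \<subseteq> Y \<Longrightarrow> Y \<subseteq> I \<Longrightarrow> Y \<in> D"
  unfolding ultrafilter_on_def by (elim conjE) simp

lemma ultrafilter_compl: "ultrafilter_on I D \<Longrightarrow> X \<subseteq> I \<Longrightarrow> X \<notin> D \<Longrightarrow> I - X \<in> D"
  unfolding ultrafilter_on_def by (elim conjE allE[of _ X]) simp

lemma ultrafilter_Collect_mono:
  "ultrafilter_on I D \<Longrightarrow> X \<in> D \<Longrightarrow> (\<And>i. i \<in> I \<Longrightarrow> i \<in> X \<Longrightarrow> P i) \<Longrightarrow> {i \<in> I. P i} \<in> D"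
  by (rule ultrafilter_mono[of I D X]) (auto dest: ultrafilter_subset)

lemma ultrafilter_not: "ultrafilter_on I D \<Longrightarrow> {i \<in> I. P i} \<notin> D \<Longrightarrow> {i \<in> I. \<not> P i} \<in> D"
proof -
  assume *: "ultrafilter_on I D" "{i \<in> I. P i} \<notin> D"
  have "I - {i \<in> I. P i} \<in> D" using * by (intro ultrafilter_compl) auto
  moreover have "I - {i \<in> I. P i} = {i \<in> I. \<not> P i}" by blast
  ultimately show ?thesis by simp
qed

lemma ultrafilter_witness: "ultrafilter_on I D \<Longrightarrow> X \<in> D \<Longrightarrow> \<exists>i. i \<in> I \<and> i \<in> X"
  by (metis ultrafilter_empty ultrafilter_subset equals0I subsetD)

text \<open>
  The ultrapower of \<open>Y\<close> by \<open>D\<close> has at most \<open>r\<close> elements. Representatives may take values outside \<open>Y\<close>.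
\<close>

definition few_functions :: "'i set \<Rightarrow> 'i set set \<Rightarrow> 'b set \<Rightarrow> 'c rel \<Rightarrow> bool" where
  "few_functions I D Y r \<longleftrightarrow>
     (\<exists>H :: ('i \<Rightarrow> 'b) set. |H| \<le>o r \<and> (\<forall>g. g ` I \<subseteq> Y \<longrightarrow> (\<exists>h\<in>H. {i \<in> I. g i = h i} \<in> D)))"

text \<open>
  The constant functions are cofinal in the ultrapower of \<open>r\<close>.
\<close>

definition bounded_functions :: "'i set \<Rightarrow> 'i set set \<Rightarrow> 'c rel \<Rightarrow> bool" where
  "bounded_functions I D r \<longleftrightarrow>
     (\<forall>f. f ` I \<subseteq> Field r \<longrightarrow> (\<exists>a\<in>Field r. {i \<in> I. (f i, a) \<in> r} \<in> D))"

lemma few_functions_by_code: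
  fixes Y :: "'b set" and c :: "('i \<Rightarrow> 'b) \<Rightarrow> 'c"
  assumes c: "\<And>g. g ` I \<subseteq> Y \<Longrightarrow> c g \<in> C" and C: "|C| \<le>o r"
    and eq: "\<And>g h. g ` I \<subseteq> Y \<Longrightarrow> h ` I \<subseteq> Y \<Longrightarrow> c g = c h \<Longrightarrow> {i \<in> I. g i = h i} \<in> D"
  shows "few_functions I D Y r"
  unfolding few_functions_def
proof (intro exI conjI allI impI)
  let ?H = "(\<lambda>x. SOME g. g ` I \<subseteq> Y \<and> c g = x) ` C"
  show "|?H| \<le>o r" by (rule ordLeq_transitive[OF card_of_image C])
  fix g :: "'i \<Rightarrow> 'b" assume g: "g ` I \<subseteq> Y"
  let ?h = "SOME h. h ` I \<subseteq> Y \<and> c h = c g"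
  have "?h ` I \<subseteq> Y \<and> c ?h = c g" by (rule someI[of _ g]) (simp add: g)
  then show "\<exists>h\<in>?H. {i \<in> I. g i = h i} \<in> D"
    using eq[OF g, of ?h] c[OF g] by (intro bexI[of _ ?h]) auto
qed

lemma few_functions_mono: "few_functions I D Y r \<Longrightarrow> r \<le>o s \<Longrightarrow> few_functions I D Y s"
  unfolding few_functions_def by (elim exE conjE) (rule exI, rule conjI, erule (1) ordLeq_transitive)

lemma few_functions_inj:
  fixes Y :: "'b set" and Y' :: "'c set"
  assumes D: "ultrafilter_on I D" and few: "few_functions I D Y r" and le: "|Y'| \<le>o |Y|"
  shows "few_functions I D Y' r"
proof -
  obtain H where H: "|H| \<le>o r" "\<And>g. g ` I \<subseteq> Y \<Longrightarrow> \<exists>h\<in>H. {i \<in> I. g i = h i} \<in> D"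
    using few unfolding few_functions_def by blast
  obtain e where e: "inj_on e Y'" "e ` Y' \<subseteq> Y" using le card_of_ordLeq by metis
  define c where "c g = (SOME h. h \<in> H \<and> {i \<in> I. e (g i) = h i} \<in> D)" for g
  have c: "c g \<in> H \<and> {i \<in> I. e (g i) = c g i} \<in> D" if "g ` I \<subseteq> Y'" for g
  proof -
    have "\<exists>h. h \<in> H \<and> {i \<in> I. e (g i) = h i} \<in> D"
      using H(2)[of "\<lambda>i. e (g i)"] that e(2) by blast
    then show ?thesis unfolding c_def by (rule someI_ex)
  qed
  show ?thesis
  proof (rule few_functions_by_code[of I Y' c H])
    fix g h assume g: "g ` I \<subseteq> Y'" and h: "h ` I \<subseteq> Y'" and eq: "c g = c h"
    have "{i \<in> I. e (g i) = c g i} \<inter> {i \<in> I. e (h i) = c g i} \<in> D"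
      using c[OF g] c[OF h] unfolding eq by (intro ultrafilter_Int[OF D]) simp_all
    then show "{i \<in> I. g i = h i} \<in> D"
    proof (rule ultrafilter_Collect_mono[OF D])
      fix i assume i: "i \<in> I" "i \<in> {i \<in> I. e (g i) = c g i} \<inter> {i \<in> I. e (h i) = c g i}"
      then have "e (g i) = e (h i)" by simp
      then show "g i = h i" using e(1) g h i(1) unfolding inj_on_def by blast
    qed
  qed (use c H in auto)
qed

text \<open>
  In the ultrapower, subset-valued functions represent subsets, and distinct ones differ in some
  element. So \<open>g\<close> can be coded by the representatives \<open>h\<close> with \<open>h i \<in> g i\<close> for almost all \<open>i\<close>.
\<close>

lemma few_functions_Pow:
  fixes Y :: "'b set"
  assumes D: "ultrafilter_on I D" and few: "few_functions I D Y r" and r: "Card_order r"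
  shows "few_functions I D (Pow Y) |Pow (Field r)|"
proof -
  obtain H where H: "|H| \<le>o r" "\<And>g. g ` I \<subseteq> Y \<Longrightarrow> \<exists>h\<in>H. {i \<in> I. g i = h i} \<in> D"
    using few unfolding few_functions_def by blast
  define c where "c g = {h \<in> H. {i \<in> I. h i \<in> g i} \<in> D}" for g
  show ?thesis
  proof (rule few_functions_by_code[of I "Pow Y" c "Pow H"])
    have "|H| \<le>o |Field r|"
      by (rule ordLeq_ordIso_trans[OF H(1) card_of_Field_ordIso'[OF r]])
    then show "|Pow H| \<le>o |Pow (Field r)|" by (rule card_of_Pow_mono)
  next
    fix g h assume g: "g ` I \<subseteq> Pow Y" and h: "h ` I \<subseteq> Pow Y" and eq: "c g = c h"
    show "{i \<in> I. g i = h i} \<in> D"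
    proof (rule ccontr)
      assume "{i \<in> I. g i = h i} \<notin> D"
      then have neq: "{i \<in> I. g i \<noteq> h i} \<in> D" by (rule ultrafilter_not[OF D])
      then obtain i0 where i0: "i0 \<in> I" "g i0 \<noteq> h i0" using ultrafilter_witness[OF D] by blast
      then obtain y0 where y0: "y0 \<in> Y" using g h by (metis Pow_iff image_subset_iff subsetI subset_antisym subset_iff)
      define e where "e i = (if g i = h i then y0 else SOME y. (y \<in> g i) \<noteq> (y \<in> h i))" for i
      have e: "(e i \<in> g i) \<noteq> (e i \<in> h i)" if "g i \<noteq> h i" for i
        unfolding e_def using that someI_ex[of "\<lambda>y. (y \<in> g i) \<noteq> (y \<in> h i)"] by auto
      have "e ` I \<subseteq> Y"
      proof
        fix y assume "y \<in> e ` I"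
        then obtain i where i: "i \<in> I" "y = e i" by blast
        show "y \<in> Y"
        proof (cases "g i = h i")
          case True then show ?thesis using i y0 by (simp add: e_def)
        next
          case False then show ?thesis using e[of i] i g h by blast
        qed
      qed
      then obtain k where k: "k \<in> H" "{i \<in> I. e i = k i} \<in> D" using H(2) by blast
      let ?N = "{i \<in> I. e i = k i} \<inter> {i \<in> I. g i \<noteq> h i}"
      have N: "?N \<in> D" using k(2) neq ultrafilter_Int[OF D] by blast
      show False
      proof (cases "k \<in> c g")
        case True
        moreover have "k \<in> c h" using True eq by simp
        ultimately have "{i \<in> I. k i \<in> g i} \<inter> {i \<in> I. k i \<in> h i} \<inter> ?N \<in> D"
          unfolding c_def by (intro ultrafilter_Int[OF D] N) simp_all
        then obtain i where "i \<in> {i \<in> I. k i \<in> g i} \<inter> {i \<in> I. k i \<in> h i} \<inter> ?N"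
          using ultrafilter_witness[OF D] by blast
        then show False using e[of i] by auto
      next
        case False
        then have "{i \<in> I. k i \<in> g i} \<notin> D" "{i \<in> I. k i \<in> h i} \<notin> D"
          using eq k(1) by (auto simp: c_def)
        then have "{i \<in> I. k i \<notin> g i} \<inter> {i \<in> I. k i \<notin> h i} \<inter> ?N \<in> D"
          by (intro ultrafilter_Int[OF D] N ultrafilter_not[OF D])
        then obtain i where "i \<in> {i \<in> I. k i \<notin> g i} \<inter> {i \<in> I. k i \<notin> h i} \<inter> ?N"
          using ultrafilter_witness[OF D] by blast
        then show False using e[of i] by auto
      qed
    qed
  qed (auto simp: c_def)
qed

text \<open>
  A regular family in its dual form: each index lies in few of the sets.
\<close>

lemma regular_ultrafilter_small_index:
  fixes r :: "'c rel"
  assumes "Card_order r" "regular_ultrafilter r D" "ultrafilter_on I D"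
  obtains X where "\<And>a. a \<in> Field r \<Longrightarrow> X a \<in> D" "\<And>i. |{a \<in> Field r. i \<in> X a}| <o r"
proof -
  obtain X where X: "\<forall>a\<in>Field r. X a \<in> D"
      "\<forall>A. A \<subseteq> Field r \<and> |A| =o r \<longrightarrow> (\<Inter>a\<in>A. X a) = {}"
    using assms(2) unfolding regular_ultrafilter_def by blast
  have "|{a \<in> Field r. i \<in> X a}| <o r" for i
  proof -
    let ?A = "{a \<in> Field r. i \<in> X a}"
    have "i \<in> (\<Inter>a\<in>?A. X a)" by blast
    then have "\<not> |?A| =o r" using X(2) by (metis (no_types, lifting) empty_iff mem_Collect_eq subsetI)
    moreover have "|?A| \<le>o |Field r|" by (rule card_of_mono1) blast
    then have "|?A| \<le>o r" by (rule ordLeq_ordIso_trans[OF _ card_of_Field_ordIso[OF assms(1)]])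
    ultimately show ?thesis using ordLeq_iff_ordLess_or_ordIso by metis
  qed
  then show ?thesis using X(1) that by blast
qed

text \<open>
  Diagonalization: given \<open>r\<close> functions, indexed by the regular family, choose the value at \<open>i\<close>
  outside the values of those whose set contains \<open>i\<close>. There are fewer than \<open>r\<close> of these, and on its
  own set each function is avoided.
\<close>

lemma regular_ultrafilter_many_functions:
  fixes r :: "'c rel" and Y :: "'b set"
  assumes D: "ultrafilter_on I D" and r: "Card_order r" and reg: "regular_ultrafilter r D"
    and Y: "r \<le>o |Y|"
  shows "\<not> few_functions I D Y r"
proof
  assume "few_functions I D Y r"
  then obtain H :: "('a \<Rightarrow> 'b) set" where
    H: "|H| \<le>o r" "\<And>g. g ` I \<subseteq> Y \<Longrightarrow> \<exists>h\<in>H. {i \<in> I. g i = h i} \<in> D"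
    unfolding few_functions_def by blast
  obtain X where X: "\<And>a. a \<in> Field r \<Longrightarrow> X a \<in> D" "\<And>i. |{a \<in> Field r. i \<in> X a}| <o r"
    using regular_ultrafilter_small_index[OF r reg D] by blast
  have "|H| \<le>o |Field r|"
    by (rule ordLeq_ordIso_trans[OF H(1) card_of_Field_ordIso'[OF r]])
  then obtain k where k: "inj_on k H" "k ` H \<subseteq> Field r" using card_of_ordLeq by metis
  have "\<exists>y. y \<in> Y \<and> (\<forall>h\<in>H. i \<in> X (k h) \<longrightarrow> y \<noteq> h i)" for i
  proof -
    let ?A = "{h \<in> H. i \<in> X (k h)}"
    have "k ` ?A \<subseteq> {a \<in> Field r. i \<in> X a}" using k(2) by blast
    moreover have "inj_on k ?A" using k(1) by (rule inj_on_subset) blast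
    ultimately have "|?A| \<le>o |{a \<in> Field r. i \<in> X a}|" by (intro card_of_ordLeq_inj)
    then have "|(\<lambda>h. h i) ` ?A| <o |Y|"
      by (rule ordLess_ordLeq_trans[OF ordLeq_ordLess_trans[OF ordLeq_transitive[OF card_of_image] X(2)] Y])
    then have "\<not> |Y| \<le>o |(\<lambda>h. h i) ` ?A|" by (rule not_ordLess_ordLeq)
    then have "\<not> Y \<subseteq> (\<lambda>h. h i) ` ?A" using card_of_mono1 by (rule contrapos_nn)
    then show ?thesis by blast
  qed
  then obtain f where f: "\<And>i. f i \<in> Y" "\<And>i h. h \<in> H \<Longrightarrow> i \<in> X (k h) \<Longrightarrow> f i \<noteq> h i"
    by metis
  then obtain h where h: "h \<in> H" "{i \<in> I. f i = h i} \<in> D" using H(2)[of f] by blast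
  then have "X (k h) \<inter> {i \<in> I. f i = h i} \<in> D" using X(1) k(2) ultrafilter_Int[OF D] by blast
  then show False using ultrafilter_witness[OF D] f(2)[OF h(1)] by blast
qed

section \<open>Decomposability, regularity and bounded functions\<close>

text \<open>
  If \<open>f\<close> decomposes \<open>D\<close>, the sets \<open>{i. a \<le> f i}\<close> form a regular family, as only the \<open>a \<le> f i\<close> have
  sets containing \<open>i\<close>.
\<close>

lemma decomposable_regular_ultrafilter:
  fixes r :: "'c rel"
  assumes D: "ultrafilter_on I D" and r: "Cinfinite r" and dec: "decomposable r I D"
  shows "regular_ultrafilter r D"
proof -
  obtain f where f: "f ` I \<subseteq> Field r"
      "\<And>X. X \<subseteq> Field r \<Longrightarrow> |X| <o r \<Longrightarrow> {i \<in> I. f i \<in> X} \<notin> D"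
    using dec unfolding decomposable_def by metis
  define X where "X a = {i \<in> I. f i \<notin> underS r a}" for a
  have "X a \<in> D" if "a \<in> Field r" for a
  proof -
    have "{i \<in> I. f i \<in> underS r a} \<notin> D"
      by (rule f(2)[OF subsetI[OF underS_Field] card_of_underS]) (use r that in simp_all)
    then show ?thesis unfolding X_def by (rule ultrafilter_not[OF D])
  qed
  moreover have "(\<Inter>a\<in>A. X a) = {}" if A: "A \<subseteq> Field r" "|A| =o r" for A
  proof (rule ccontr)
    assume "(\<Inter>a\<in>A. X a) \<noteq> {}"
    then obtain i where i: "\<And>a. a \<in> A \<Longrightarrow> i \<in> X a" by blast
    have "\<not> finite A"
      using card_of_ordIso_finite_Field[of r A] ordIso_symmetric[OF A(2)] r unfolding cinfinite_def by simp
    then have "i \<in> I" using i unfolding X_def by (metis (no_types, lifting) finite.emptyI mem_Collect_eq ex_in_conv)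
    then have fi: "f i \<in> Field r" using f(1) by blast
    obtain b where b: "b \<in> Field r" "f i \<noteq> b" "(f i, b) \<in> r"
      using infinite_Card_order_limit r fi unfolding cinfinite_def by metis
    have "A \<subseteq> underS r b"
    proof
      fix a assume a: "a \<in> A"
      then have "f i \<notin> underS r a" using i unfolding X_def by blast
      then have "(a, f i) \<in> r \<or> a = f i"
        using card_order_total[of r a "f i"] r a A(1) fi unfolding underS_def by blast
      then have "(a, b) \<in> r" using card_order_transitive[of r a "f i" b] r b(3) by blast
      moreover have "a \<noteq> b"
        using \<open>(a, f i) \<in> r \<or> a = f i\<close> b card_order_antisym r by metis
      ultimately show "a \<in> underS r b" unfolding underS_def by blast
    qed
    then have "|A| \<le>o |underS r b|" by (rule card_of_mono1)
    moreover have "|underS r (b)| <o r" by (rule card_of_underS) (use r b(1) in simp_all)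
    ultimately have "|A| <o r" by (rule ordLeq_ordLess_trans)
    then show False using A(2) by (simp add: not_ordLess_ordIso)
  qed
  ultimately show ?thesis unfolding regular_ultrafilter_def by blast
qed

text \<open>
  For a singular \<open>r\<close>, a function unbounded modulo \<open>D\<close> may have a small range and need not decompose
  \<open>D\<close>, but the sets \<open>{i. a < f i}\<close> are still a regular family.
\<close>

lemma not_bounded_regular_ultrafilter:
  fixes r :: "'c rel"
  assumes D: "ultrafilter_on I D" and r: "Cinfinite r" and nb: "\<not> bounded_functions I D r"
  shows "regular_ultrafilter r D"
proof -
  obtain f where f: "f ` I \<subseteq> Field r" "\<And>a. a \<in> Field r \<Longrightarrow> {i \<in> I. (f i, a) \<in> r} \<notin> D"
    using nb unfolding bounded_functions_def by blast
  define X where "X a = {i \<in> I. (f i, a) \<notin> r}" for a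
  have "X a \<in> D" if "a \<in> Field r" for a
    unfolding X_def by (rule ultrafilter_not[OF D f(2)[OF that]])
  moreover have "(\<Inter>a\<in>A. X a) = {}" if A: "A \<subseteq> Field r" "|A| =o r" for A
  proof (rule ccontr)
    assume "(\<Inter>a\<in>A. X a) \<noteq> {}"
    then obtain i where i: "\<And>a. a \<in> A \<Longrightarrow> i \<in> X a" by blast
    have "\<not> finite A"
      using card_of_ordIso_finite_Field[of r A] ordIso_symmetric[OF A(2)] r unfolding cinfinite_def by simp
    then have "i \<in> I" using i unfolding X_def by (metis (no_types, lifting) finite.emptyI mem_Collect_eq ex_in_conv)
    then have fi: "f i \<in> Field r" using f(1) by blast
    have "A \<subseteq> underS r (f i)"
    proof
      fix a assume a: "a \<in> A"
      then have "(f i, a) \<notin> r" using i unfolding X_def by blast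
      then show "a \<in> underS r (f i)"
        using card_order_total[of r a "f i"] card_order_refl[of r a] r a A(1) fi unfolding underS_def by blast
    qed
    then have "|A| \<le>o |underS r (f i)|" by (rule card_of_mono1)
    moreover have "|underS r (f i)| <o r" by (rule card_of_underS) (use r fi in simp_all)
    ultimately have "|A| <o r" by (rule ordLeq_ordLess_trans)
    then show False using A(2) by (simp add: not_ordLess_ordIso)
  qed
  ultimately show ?thesis unfolding regular_ultrafilter_def by blast
qed

lemma not_cofinal_bound:
  assumes "Cinfinite r" "regularCard r" "B \<subseteq> Field r" "|B| <o r"
  obtains a where "a \<in> Field r" "\<And>b. b \<in> B \<Longrightarrow> (b, a) \<in> r"
proof -
  have "cofinal B r \<Longrightarrow> |B| =o r"
    using assms(2,3) unfolding regularCard_def by simp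
  then have "\<not> cofinal B r" using not_ordLess_ordIso[OF assms(4)] by blast
  then obtain a where a: "a \<in> Field r" "\<forall>b\<in>B. \<not> (a \<noteq> b \<and> (a, b) \<in> r)"
    unfolding cofinal_def by blast
  then show ?thesis
    using that[of a] card_order_total[of r a] card_order_refl[of r a] assms(1,3) by (metis subsetD)
qed

lemma not_bounded_decomposable:
  fixes r :: "'c rel"
  assumes D: "ultrafilter_on I D" and r: "Cinfinite r" "regularCard r"
    and nb: "\<not> bounded_functions I D r"
  shows "decomposable r I D"
proof -
  obtain f where f: "f ` I \<subseteq> Field r" "\<And>a. a \<in> Field r \<Longrightarrow> {i \<in> I. (f i, a) \<in> r} \<notin> D"
    using nb unfolding bounded_functions_def by blast
  have "{i \<in> I. f i \<in> X} \<notin> D" if X: "X \<subseteq> Field r" "|X| <o r" for X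
  proof
    assume *: "{i \<in> I. f i \<in> X} \<in> D"
    obtain a where a: "a \<in> Field r" "\<And>b. b \<in> X \<Longrightarrow> (b, a) \<in> r"
      using not_cofinal_bound[OF r X] by blast
    then have "{i \<in> I. (f i, a) \<in> r} \<in> D"
      by (intro ultrafilter_Collect_mono[OF D *]) simp
    then show False using f(2) a(1) by blast
  qed
  then show ?thesis unfolding decomposable_def using f(1) by blast
qed

text \<open>
  Map \<open>i\<close> to an upper bound of the \<open>a\<close> with \<open>i \<in> X a\<close>: it exists since \<open>r\<close> is regular, and it is at
  least \<open>b\<close> on \<open>X b\<close>.
\<close>

lemma sparse_family_not_bounded:
  fixes r :: "'c rel"
  assumes D: "ultrafilter_on I D" and r: "Cinfinite r" "regularCard r"
    and X: "\<And>a. a \<in> Field r \<Longrightarrow> X a \<in> D" "\<And>i. i \<in> I \<Longrightarrow> |{a \<in> Field r. i \<in> X a}| <o r"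
  shows "\<not> bounded_functions I D r"
proof
  assume bd: "bounded_functions I D r"
  have "\<exists>b. b \<in> Field r \<and> (\<forall>a\<in>Field r. i \<in> X a \<longrightarrow> (a, b) \<in> r)" if "i \<in> I" for i
    using not_cofinal_bound[OF r _ X(2)[OF that]] by (metis (no_types, lifting) mem_Collect_eq subsetI)
  then obtain f where f: "\<And>i. i \<in> I \<Longrightarrow> f i \<in> Field r"
      "\<And>i a. i \<in> I \<Longrightarrow> a \<in> Field r \<Longrightarrow> i \<in> X a \<Longrightarrow> (a, f i) \<in> r"
    by metis
  then obtain a where a: "a \<in> Field r" "{i \<in> I. (f i, a) \<in> r} \<in> D"
    using bd unfolding bounded_functions_def by blast
  obtain b where b: "b \<in> Field r" "a \<noteq> b" "(a, b) \<in> r"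
    using infinite_Card_order_limit r a(1) unfolding cinfinite_def by metis
  have "X b \<inter> {i \<in> I. (f i, a) \<in> r} \<in> D" using X(1)[OF b(1)] a(2) ultrafilter_Int[OF D] by blast
  then obtain i where "i \<in> I" "i \<in> X b" "(f i, a) \<in> r" using ultrafilter_witness[OF D] by blast
  then have "(b, a) \<in> r" using f(2)[of i b] b(1) card_order_transitive[of r b "f i" a] r by blast
  then show False using b card_order_antisym[of r a b] r by blast
qed

lemma regular_ultrafilter_not_bounded:
  fixes r :: "'c rel"
  assumes D: "ultrafilter_on I D" and r: "Cinfinite r" "regularCard r" and reg: "regular_ultrafilter r D"
  shows "\<not> bounded_functions I D r"
proof -
  obtain X where "\<And>a. a \<in> Field r \<Longrightarrow> X a \<in> D" "\<And>i. |{a \<in> Field r. i \<in> X a}| <o r"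
    using regular_ultrafilter_small_index[OF _ reg D] r(1) by blast
  then show ?thesis using sparse_family_not_bounded[OF D r] by blast
qed

section \<open>Minimal images and decomposability\<close>

lemma minimal_image:
  assumes D: "ultrafilter_on I D"
  obtains X where "X \<in> D" "\<And>Z. Z \<in> D \<Longrightarrow> |g ` X| \<le>o |g ` Z|"
proof -
  have "I \<in> D" using D unfolding ultrafilter_on_def by (elim conjE)
  then have "(\<lambda>X. |g ` X| ) ` D \<noteq> {}" by blast
  then obtain r where "r \<in> (\<lambda>X. |g ` X| ) ` D" "\<forall>s\<in>(\<lambda>X. |g ` X| ) ` D. r \<le>o s"
    using exists_minim_Card_order[of "(\<lambda>X. |g ` X| ) ` D"] by (auto simp: card_of_Card_order)
  then show ?thesis using that by auto
qed

text \<open>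
  If \<open>X\<close> makes the image of \<open>g\<close> smallest, then \<open>g\<close>, with its values on \<open>X\<close> renamed to elements of
  \<open>r\<close>, is not concentrated on any smaller set of values.
\<close>

lemma minimal_image_decomposable:
  fixes r :: "'c rel"
  assumes D: "ultrafilter_on I D" and X: "X \<in> D" "\<And>Z. Z \<in> D \<Longrightarrow> |g ` X| \<le>o |g ` Z|"
    and r: "Card_order r" "r =o |g ` X|"
  shows "decomposable r I D"
proof -
  have "|g ` X| =o |Field r|"
    by (rule ordIso_symmetric[OF ordIso_transitive[OF card_of_Field_ordIso[OF r(1)] r(2)]])
  then obtain b where b: "bij_betw b (g ` X) (Field r)" using card_of_ordIso by metis
  obtain x0 where x0: "x0 \<in> X" using ultrafilter_witness[OF D X(1)] by blast
  define f where "f i = (if i \<in> X then b (g i) else b (g x0))" for i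
  have "f ` I \<subseteq> Field r"
    using b x0 unfolding f_def bij_betw_def by auto
  moreover have "{i \<in> I. f i \<in> Y} \<notin> D" if Y: "Y \<subseteq> Field r" "|Y| <o r" for Y
  proof
    assume *: "{i \<in> I. f i \<in> Y} \<in> D"
    let ?Z = "X \<inter> {i \<in> I. f i \<in> Y}"
    have Z: "?Z \<in> D" by (rule ultrafilter_Int[OF D X(1) *])
    have "inj_on b (g ` ?Z)"
      using b unfolding bij_betw_def by (elim conjE) (erule inj_on_subset, blast)
    moreover have "b ` (g ` ?Z) \<subseteq> Y" by (auto simp: f_def)
    ultimately have "|g ` ?Z| \<le>o |Y|" by (rule card_of_ordLeq_inj)
    then have "|g ` X| \<le>o |Y|" by (rule ordLeq_transitive[OF X(2)[OF Z]])
    then have "|g ` X| <o r" using Y(2) by (rule ordLeq_ordLess_trans)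
    then show False using ordIso_symmetric[OF r(2)] not_ordLess_ordIso by auto
  qed
  ultimately show ?thesis unfolding decomposable_def by (intro exI[of _ f]) simp
qed

text \<open>
  Otherwise the least size of an image of \<open>g\<close> on a set in \<open>D\<close> is a cardinal between \<open>s\<close> and \<open>t\<close> for
  which \<open>D\<close> is decomposable. The bound on \<open>t\<close> makes this cardinal available on the type \<open>'u\<close>.
\<close>

lemma not_decomposable_small_image:
  fixes s :: "'u rel" and g :: "'i \<Rightarrow> 'b"
  assumes D: "ultrafilter_on I D" and s: "Card_order s" and t: "t \<le>o |UNIV :: 'u set|"
    and nd: "\<And>r :: 'u rel. Card_order r \<Longrightarrow> s \<le>o r \<Longrightarrow> r \<le>o t \<Longrightarrow> \<not> decomposable r I D"
    and g: "|g ` I| \<le>o t"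
  shows "\<exists>X\<in>D. |g ` X| <o s"
proof -
  obtain X where X: "X \<in> D" "\<And>Z. Z \<in> D \<Longrightarrow> |g ` X| \<le>o |g ` Z|"
    using minimal_image[OF D] by blast
  have le: "|g ` X| \<le>o t"
    by (rule ordLeq_transitive[OF card_of_mono1[OF image_mono[OF ultrafilter_subset[OF D X(1)]]] g])
  then have "|g ` X| \<le>o |UNIV :: 'u set|" by (rule ordLeq_transitive[OF _ t])
  then obtain B :: "'u set" where B: "|g ` X| =o |B|"
    using internalize_card_of_ordLeq2[of "g ` X" "UNIV :: 'u set"] by auto
  have "decomposable |B| I D"
    by (rule minimal_image_decomposable[OF D X card_of_Card_order ordIso_symmetric[OF B]])
  moreover have "|B| \<le>o t" by (rule ordIso_ordLeq_trans[OF ordIso_symmetric[OF B] le])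
  ultimately have "\<not> s \<le>o |B|" using nd[OF card_of_Card_order] by auto
  then have "|B| <o s" using card_order_not_ordLeq_ordLess[OF s card_of_Card_order] by auto
  then show ?thesis using X(1) ordIso_ordLess_trans[OF B] by auto
qed

section \<open>Counting functions modulo an ultrafilter\<close>

lemma card_of_Pow_Times_Field:
  assumes "Cinfinite r"
  shows "|Pow (Field r \<times> Field r)| =o |Pow (Field r)|"
  using assms card_of_Times_same_infinite[of "Field r"] unfolding cinfinite_def
  by (intro card_of_Pow_cong) simp

text \<open>
  Silver's argument. If there were no such \<open>G\<close>, recursion along \<open>r\<close> would give functions \<open>f a\<close>
  none of which factors through the preceding ones. Joined into one function, they take fewer
  than \<open>r\<close> values on some \<open>X \<in> D\<close>. Since \<open>f a\<close> does not factor on \<open>X\<close>, there are two indices in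
  \<open>X\<close> whose joint values first differ at \<open>a\<close>. So the \<open>r\<close> many \<open>a\<close> are told apart by pairs of joint
  values, of which there are fewer than \<open>r\<close>. Functions on \<open>r\<close> are made total by the value \<open>{}\<close>.
\<close>

lemma exists_finest_function:
  fixes r :: "'k rel" and D :: "'i set set"
  assumes D: "ultrafilter_on I D" and r: "Cinfinite r"
    and small: "\<And>g :: 'i \<Rightarrow> 'k \<Rightarrow> 'k set.
       \<forall>i a. g i a \<subseteq> Field r \<and> (a \<notin> Field r \<longrightarrow> g i a = {}) \<Longrightarrow> \<exists>X\<in>D. |g ` X| <o r"
  shows "\<exists>(G :: 'i \<Rightarrow> 'k \<Rightarrow> 'k set) X. X \<in> D \<and> |G ` X| <o r \<and>
    (\<forall>g. g ` I \<subseteq> Pow (Field r) \<longrightarrow> (\<exists>Z\<in>D. \<exists>F. \<forall>i\<in>Z. g i = F (G i)))"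
proof -
  define below where "below f a i = (\<lambda>b. if b \<in> underS r a then f b i else {})"
    for f :: "'k \<Rightarrow> 'i \<Rightarrow> 'k set" and a i
  define factors where "factors f a g \<longleftrightarrow> (\<exists>Z\<in>D. \<exists>F. \<forall>i\<in>Z. g i = F (below f a i))"
    for f a and g :: "'i \<Rightarrow> 'k set"
  have below_small: "\<exists>X\<in>D. |below f a ` X| <o r"
    if "\<And>b. b \<in> underS r a \<Longrightarrow> f b ` UNIV \<subseteq> Pow (Field r)" for f a
  proof (rule small, intro allI conjI impI)
    show "below f a i b \<subseteq> Field r" for i b
      using that[of b] by (auto simp: below_def)
    show "below f a i b = {}" if "b \<notin> Field r" for i b
      using that underS_Field[of b r a] by (auto simp: below_def)
  qed
  have "\<exists>f a. a \<in> Field r \<and> (\<forall>b\<in>underS r a. f b ` UNIV \<subseteq> Pow (Field r)) \<and>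
          (\<forall>g. g ` UNIV \<subseteq> Pow (Field r) \<longrightarrow> factors f a g)"
  proof (rule ccontr)
    assume no: "\<not> ?thesis"
    have wf: "wf (r - Id)"
      using r card_order_on_well_order_on well_order_on_def by blast
    have "\<exists>f. \<forall>a. a \<in> Field r \<longrightarrow> f a ` UNIV \<subseteq> Pow (Field r) \<and> \<not> factors f a (f a)"
    proof (rule dependent_wf_choice[OF wf])
      fix f g :: "'k \<Rightarrow> 'i \<Rightarrow> 'k set" and a h
      assume "\<And>z. (z, a) \<in> r - Id \<Longrightarrow> f z = g z"
      then have "below f a = below g a"
        by (intro ext) (auto simp: below_def underS_def)
      then show "(a \<in> Field r \<longrightarrow> h ` UNIV \<subseteq> Pow (Field r) \<and> \<not> factors f a h) =
                 (a \<in> Field r \<longrightarrow> h ` UNIV \<subseteq> Pow (Field r) \<and> \<not> factors g a h)"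
        by (simp add: factors_def)
    next
      fix f :: "'k \<Rightarrow> 'i \<Rightarrow> 'k set" and a
      assume IH: "\<And>b. (b, a) \<in> r - Id \<Longrightarrow> b \<in> Field r \<longrightarrow>
        f b ` UNIV \<subseteq> Pow (Field r) \<and> \<not> factors f b (f b)"
      have "\<forall>b\<in>underS r a. f b ` UNIV \<subseteq> Pow (Field r)"
      proof
        fix b assume b: "b \<in> underS r a"
        then have "(b, a) \<in> r - Id" "b \<in> Field r" using underS_Field[of b r a] by (auto simp: underS_def)
        then show "f b ` UNIV \<subseteq> Pow (Field r)" using IH by blast
      qed
      then show "\<exists>g. a \<in> Field r \<longrightarrow> g ` UNIV \<subseteq> Pow (Field r) \<and> \<not> factors f a g"
        using no by metis
    qed
    then obtain f where f: "\<And>a. a \<in> Field r \<Longrightarrow> f a ` UNIV \<subseteq> Pow (Field r)"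
        "\<And>a. a \<in> Field r \<Longrightarrow> \<not> factors f a (f a)"
      by metis
    define G where "G i = (\<lambda>b. if b \<in> Field r then f b i else {})" for i
    have "\<exists>X\<in>D. |G ` X| <o r"
    proof (rule small, intro allI conjI impI)
      show "G i b \<subseteq> Field r" for i b using f(1)[of b] by (auto simp: G_def)
    qed (simp add: G_def)
    then obtain X where X: "X \<in> D" "|G ` X| <o r" by blast
    have "\<exists>i j. i \<in> X \<and> j \<in> X \<and> below f a i = below f a j \<and> f a i \<noteq> f a j" if a: "a \<in> Field r" for a
    proof (rule ccontr)
      assume "\<not> ?thesis"
      then have *: "f a i = f a j" if "i \<in> X" "j \<in> X" "below f a i = below f a j" for i j
        using that by blast
      have "f a i = f a (SOME j. j \<in> X \<and> below f a j = below f a i)" if i: "i \<in> X" for i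
      proof -
        have "(SOME j. j \<in> X \<and> below f a j = below f a i) \<in> X \<and>
              below f a (SOME j. j \<in> X \<and> below f a j = below f a i) = below f a i"
          by (rule someI[of _ i]) (simp add: i)
        then show ?thesis using *[OF i] by metis
      qed
      then have "factors f a (f a)"
        unfolding factors_def using X(1)
        by (intro bexI[of _ X] exI[of _ "\<lambda>c. f a (SOME j. j \<in> X \<and> below f a j = c)"]) auto
      then show False using f(2)[OF a] by simp
    qed
    then obtain p q where pq: "\<And>a. a \<in> Field r \<Longrightarrow> p a \<in> X \<and> q a \<in> X \<and>
        below f a (p a) = below f a (q a) \<and> f a (p a) \<noteq> f a (q a)"
      by metis
    \<comment> \<open>The pair of values chosen at \<open>a\<close> determines \<open>a\<close>: it is the first place where they differ.\<close>
    have differ: "a = b" if "a \<in> Field r" "b \<in> Field r" "(a, b) \<in> r"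
      "G (p a) = G (p b)" "G (q a) = G (q b)" for a b
    proof (rule ccontr)
      assume "a \<noteq> b"
      then have a: "a \<in> underS r b" using that(3) by (simp add: underS_def)
      have "G (p b) a = G (q b) a"
        using pq[OF that(2)] a that(1) by (metis G_def below_def)
      then have "f a (p a) = f a (q a)" using that(1,4,5) by (metis G_def)
      then show False using pq[OF that(1)] by blast
    qed
    have "inj_on (\<lambda>a. (G (p a), G (q a))) (Field r)"
    proof (rule inj_onI)
      fix a b assume ab: "a \<in> Field r" "b \<in> Field r" "(G (p a), G (q a)) = (G (p b), G (q b))"
      then have "(a, b) \<in> r \<or> (b, a) \<in> r" using card_order_total[of r a b] r by blast
      then show "a = b" using differ[of a b] differ[of b a] ab by auto
    qed
    moreover have "(\<lambda>a. (G (p a), G (q a))) ` Field r \<subseteq> G ` X \<times> G ` X" using pq by blast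
    ultimately have "|Field r| \<le>o |G ` X \<times> G ` X|" by (rule card_of_ordLeq_inj)
    moreover have "|G ` X \<times> G ` X| <o r" by (rule card_of_Times_ordLess_infinite[OF r X(2)])
    moreover have "r =o |Field r|" using r by (simp add: card_of_Field_ordIso')
    ultimately show False
      using ordIso_ordLeq_trans[of r "|Field r|" "|G ` X \<times> G ` X|"] not_ordLess_ordLeq[of _ r] by blast
  qed
  then obtain f a where fa: "\<forall>b\<in>underS r a. f b ` UNIV \<subseteq> Pow (Field r)"
      "\<And>g. g ` UNIV \<subseteq> Pow (Field r) \<Longrightarrow> factors f a g"
    by metis
  obtain X where X: "X \<in> D" "|below f a ` X| <o r" using below_small fa(1) by blast
  show ?thesis
  proof (intro exI conjI allI impI)
    show "X \<in> D" "|below f a ` X| <o r" using X by simp_all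
    fix g :: "'i \<Rightarrow> 'k set" assume g: "g ` I \<subseteq> Pow (Field r)"
    have "factors f a (\<lambda>i. if i \<in> I then g i else {})" by (rule fa(2)) (use g in auto)
    then obtain Z F where Z: "Z \<in> D" "\<forall>i\<in>Z. (if i \<in> I then g i else {}) = F (below f a i)"
      unfolding factors_def by blast
    moreover have "i \<in> I" if "i \<in> Z" for i using ultrafilter_subset[OF D Z(1)] that by blast
    ultimately show "\<exists>Z\<in>D. \<exists>F. \<forall>i\<in>Z. g i = F (below f a i)" by metis
  qed
qed

text \<open>
  A function factoring through the finest one is determined modulo \<open>D\<close> by a subset-valued function
  on its fewer than \<open>r\<close> values. The hypothesis is on functions whose values are functions from \<open>r\<close>
  to subsets of \<open>r\<close>, since the joint function of the preceding proof is of this kind; as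
  \<open>(2\<^sup>r)\<^sup>r = 2\<^sup>r\<close>, it takes at most \<open>2\<^sup>r\<close> values.
\<close>

lemma few_functions_Pow_Field:
  fixes r :: "'k rel" and D :: "'i set set"
  assumes D: "ultrafilter_on I D" and r: "Cinfinite r"
    and small: "\<And>g :: 'i \<Rightarrow> 'k \<Rightarrow> 'k set. |g ` I| \<le>o |Pow (Field r)| \<Longrightarrow> \<exists>X\<in>D. |g ` X| <o r"
  shows "few_functions I D (Pow (Field r)) |Pow (Field r)|"
proof -
  have le: "|g ` I| \<le>o |Pow (Field r)|"
    if g: "\<forall>i a. g i a \<subseteq> Field r \<and> (a \<notin> Field r \<longrightarrow> g i a = {})" for g :: "'i \<Rightarrow> 'k \<Rightarrow> 'k set"
  proof -
    let ?graph = "\<lambda>h :: 'k \<Rightarrow> 'k set. {(a, x). x \<in> h a}"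
    have "inj_on ?graph (g ` I)"
      by (rule inj_onI) (auto simp: fun_eq_iff set_eq_iff)
    moreover have "x \<in> Field r \<and> a \<in> Field r" if "x \<in> g i a" for x i a
      using g that by blast
    then have "?graph ` (g ` I) \<subseteq> Pow (Field r \<times> Field r)" by auto
    ultimately have "|g ` I| \<le>o |Pow (Field r \<times> Field r)|" by (rule card_of_ordLeq_inj)
    then show ?thesis by (rule ordLeq_ordIso_trans[OF _ card_of_Pow_Times_Field[OF r]])
  qed
  have "\<exists>(G :: 'i \<Rightarrow> 'k \<Rightarrow> 'k set) X. X \<in> D \<and> |G ` X| <o r \<and>
      (\<forall>g. g ` I \<subseteq> Pow (Field r) \<longrightarrow> (\<exists>Z\<in>D. \<exists>F. \<forall>i\<in>Z. g i = F (G i)))"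
    by (rule exists_finest_function[OF D r]) (rule small[OF le])
  then obtain G :: "'i \<Rightarrow> 'k \<Rightarrow> 'k set" and X where X: "X \<in> D" "|G ` X| <o r"
    and fact: "\<forall>g. g ` I \<subseteq> Pow (Field r) \<longrightarrow> (\<exists>Z\<in>D. \<exists>F. \<forall>i\<in>Z. g i = F (G i))"
    by (elim exE conjE)
  define F where "F g = (SOME F. \<exists>Z\<in>D. \<forall>i\<in>Z. g i = F (G i))" for g :: "'i \<Rightarrow> 'k set"
  have F: "\<exists>Z\<in>D. \<forall>i\<in>Z. g i = F g (G i)" if "g ` I \<subseteq> Pow (Field r)" for g
  proof -
    have "\<exists>Z\<in>D. \<exists>F. \<forall>i\<in>Z. g i = F (G i)" by (rule fact[rule_format, OF that])
    then obtain Z F where "Z \<in> D" "\<forall>i\<in>Z. g i = F (G i)" by (elim bexE exE)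
    then have "\<exists>F. \<exists>Z\<in>D. \<forall>i\<in>Z. g i = F (G i)" by (intro exI[of _ F] bexI[of _ Z])
    then show ?thesis unfolding F_def by (rule someI_ex)
  qed
  define c where "c g = {(v, x). v \<in> G ` X \<and> x \<in> Field r \<and> x \<in> F g v}" for g
  show ?thesis
  proof (rule few_functions_by_code[of I _ c "Pow (G ` X \<times> Field r)"])
    have "|G ` X| \<le>o |Field r|"
      by (rule ordLeq_ordIso_trans[OF ordLess_imp_ordLeq[OF X(2)]])
        (use r in \<open>simp add: card_of_Field_ordIso'\<close>)
    then have "|G ` X \<times> Field r| \<le>o |Field r \<times> Field r|" by (rule card_of_Times_mono1)
    then show "|Pow (G ` X \<times> Field r)| \<le>o |Pow (Field r)|"
      by (rule ordLeq_ordIso_trans[OF card_of_Pow_mono card_of_Pow_Times_Field[OF r]])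
  next
    fix g h assume g: "g ` I \<subseteq> Pow (Field r)" and h: "h ` I \<subseteq> Pow (Field r)" and eq: "c g = c h"
    obtain Z where Z: "Z \<in> D" "\<forall>i\<in>Z. g i = F g (G i)" using F[OF g] by blast
    obtain W where W: "W \<in> D" "\<forall>i\<in>W. h i = F h (G i)" using F[OF h] by blast
    have "X \<inter> (Z \<inter> W) \<in> D" using X(1) Z(1) W(1) by (intro ultrafilter_Int[OF D])
    then show "{i \<in> I. g i = h i} \<in> D"
    proof (rule ultrafilter_Collect_mono[OF D])
      fix i assume i: "i \<in> I" "i \<in> X \<inter> (Z \<inter> W)"
      have c_iff: "(G i, x) \<in> c k \<longleftrightarrow> x \<in> Field r \<and> x \<in> F k (G i)" for k x
        using i by (auto simp: c_def)
      have "x \<in> F g (G i) \<longleftrightarrow> x \<in> F h (G i)" if "x \<in> Field r" for x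
        using c_iff[of x g] c_iff[of x h] eq that by simp
      moreover have "g i \<subseteq> Field r" "h i \<subseteq> Field r" using g h i(1) by auto
      ultimately show "g i = h i" using Z(2) W(2) i(2) by (metis IntE subset_antisym subsetI subsetD)
    qed
  qed (auto simp: c_def)
qed

text \<open>
  If functions into \<open>r\<close> are bounded modulo \<open>D\<close>, a function into the subsets of \<open>r\<close> is determined
  modulo \<open>D\<close> by its traces on the initial segments of \<open>r\<close>: a function choosing elements in which
  two of them differ is bounded, so the difference shows in some trace. Coding the traces takes a
  function from \<open>r\<close> to \<open>2\<^sup>r\<close>.
\<close>

lemma few_functions_Pow_limit:
  fixes r :: "'k rel" and D :: "'i set set"
  assumes D: "ultrafilter_on I D" and r: "Cinfinite r" and bd: "bounded_functions I D r"
    and few: "\<And>a. a \<in> Field r \<Longrightarrow> few_functions I D (Pow (underS r a)) |Pow (Field r)|"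
  shows "few_functions I D (Pow (Field r)) |Pow (Field r)|"
proof -
  have "\<forall>a\<in>Field r. \<exists>H. |H| \<le>o |Pow (Field r)| \<and>
      (\<forall>g. g ` I \<subseteq> Pow (underS r a) \<longrightarrow> (\<exists>h\<in>H. {i \<in> I. g i = h i} \<in> D))"
    using few unfolding few_functions_def by simp
  from bchoice[OF this] obtain H where "\<forall>a\<in>Field r. |H a| \<le>o |Pow (Field r)| \<and>
      (\<forall>g. g ` I \<subseteq> Pow (underS r a) \<longrightarrow> (\<exists>h\<in>H a. {i \<in> I. g i = h i} \<in> D))"
    by (elim exE)
  then have H: "\<And>a. a \<in> Field r \<Longrightarrow> |H a| \<le>o |Pow (Field r)|"
      "\<And>a g. a \<in> Field r \<Longrightarrow> g ` I \<subseteq> Pow (underS r a) \<Longrightarrow> \<exists>h\<in>H a. {i \<in> I. g i = h i} \<in> D"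
    by simp_all
  have "\<exists>k. inj_on k (H a) \<and> k ` H a \<subseteq> Pow (Field r)" if "a \<in> Field r" for a
    by (rule card_of_ordLeq_ex_inj[OF H(1)[OF that]])
  then obtain k where k: "\<And>a. a \<in> Field r \<Longrightarrow> inj_on (k a) (H a)"
      "\<And>a. a \<in> Field r \<Longrightarrow> k a ` H a \<subseteq> Pow (Field r)"
    by metis
  define t where "t g a = (SOME h. h \<in> H a \<and> {i \<in> I. g i \<inter> underS r a = h i} \<in> D)" for g a
  have "t g a \<in> H a \<and> {i \<in> I. g i \<inter> underS r a = t g a i} \<in> D" if "a \<in> Field r" for a and g :: "'i \<Rightarrow> 'k set"
  proof -
    have "\<exists>h. h \<in> H a \<and> {i \<in> I. g i \<inter> underS r a = h i} \<in> D"
      using H(2)[OF that, of "\<lambda>i. g i \<inter> underS r a"] by auto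
    then show ?thesis unfolding t_def by (rule someI_ex)
  qed
  then have t: "\<And>a g. a \<in> Field r \<Longrightarrow> t g a \<in> H a"
      "\<And>a g. a \<in> Field r \<Longrightarrow> {i \<in> I. g i \<inter> underS r a = t g a i} \<in> D"
    by simp_all
  define c where "c g = {(a, x). a \<in> Field r \<and> x \<in> k a (t g a)}" for g
  show ?thesis
  proof (rule few_functions_by_code[of I _ c "Pow (Field r \<times> Field r)"])
    show "|Pow (Field r \<times> Field r)| \<le>o |Pow (Field r)|"
      by (rule ordIso_imp_ordLeq[OF card_of_Pow_Times_Field[OF r]])
    show "c g \<in> Pow (Field r \<times> Field r)" for g using k(2) t(1) unfolding c_def by fast
  next
    fix g h assume g: "g ` I \<subseteq> Pow (Field r)" and h: "h ` I \<subseteq> Pow (Field r)" and eq: "c g = c h"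
    have t_eq: "t g a = t h a" if a: "a \<in> Field r" for a
    proof -
      have "x \<in> k a (t g a) \<longleftrightarrow> (a, x) \<in> c g" "x \<in> k a (t h a) \<longleftrightarrow> (a, x) \<in> c h" for x
        using a by (auto simp: c_def)
      then have "k a (t g a) = k a (t h a)" using eq by auto
      then show ?thesis using inj_onD[OF k(1)[OF a]] t(1)[OF a] by blast
    qed
    show "{i \<in> I. g i = h i} \<in> D"
    proof (rule ccontr)
      assume "{i \<in> I. g i = h i} \<notin> D"
      then have neq: "{i \<in> I. g i \<noteq> h i} \<in> D" by (rule ultrafilter_not[OF D])
      obtain y0 where y0: "y0 \<in> Field r" using r unfolding cinfinite_def by (metis equals0I finite.emptyI)
      define e where "e i = (if g i = h i then y0 else SOME y. (y \<in> g i) \<noteq> (y \<in> h i))" for i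
      have e: "(e i \<in> g i) \<noteq> (e i \<in> h i)" if "g i \<noteq> h i" for i
        unfolding e_def using that someI_ex[of "\<lambda>y. (y \<in> g i) \<noteq> (y \<in> h i)"] by auto
      have "e i \<in> Field r" if "i \<in> I" for i
      proof (cases "g i = h i")
        case True then show ?thesis using y0 by (simp add: e_def)
      next
        case False then show ?thesis using e[of i] that g h by blast
      qed
      then have "e ` I \<subseteq> Field r" by (rule image_subsetI)
      then have "\<exists>a\<in>Field r. {i \<in> I. (e i, a) \<in> r} \<in> D"
        by (rule bd[unfolded bounded_functions_def, rule_format])
      then obtain a where a: "a \<in> Field r" "{i \<in> I. (e i, a) \<in> r} \<in> D" by (elim bexE)
      obtain b where b: "b \<in> Field r" "a \<noteq> b" "(a, b) \<in> r"
        using infinite_Card_order_limit[of r a] r a(1) unfolding cinfinite_def by blast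
      have "{i \<in> I. g i \<noteq> h i} \<inter> ({i \<in> I. (e i, a) \<in> r} \<inter>
          ({i \<in> I. g i \<inter> underS r b = t g b i} \<inter> {i \<in> I. h i \<inter> underS r b = t g b i})) \<in> D"
        using t(2)[OF b(1), of g] t(2)[OF b(1), of h] unfolding t_eq[OF b(1)]
        by (intro ultrafilter_Int[OF D] neq a(2))
      from ultrafilter_witness[OF D this]
      obtain i where i: "g i \<noteq> h i" "(e i, a) \<in> r" "g i \<inter> underS r b = h i \<inter> underS r b"
        by auto
      have "(e i, b) \<in> r" using card_order_transitive[of r "e i" a b] r i(2) b(3) by blast
      moreover have "e i \<noteq> b" using card_order_antisym[of r a b] r i(2) b by blast
      ultimately have "e i \<in> underS r b" by (simp add: underS_def)
      then show False using e[OF i(1)] i(3) by blast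
    qed
  qed
qed

section \<open>Descending from a successor cardinal\<close>

text \<open>
  Kunen--Prikry, Chudnovsky. Let \<open>f\<close> be unbounded in the successor \<open>s'\<close>, and let \<open>e b\<close> embed the
  predecessors of \<open>b\<close> into \<open>s\<close>. For each \<open>a\<close> in \<open>s'\<close> the function mapping \<open>i\<close> to \<open>e (f i) a\<close> is bounded
  modulo \<open>D\<close> by some \<open>c a\<close>, and \<open>c\<close> is constant on a set of size \<open>s'\<close>, say with value \<open>a\<^sub>0\<close>. For
  \<open>a\<close> in this set the sets \<open>{i. e (f i) a \<le> a\<^sub>0}\<close> are in \<open>D\<close>, and since \<open>e (f i)\<close> is injective each
  \<open>i\<close> lies in at most \<open>|under s a\<^sub>0|\<close> many of them. This makes some function into each regular
  cardinal above \<open>|under s a\<^sub>0|\<close> and up to \<open>s'\<close> unbounded.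
\<close>

lemma successor_descent:
  fixes s :: "'s rel" and s' :: "'t rel" and D :: "'i set set"
  assumes D: "ultrafilter_on I D" and s: "Cinfinite s" and s': "Card_order s'" "s' =o cardSuc s"
    and bd: "bounded_functions I D s" and nb: "\<not> bounded_functions I D s'"
  obtains a where "a \<in> Field s"
    "\<And>r :: 'r rel. Cinfinite r \<Longrightarrow> regularCard r \<Longrightarrow> |under s a| <o r \<Longrightarrow> r \<le>o s' \<Longrightarrow>
       \<not> bounded_functions I D r"
proof -
  obtain f where f: "f ` I \<subseteq> Field s'" "\<And>a. a \<in> Field s' \<Longrightarrow> {i \<in> I. (f i, a) \<in> s'} \<notin> D"
    using nb unfolding bounded_functions_def by blast
  have s_less: "s <o s'"
    by (rule ordLess_ordIso_trans[OF cardSuc_greater ordIso_symmetric[OF s'(2)]]) (use s in simp)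
  have "\<exists>e. inj_on e (underS s' b) \<and> e ` underS s' b \<subseteq> Field s" if b: "b \<in> Field s'" for b
  proof -
    have "|underS s' b| <o s'" by (rule card_of_underS[OF s'(1) b])
    then have "|underS s' b| <o cardSuc s" using s'(2) by (rule ordLess_ordIso_trans)
    then have "|underS s' b| \<le>o s"
      using cardSuc_ordLeq_ordLess[of s "|underS s' b|"] s card_of_Card_order by blast
    then have "|underS s' b| \<le>o |Field s|"
      by (rule ordLeq_ordIso_trans) (use s in \<open>simp add: card_of_Field_ordIso'\<close>)
    then show ?thesis by (rule card_of_ordLeq_ex_inj)
  qed
  then obtain e where e: "\<And>b. b \<in> Field s' \<Longrightarrow> inj_on (e b) (underS s' b)"
      "\<And>b. b \<in> Field s' \<Longrightarrow> e b ` underS s' b \<subseteq> Field s"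
    by metis
  obtain z where z: "z \<in> Field s" using s unfolding cinfinite_def by (metis equals0I finite.emptyI)
  define X where "X a c = {i \<in> I. a \<in> underS s' (f i) \<and> (e (f i) a, c) \<in> s}" for a c
  have "\<exists>c\<in>Field s. X a c \<in> D" if a: "a \<in> Field s'" for a
  proof -
    define g where "g i = (if a \<in> underS s' (f i) then e (f i) a else z)" for i
    have "g ` I \<subseteq> Field s" using e(2) f(1) z unfolding g_def by auto
    then obtain c where c: "c \<in> Field s" "{i \<in> I. (g i, c) \<in> s} \<in> D"
      using bd unfolding bounded_functions_def by blast
    have "{i \<in> I. (f i, a) \<notin> s'} \<inter> {i \<in> I. (g i, c) \<in> s} \<in> D"
      by (rule ultrafilter_Int[OF D ultrafilter_not[OF D f(2)[OF a]] c(2)])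
    then have "X a c \<in> D" unfolding X_def
    proof (rule ultrafilter_Collect_mono[OF D])
      fix i assume i: "i \<in> I" "i \<in> {i \<in> I. (f i, a) \<notin> s'} \<inter> {i \<in> I. (g i, c) \<in> s}"
      have fi: "f i \<in> Field s'" using f(1) i(1) by blast
      have "a \<in> underS s' (f i)"
        using card_order_total[OF s'(1) a fi] card_order_refl[OF s'(1) a] i(2) by (auto simp: underS_def)
      then show "a \<in> underS s' (f i) \<and> (e (f i) a, c) \<in> s" using i(2) by (auto simp: g_def)
    qed
    then show ?thesis using c(1) by blast
  qed
  then obtain c where c: "\<And>a. a \<in> Field s' \<Longrightarrow> c a \<in> Field s" "\<And>a. a \<in> Field s' \<Longrightarrow> X a (c a) \<in> D"
    by metis
  have "\<exists>a\<in>Field s. \<not> |{b \<in> Field s'. c b = a}| \<le>o s"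
  proof (rule ccontr)
    assume "\<not> ?thesis"
    then have "\<forall>a\<in>Field s. |{b \<in> Field s'. c b = a}| \<le>o s" by blast
    moreover have "|Field s| \<le>o s" using s by (simp add: card_of_Field_ordIso ordIso_imp_ordLeq)
    ultimately have "|\<Union>a\<in>Field s. {b \<in> Field s'. c b = a}| \<le>o s"
      using s unfolding cinfinite_def by (intro card_of_UNION_ordLeq_infinite_Field) simp_all
    moreover have "(\<Union>a\<in>Field s. {b \<in> Field s'. c b = a}) = Field s'" using c(1) by blast
    ultimately have "|Field s'| \<le>o s" by simp
    then have "s' \<le>o s" by (rule ordIso_ordLeq_trans[OF card_of_Field_ordIso'[OF s'(1)]])
    then show False using s_less by (simp add: not_ordLess_ordLeq)
  qed
  then obtain a where a: "a \<in> Field s" "\<not> |{b \<in> Field s'. c b = a}| \<le>o s" by blast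
  let ?A = "{b \<in> Field s'. c b = a}"
  have "s <o |?A|" using card_order_not_ordLeq_ordLess[OF card_of_Card_order _ a(2)] s by blast
  then have "cardSuc s \<le>o |?A|" using cardSuc_least[of s "|?A|"] s card_of_Card_order by blast
  then have A: "s' \<le>o |?A|" by (rule ordIso_ordLeq_trans[OF s'(2)])
  show ?thesis
  proof (rule that[OF a(1)])
    fix r :: "'r rel"
    assume r: "Cinfinite r" "regularCard r" "|under s a| <o r" "r \<le>o s'"
    have "|Field r| \<le>o |?A|"
      by (rule ordIso_ordLeq_trans[OF card_of_Field_ordIso ordLeq_transitive[OF r(4) A]]) (use r in simp)
    then obtain k where k: "inj_on k (Field r)" "k ` Field r \<subseteq> ?A"
      using card_of_ordLeq_ex_inj[of "Field r" ?A] by blast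
    show "\<not> bounded_functions I D r"
    proof (rule sparse_family_not_bounded[OF D r(1,2)])
      show "X (k x) (c (k x)) \<in> D" if "x \<in> Field r" for x using c(2) k(2) that by blast
      fix i assume i: "i \<in> I"
      let ?B = "{x \<in> Field r. i \<in> X (k x) (c (k x))}"
      have B: "k x \<in> underS s' (f i) \<and> (e (f i) (k x), a) \<in> s" if "x \<in> ?B" for x
        using that k(2) by (auto simp: X_def)
      have "inj_on (\<lambda>x. e (f i) (k x)) ?B"
      proof (rule inj_onI)
        fix x y assume xy: "x \<in> ?B" "y \<in> ?B" "e (f i) (k x) = e (f i) (k y)"
        have "f i \<in> Field s'" using f(1) i by blast
        then have "k x = k y" using e(1) B[OF xy(1)] B[OF xy(2)] xy(3) by (meson inj_onD)
        then show "x = y" using k(1) xy(1,2) by (auto dest: inj_onD)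
      qed
      moreover have "(\<lambda>x. e (f i) (k x)) ` ?B \<subseteq> under s a" using B by (auto simp: under_def)
      ultimately have "|?B| \<le>o |under s a|" by (rule card_of_ordLeq_inj)
      then show "|?B| <o r" using r(3) by (rule ordLeq_ordLess_trans)
    qed
  qed
qed

section \<open>Iterated successors and exponentials\<close>

lemma card_of_under_less:
  assumes "Cinfinite r" "a \<in> Field r"
  shows "|under r a| <o r"
proof -
  have "|underS r a| <o r" by (rule card_of_underS) (use assms in simp_all)
  moreover have "|{a}| <o r"
    using assms(1) by (intro Cfinite_ordLess_Cinfinite) (simp_all add: cfinite_def Field_card_of card_of_card_order_on)
  ultimately have "|{a} \<union> underS r a| <o r" using assms(1) by (intro Un_Cinfinite_bound_strict)
  moreover have "under r a \<subseteq> {a} \<union> underS r a" by (auto simp: under_def underS_def)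
  ultimately show ?thesis using card_of_mono1 ordLeq_ordLess_trans by fast
qed

lemma succ_card_facts:
  fixes \<kappa> :: "'u rel"
  assumes U: "inaccessible |UNIV :: 'u set|" and \<kappa>: "Cinfinite \<kappa>" "\<kappa> <o |UNIV :: 'u set|"
  shows "Cinfinite (succ_card n \<kappa>)" "succ_card n \<kappa> <o |UNIV :: 'u set|"
    "succ_card (Suc n) \<kappa> =o cardSuc (succ_card n \<kappa>)" "regularCard (succ_card (Suc n) \<kappa>)"
proof -
  note facts = succ_card_less_universe[OF U conjunct2[OF \<kappa>(1)] \<kappa>(2)]
  show less: "succ_card n \<kappa> <o |UNIV :: 'u set|" for n by (rule conjunct2[OF facts])
  show iso: "succ_card (Suc n) \<kappa> =o cardSuc (succ_card n \<kappa>)" for n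
    by (rule succ_card_Suc[OF U conjunct2[OF \<kappa>(1)] \<kappa>(2)])
  show inf: "Cinfinite (succ_card n \<kappa>)" for n
  proof (induction n)
    case 0 then show ?case using \<kappa>(1) by simp
  next
    case (Suc n)
    show ?case by (rule Cinfinite_cong[OF ordIso_symmetric[OF iso] Cinfinite_cardSuc[OF Suc]])
  qed
  show "regularCard (succ_card (Suc n) \<kappa>)"
    by (rule regularCard_ordIso[OF ordIso_symmetric[OF iso] Cinfinite_cardSuc[OF inf] regularCard_cardSuc[OF inf]])
qed

lemma few_functions_Field:
  assumes D: "ultrafilter_on I D" and few: "few_functions I D Y |Y|"
    and r: "Card_order r" "r =o |Y|"
  shows "few_functions I D (Field r) r"
proof -
  have "|Field r| \<le>o |Y|" by (rule ordIso_imp_ordLeq[OF ordIso_transitive[OF card_of_Field_ordIso[OF r(1)] r(2)]])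
  then have "few_functions I D (Field r) |Y|" by (rule few_functions_inj[OF D few])
  then show ?thesis by (rule few_functions_mono[OF _ ordIso_imp_ordLeq[OF ordIso_symmetric[OF r(2)]]])
qed

lemma few_functions_beth:
  fixes r :: "'u rel"
  assumes U: "inaccessible |UNIV :: 'u set|" and r: "Card_order r" "r <o |UNIV :: 'u set|"
    and D: "ultrafilter_on I D" and few: "few_functions I D (Pow (Field r)) |Pow (Field r)|"
  shows "few_functions I D (Field (beth (Suc m) r)) (beth (Suc m) r)"
proof (induction m)
  case 0
  have "beth (Suc 0) r =o |Pow (Field r)|"
    using ordIso_transitive[OF beth_Suc[OF U r, of 0] ctwo_cexp_Pow] by simp
  then show ?case
    by (rule few_functions_Field[OF D few conjunct1[OF beth_less_universe[OF U r]]])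
next
  case (Suc m)
  have co: "Card_order (beth (Suc m) r)" by (rule conjunct1[OF beth_less_universe[OF U r]])
  have "beth (Suc (Suc m)) r =o |Pow (Field (beth (Suc m) r))|"
    by (rule ordIso_transitive[OF beth_Suc[OF U r] ctwo_cexp_Pow])
  then show ?case
    by (rule few_functions_Field[OF D few_functions_Pow[OF D Suc co] conjunct1[OF beth_less_universe[OF U r]]])
qed

lemma few_functions_successor:
  fixes s :: "'s rel" and s' :: "'t rel"
  assumes D: "ultrafilter_on I D" and s: "Cinfinite s" and s': "Cinfinite s'" "s' =o cardSuc s"
    and bd: "bounded_functions I D s'"
    and few: "few_functions I D (Pow (Field s)) |Pow (Field s)|"
  shows "few_functions I D (Pow (Field s')) |Pow (Field s')|"
proof (rule few_functions_Pow_limit[OF D s'(1) bd])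
  fix a assume a: "a \<in> Field s'"
  have co: "Card_order s" "Card_order s'" using s s' by simp_all
  have "|underS s' a| <o s'" by (rule card_of_underS[OF co(2) a])
  then have "|underS s' a| <o cardSuc s" using s'(2) by (rule ordLess_ordIso_trans)
  then have "|underS s' a| \<le>o s"
    using cardSuc_ordLeq_ordLess[of s "|underS s' a|"] co card_of_Card_order by blast
  then have "|underS s' a| \<le>o |Field s|"
    by (rule ordLeq_ordIso_trans[OF _ card_of_Field_ordIso'[OF co(1)]])
  then have "few_functions I D (Pow (underS s' a)) |Pow (Field s)|"
    by (intro few_functions_inj[OF D few] card_of_Pow_mono)
  moreover have "|Field s| \<le>o |Field s'|"
    using ordLess_imp_ordLeq[OF ordLess_ordIso_trans[OF cardSuc_greater[OF co(1)] ordIso_symmetric[OF s'(2)]]]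
    by (rule card_of_mono2)
  ultimately show "few_functions I D (Pow (underS s' a)) |Pow (Field s')|"
    using card_of_Pow_mono few_functions_mono by blast
qed

lemma bounded_functions_successor:
  fixes s :: "'s rel" and s' :: "'t rel"
  assumes D: "ultrafilter_on I D" and s: "Cinfinite s" "regularCard s" and s': "Card_order s'" "s' =o cardSuc s"
    and bd: "bounded_functions I D s"
  shows "bounded_functions I D s'"
proof (rule ccontr)
  assume nb: "\<not> bounded_functions I D s'"
  have co: "Card_order s" using s by simp
  have "s <o s'" by (rule ordLess_ordIso_trans[OF cardSuc_greater[OF co] ordIso_symmetric[OF s'(2)]])
  then have le: "s \<le>o s'" by (rule ordLess_imp_ordLeq)
  obtain a where a: "a \<in> Field s" "\<And>r :: 's rel. Cinfinite r \<Longrightarrow> regularCard r \<Longrightarrow>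
      |under s a| <o r \<Longrightarrow> r \<le>o s' \<Longrightarrow> \<not> bounded_functions I D r"
    using successor_descent[OF D s(1) s' bd nb] by blast
  show False using a(2)[OF s card_of_under_less[OF s(1) a(1)] le] bd by simp
qed

text \<open>
  The bound on functions into \<open>2\<^sup>\<kappa>\<close> is lifted to \<open>2\<close> to the power \<open>\<kappa>\<^sup>+\<^sup>n\<close> and from there along the
  beth sequence, where it contradicts regularity. For \<open>m = 0\<close> regularity of \<open>D\<close> is refuted
  by boundedness, \<open>\<kappa>\<^sup>+\<^sup>n\<close> being a regular cardinal.
\<close>

lemma not_regular_ultrafilter_above:
  fixes \<kappa> :: "'u rel"
  assumes U: "inaccessible |UNIV :: 'u set|" and \<kappa>: "Cinfinite \<kappa>" "\<kappa> <o |UNIV :: 'u set|"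
    and D: "ultrafilter_on I D" and few: "few_functions I D (Pow (Field \<kappa>)) |Pow (Field \<kappa>)|"
    and bd: "bounded_functions I D (succ_card 1 \<kappa>)"
    and mn: "m \<noteq> 0 \<or> n \<noteq> 0"
  shows "\<not> regular_ultrafilter (beth m (succ_card n \<kappa>)) D"
proof -
  note facts = succ_card_facts[OF U \<kappa>]
  have co: "Card_order (succ_card k \<kappa>)" for k using facts(1) by simp
  have bounded: "bounded_functions I D (succ_card (Suc k) \<kappa>)" for k
  proof (induction k)
    case 0 then show ?case using bd by simp
  next
    case (Suc k)
    show ?case by (rule bounded_functions_successor[OF D facts(1,4) co facts(3) Suc])
  qed
  have few_succ: "few_functions I D (Pow (Field (succ_card k \<kappa>))) |Pow (Field (succ_card k \<kappa>))|" for k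
  proof (induction k)
    case 0 then show ?case using few by simp
  next
    case (Suc k)
    show ?case by (rule few_functions_successor[OF D facts(1,1,3) bounded Suc])
  qed
  show ?thesis
  proof (cases m)
    case 0
    then obtain k where "n = Suc k" using mn by (cases n) auto
    then show ?thesis
      using 0 regular_ultrafilter_not_bounded[OF D facts(1) facts(4)[of k]] bounded[of k] by auto
  next
    case (Suc l)
    let ?b = "beth (Suc l) (succ_card n \<kappa>)"
    have b: "Card_order ?b" by (rule conjunct1[OF beth_less_universe[OF U co facts(2)]])
    have "few_functions I D (Field ?b) ?b"
      by (rule few_functions_beth[OF U co facts(2) D few_succ])
    then have "\<not> regular_ultrafilter ?b D"
      using regular_ultrafilter_many_functions[OF D b _ ordIso_imp_ordLeq[OF card_of_Field_ordIso'[OF b]]] by blast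
    then show ?thesis using Suc by simp
  qed
qed

lemma few_functions_of_not_decomposable:
  fixes \<rho> :: "'u rel"
  assumes U: "inaccessible |UNIV :: 'u set|" and \<rho>: "Cinfinite \<rho>" "\<rho> <o |UNIV :: 'u set|"
    and D: "ultrafilter_on I D"
    and nd: "\<And>\<mu> :: 'u rel. Card_order \<mu> \<Longrightarrow> \<rho> \<le>o \<mu> \<Longrightarrow> \<mu> \<le>o ctwo ^c \<rho> \<Longrightarrow> \<not> decomposable \<mu> I D"
  shows "few_functions I D (Pow (Field \<rho>)) |Pow (Field \<rho>)|"
proof (rule few_functions_Pow_Field[OF D \<rho>(1)])
  have co: "Card_order \<rho>" using \<rho> by simp
  have "ctwo ^c \<rho> <o |UNIV :: 'u set|" by (rule ctwo_cexp_less_universe[OF U co \<rho>(2)])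
  then have le: "ctwo ^c \<rho> \<le>o |UNIV :: 'u set|" by (rule ordLess_imp_ordLeq)
  fix g :: "'a \<Rightarrow> 'u \<Rightarrow> 'u set" assume "|g ` I| \<le>o |Pow (Field \<rho>)|"
  then have g: "|g ` I| \<le>o ctwo ^c \<rho>" by (rule ordLeq_ordIso_trans[OF _ ordIso_symmetric[OF ctwo_cexp_Pow]])
  show "\<exists>X\<in>D. |g ` X| <o \<rho>"
    by (rule not_decomposable_small_image[OF D co le nd g])
qed

section \<open>Regularity of ultrafilters descends\<close>

text \<open>
  If \<open>D\<close> is regular for no cardinal between \<open>\<kappa>\<close> and \<open>2\<^sup>\<kappa>\<close>, it is decomposable for none of them, so
  functions into \<open>2\<^sup>\<kappa>\<close> can be counted.
\<close>

theorem regular_ultrafilter_below_exponential: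
  fixes \<kappa> :: "'u rel"
  assumes U: "inaccessible |UNIV :: 'u set|" and \<kappa>: "Cinfinite \<kappa>" "\<kappa> <o |UNIV :: 'u set|"
    and D: "ultrafilter_on I D" and m: "m \<noteq> 0"
    and reg: "regular_ultrafilter (beth m (succ_card n \<kappa>)) D"
  shows "\<exists>\<mu> :: 'u rel. Card_order \<mu> \<and> \<kappa> \<le>o \<mu> \<and> \<mu> \<le>o ctwo ^c \<kappa> \<and> regular_ultrafilter \<mu> D"
proof (rule ccontr)
  assume "\<not> ?thesis"
  then have nreg: "\<not> regular_ultrafilter \<mu> D"
    if "Card_order \<mu>" "\<kappa> \<le>o \<mu>" "\<mu> \<le>o ctwo ^c \<kappa>" for \<mu> :: "'u rel"
    using that by simp
  have nd: "\<not> decomposable \<mu> I D" if \<mu>: "Card_order \<mu>" "\<kappa> \<le>o \<mu>" "\<mu> \<le>o ctwo ^c \<kappa>" for \<mu> :: "'u rel"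
  proof -
    have "Cinfinite \<mu>" using cinfinite_mono[OF \<mu>(2)] \<kappa>(1) \<mu>(1) by simp
    then show ?thesis using decomposable_regular_ultrafilter[OF D] nreg[OF \<mu>] by auto
  qed
  have co: "Card_order \<kappa>" using \<kappa> by simp
  note facts = succ_card_facts[OF U \<kappa>]
  \<comment> \<open>As \<open>\<kappa>\<^sup>+\<close> lies between \<open>\<kappa>\<close> and \<open>2\<^sup>\<kappa>\<close>, functions into it are bounded.\<close>
  have "cardSuc \<kappa> \<le>o ctwo ^c \<kappa>" by (rule cardSuc_least[OF co Card_order_cexp ordLess_ctwo_cexp[OF co]])
  then have le: "succ_card 1 \<kappa> \<le>o ctwo ^c \<kappa>"
    using ordIso_ordLeq_trans[OF facts(3)[of 0]] by simp
  have "\<kappa> <o succ_card 1 \<kappa>"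
    using ordLess_ordIso_trans[OF cardSuc_greater[OF co] ordIso_symmetric[OF facts(3)[of 0, simplified succ_card.simps(1)]]] by simp
  then have "\<not> regular_ultrafilter (succ_card 1 \<kappa>) D"
    using nreg[OF conjunct2[OF facts(1)] ordLess_imp_ordLeq le] by simp
  then have "bounded_functions I D (succ_card 1 \<kappa>)"
    using not_bounded_regular_ultrafilter[OF D facts(1)[of 1]] by auto
  then show False
    using not_regular_ultrafilter_above[OF U \<kappa> D few_functions_of_not_decomposable[OF U \<kappa> D nd]] m reg by blast
qed

lemma finite_range_constant:
  assumes D: "ultrafilter_on I D" and "finite Y" "X \<in> D" "g ` X \<subseteq> Y"
  shows "\<exists>y\<in>Y. {i \<in> I. g i = y} \<in> D"
  using assms(2-)
proof (induction Y arbitrary: X)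
  case empty
  then show ?case using ultrafilter_witness[OF D] by blast
next
  case (insert y Y)
  show ?case
  proof (cases "{i \<in> I. g i = y} \<in> D")
    case False
    then have "X \<inter> {i \<in> I. g i \<noteq> y} \<in> D" by (intro ultrafilter_Int[OF D] insert.prems ultrafilter_not[OF D])
    moreover have "g ` (X \<inter> {i \<in> I. g i \<noteq> y}) \<subseteq> Y" using insert.prems by blast
    ultimately show ?thesis using insert.IH by blast
  qed blast
qed

lemma few_functions_finite:
  fixes Y :: "'b set"
  assumes D: "ultrafilter_on I D" and "finite Y" and r: "Cinfinite r"
  shows "few_functions I D Y r"
  unfolding few_functions_def
proof (intro exI[of _ "(\<lambda>y i. y) ` Y"] conjI allI impI)
  show "|(\<lambda>y i. y) ` Y| \<le>o r"
    using assms(2) r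
    by (intro ordLess_imp_ordLeq Cfinite_ordLess_Cinfinite) (simp_all add: cfinite_def Field_card_of card_of_card_order_on)
  fix g assume "g ` I \<subseteq> Y"
  moreover have "I \<in> D" using D unfolding ultrafilter_on_def by (elim conjE)
  ultimately show "\<exists>h\<in>(\<lambda>y i. y) ` Y. {i \<in> I. g i = h i} \<in> D"
    using finite_range_constant[OF D assms(2)] by auto
qed

text \<open>
  By \<open>U'\<close>, failure of \<open>(\<kappa>,\<kappa>)\<close>-regularity gives \<open>\<nu> < \<kappa>\<close> such that \<open>D\<close> is decomposable for no cardinal
  strictly between \<open>\<nu>\<close> and \<open>\<kappa>\<close>. Any \<open>\<rho>\<close> in this interval can take the place of \<open>\<kappa>\<close> in the argument for
  the interval from \<open>\<kappa>\<close> to \<open>2\<^sup>\<kappa>\<close>, because \<open>2\<^sup>\<rho> < \<kappa>\<close>.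
\<close>

theorem regular_ultrafilter_strong_limit:
  fixes \<kappa> :: "'u rel" and I :: "'u set"
  assumes U: "inaccessible |UNIV :: 'u set|" and \<kappa>: "\<kappa> <o |UNIV :: 'u set|"
    and lim: "strong_limit \<kappa>" and U': "U' \<kappa>"
    and I: "|I| <o |UNIV :: 'u set|" and D: "ultrafilter_on I D"
    and reg: "regular_ultrafilter (beth m (succ_card n \<kappa>)) D"
  shows "regular_ultrafilter \<kappa> D"
proof (rule ccontr)
  assume nreg: "\<not> regular_ultrafilter \<kappa> D"
  have inf: "Cinfinite \<kappa>" and exp: "\<And>\<nu> :: 'u rel. Card_order \<nu> \<Longrightarrow> \<nu> <o \<kappa> \<Longrightarrow> ctwo ^c \<nu> <o \<kappa>"
    using lim by (simp_all add: strong_limit_def)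
  then have co: "Card_order \<kappa>" by simp
  have bd: "bounded_functions I D \<kappa>" using not_bounded_regular_ultrafilter[OF D inf] nreg by blast
  obtain \<nu> :: "'u rel" where \<nu>: "Card_order \<nu>" "\<nu> <o \<kappa>"
    and nd: "\<And>\<mu> :: 'u rel. Card_order \<mu> \<Longrightarrow> \<nu> <o \<mu> \<Longrightarrow> \<mu> <o \<kappa> \<Longrightarrow> \<not> decomposable \<mu> I D"
  proof -
    have "\<not> (\<forall>\<nu>' :: 'u rel. Card_order \<nu>' \<and> \<nu>' <o \<kappa> \<longrightarrow>
        (\<exists>\<nu> :: 'u rel. Card_order \<nu> \<and> \<nu>' <o \<nu> \<and> \<nu> <o \<kappa> \<and> decomposable \<nu> I D))"
      using U'[unfolded U'_def, rule_format, of I D] I D nreg by blast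
    then show ?thesis using that by metis
  qed
  have Field_\<nu>: "|Field \<nu>| <o \<kappa>" by (rule ordIso_ordLess_trans[OF card_of_Field_ordIso[OF \<nu>(1)] \<nu>(2)])
  have copy: "Card_order (card_copy r :: 'u rel)" "(card_copy r :: 'u rel) =o r" if "Card_order r" "r <o \<kappa>" for r :: "'u set rel"
    using card_copy[OF that(1), where ?'a = 'u] ordLess_imp_ordLeq[OF ordLess_transitive[OF that(2) \<kappa>]] by simp_all
  have copy': "Card_order (card_copy r :: 'u rel)" "(card_copy r :: 'u rel) =o r" if "Card_order r" "r <o \<kappa>" for r :: "('u \<Rightarrow> bool) rel"
    using card_copy[OF that(1), where ?'a = 'u] ordLess_imp_ordLeq[OF ordLess_transitive[OF that(2) \<kappa>]] by simp_all
  have few: "few_functions I D (Pow (Field \<kappa>)) |Pow (Field \<kappa>)|"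
  proof (rule few_functions_Pow_limit[OF D inf bd])
    fix a assume a: "a \<in> Field \<kappa>"
    have Cinf: "Cinfinite |Pow (Field \<kappa>)|"
      using inf by (simp add: cinfinite_def Field_card_of card_of_card_order_on)
    show "few_functions I D (Pow (underS \<kappa> a)) |Pow (Field \<kappa>)|"
    proof (cases "finite (underS \<kappa> a)")
      case True
      then show ?thesis by (intro few_functions_finite[OF D _ Cinf]) simp
    next
      case False
      let ?w = "|underS \<kappa> a \<union> Field \<nu>|"
      have "?w <o \<kappa>" by (rule Un_Cinfinite_bound_strict[OF card_of_underS[OF co a] Field_\<nu> inf])
      then have w: "ctwo ^c ?w <o \<kappa>" by (rule exp[OF card_of_Card_order])
      \<comment> \<open>The exponential of a cardinal above both the segment and \<open>\<nu>\<close>, to exceed \<open>\<nu>\<close> strictly.\<close>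
      define \<rho> :: "'u rel" where "\<rho> = card_copy (ctwo ^c ?w)"
      have \<rho>: "Card_order \<rho>" "\<rho> =o ctwo ^c ?w" unfolding \<rho>_def by (rule copy'[OF Card_order_cexp w])+
      have w_\<rho>: "?w <o \<rho>" by (rule ordLess_ordIso_trans[OF ordLess_ctwo_cexp[OF card_of_Card_order] ordIso_symmetric[OF \<rho>(2)]])
      have under_\<rho>: "|underS \<kappa> a| \<le>o \<rho>"
        by (rule ordLeq_transitive[OF card_of_mono1 ordLess_imp_ordLeq[OF w_\<rho>]]) blast
      have \<nu>_\<rho>: "\<nu> <o \<rho>"
        by (rule ordIso_ordLess_trans[OF card_of_Field_ordIso'[OF \<nu>(1)] ordLeq_ordLess_trans[OF card_of_mono1 w_\<rho>]]) blast
      have \<rho>_\<kappa>: "\<rho> <o \<kappa>" by (rule ordIso_ordLess_trans[OF \<rho>(2) w])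
      have \<rho>_inf: "Cinfinite \<rho>"
        using cinfinite_mono[OF under_\<rho>] False \<rho>(1) by (simp add: cinfinite_def Field_card_of)
      have "few_functions I D (Pow (Field \<rho>)) |Pow (Field \<rho>)|"
      proof (rule few_functions_of_not_decomposable[OF U \<rho>_inf ordLess_transitive[OF \<rho>_\<kappa> \<kappa>] D])
        fix \<mu> :: "'u rel" assume \<mu>: "Card_order \<mu>" "\<rho> \<le>o \<mu>" "\<mu> \<le>o ctwo ^c \<rho>"
        show "\<not> decomposable \<mu> I D"
          by (rule nd[OF \<mu>(1) ordLess_ordLeq_trans[OF \<nu>_\<rho> \<mu>(2)] ordLeq_ordLess_trans[OF \<mu>(3) exp[OF \<rho>(1) \<rho>_\<kappa>]]])
      qed
      then have "few_functions I D (Pow (underS \<kappa> a)) |Pow (Field \<rho>)|"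
        by (rule few_functions_inj[OF D _ card_of_Pow_mono[OF ordLeq_ordIso_trans[OF under_\<rho> card_of_Field_ordIso'[OF \<rho>(1)]]]])
      then show ?thesis
        by (rule few_functions_mono[OF _ card_of_Pow_mono[OF card_of_mono2[OF ordLess_imp_ordLeq[OF \<rho>_\<kappa>]]]])
    qed
  qed
  note facts = succ_card_facts[OF U inf \<kappa>]
  have bd_succ: "bounded_functions I D (succ_card 1 \<kappa>)"
  proof (cases "regularCard \<kappa>")
    case True
    show ?thesis
      using bounded_functions_successor[OF D inf True conjunct2[OF facts(1)] facts(3)[of 0, simplified succ_card.simps(1)] bd] by simp
  next
    case False
    \<comment> \<open>A singular \<open>\<kappa>\<close> has regular cardinals \<open>r\<close> arbitrarily high below it, and unboundedness descends
      to \<open>r > \<nu>\<close>, where it means decomposability. The countable set \<open>C\<close> makes \<open>r\<close> infinite.\<close>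
    have "natLeq <o \<kappa>"
    proof -
      have "\<not> natLeq =o \<kappa>" using regularCard_ordIso[OF _ natLeq_Cinfinite regularCard_natLeq] False by blast
      then show ?thesis using natLeq_ordLeq_cinfinite[OF inf] ordLeq_iff_ordLess_or_ordIso by blast
    qed
    then have "|UNIV :: nat set| <o \<kappa>" by (rule ordIso_ordLess_trans[OF card_of_nat])
    then obtain C where C: "C \<subset> Field \<kappa>" "|UNIV :: nat set| =o |C|" "|C| <o \<kappa>"
      using internalize_card_of_ordLess[of "UNIV :: nat set" \<kappa>] by blast
    show ?thesis
    proof (rule ccontr)
      assume nb: "\<not> ?thesis"
      obtain a where a: "a \<in> Field \<kappa>" "\<And>r :: 'u rel. Cinfinite r \<Longrightarrow> regularCard r \<Longrightarrow>
          |under \<kappa> a| <o r \<Longrightarrow> r \<le>o succ_card 1 \<kappa> \<Longrightarrow> \<not> bounded_functions I D r"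
        using successor_descent[OF D inf conjunct2[OF facts(1)[of 1]] facts(3)[of 0, simplified succ_card.simps(1), folded One_nat_def] bd nb] by blast
      let ?W = "under \<kappa> a \<union> (Field \<nu> \<union> C)"
      have W: "|?W| <o \<kappa>"
        by (intro Un_Cinfinite_bound_strict[OF _ _ inf] card_of_under_less[OF inf a(1)] Field_\<nu> C(3))
      have W_inf: "Cinfinite |?W|"
        using card_of_ordIso_finite[OF C(2)] by (simp add: cinfinite_def Field_card_of card_of_card_order_on)
      have "cardSuc |?W| \<le>o ctwo ^c |?W|"
        by (rule cardSuc_least[OF card_of_Card_order Card_order_cexp ordLess_ctwo_cexp[OF card_of_Card_order]])
      then have suc: "cardSuc |?W| <o \<kappa>" by (rule ordLeq_ordLess_trans[OF _ exp[OF card_of_Card_order W]])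
      define r :: "'u rel" where "r = card_copy (cardSuc |?W| )"
      have r: "Card_order r" "r =o cardSuc |?W|"
        unfolding r_def by (rule copy[OF cardSuc_Card_order[OF card_of_Card_order] suc])+
      have r_inf: "Cinfinite r" by (rule Cinfinite_cong[OF ordIso_symmetric[OF r(2)] Cinfinite_cardSuc[OF W_inf]])
      have r_reg: "regularCard r"
        by (rule regularCard_ordIso[OF ordIso_symmetric[OF r(2)] Cinfinite_cardSuc[OF W_inf] regularCard_cardSuc[OF W_inf]])
      have W_r: "|?W| <o r"
        by (rule ordLess_ordIso_trans[OF cardSuc_greater[OF card_of_Card_order] ordIso_symmetric[OF r(2)]])
      have r_\<kappa>: "r <o \<kappa>" by (rule ordIso_ordLess_trans[OF r(2) suc])
      have "|under \<kappa> a| <o r" by (rule ordLeq_ordLess_trans[OF card_of_mono1 W_r]) blast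
      moreover have "\<kappa> <o succ_card 1 \<kappa>"
        using ordLess_ordIso_trans[OF cardSuc_greater[OF co] ordIso_symmetric[OF facts(3)[of 0, simplified succ_card.simps(1)]]] by simp
      then have "r \<le>o succ_card 1 \<kappa>" by (rule ordLess_imp_ordLeq[OF ordLess_transitive[OF r_\<kappa>]])
      ultimately have "\<not> bounded_functions I D r" by (rule a(2)[OF r_inf r_reg])
      then have "decomposable r I D" by (rule not_bounded_decomposable[OF D r_inf r_reg])
      moreover have "\<nu> <o r"
        by (rule ordIso_ordLess_trans[OF card_of_Field_ordIso'[OF \<nu>(1)] ordLeq_ordLess_trans[OF card_of_mono1 W_r]]) blast
      ultimately show False using nd[OF r(1) _ r_\<kappa>] by simp
    qed
  qed
  show False
  proof (cases "m \<noteq> 0 \<or> n \<noteq> 0")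
    case True
    then show False using not_regular_ultrafilter_above[OF U inf \<kappa> D few bd_succ] reg by blast
  next
    case False
    then show False using reg nreg by simp
  qed
qed

section \<open>Sets of fewer elements than the universe\<close>

lemma universe_Cinfinite:
  assumes "inaccessible |UNIV :: 'u set|"
  shows "Cinfinite |UNIV :: 'u set|"
  using assms unfolding inaccessible_def strong_limit_def by (elim conjE) (intro conjI)

lemma less_universe_Pow:
  fixes A :: "'b set"
  assumes U: "inaccessible |UNIV :: 'u set|" and A: "|A| <o |UNIV :: 'u set|"
  shows "|Pow A| <o |UNIV :: 'u set|"
proof -
  obtain B :: "'u set" where B: "|A| =o |B|"
    using internalize_card_of_ordLeq2[of A "UNIV :: 'u set"] ordLess_imp_ordLeq[OF A] by auto
  have "|B| <o |UNIV :: 'u set|" by (rule ordIso_ordLess_trans[OF ordIso_symmetric[OF B] A])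
  then have "ctwo ^c |B| <o |UNIV :: 'u set|"
    by (rule ctwo_cexp_less_universe[OF U card_of_Card_order])
  moreover have "|Pow A| =o ctwo ^c |B|"
    using ordIso_transitive[OF card_of_Pow_cong[OF B] ordIso_symmetric[OF ctwo_cexp_Pow[of "|B|", unfolded Field_card_of]]] .
  ultimately show ?thesis by (rule ordIso_ordLess_trans[rotated])
qed

lemma less_universe_Un:
  assumes "inaccessible |UNIV :: 'u set|" "|A| <o |UNIV :: 'u set|" "|B| <o |UNIV :: 'u set|"
  shows "|A \<union> B| <o |UNIV :: 'u set|"
  by (rule Un_Cinfinite_bound_strict[OF assms(2,3) universe_Cinfinite[OF assms(1)]])

lemma less_universe_finite:
  fixes A :: "'b set"
  assumes "inaccessible |UNIV :: 'u set|" "finite A"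
  shows "|A| <o |UNIV :: 'u set|"
  by (intro Cfinite_ordLess_Cinfinite universe_Cinfinite[OF assms(1)])
    (simp_all add: cfinite_def Field_card_of card_of_card_order_on assms(2))

lemma less_universe_UNION:
  assumes U: "inaccessible |UNIV :: 'u set|" and "|J| <o |UNIV :: 'u set|"
    and "\<And>j. j \<in> J \<Longrightarrow> |A j| <o |UNIV :: 'u set|"
  shows "|\<Union>j\<in>J. A j| <o |UNIV :: 'u set|"
proof (rule card_of_UNION_ordLess_infinite_Field_regularCard)
  show "regularCard |UNIV :: 'u set|" using U unfolding inaccessible_def by (elim conjE)
  show "Cinfinite |UNIV :: 'u set|" by (rule universe_Cinfinite[OF U])
qed (use assms in auto)

lemma less_universe_image: "|A| <o r \<Longrightarrow> |f ` A| <o r"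
  by (rule ordLeq_ordLess_trans[OF card_of_image])

lemma less_universe_subset: "|A| <o r \<Longrightarrow> B \<subseteq> A \<Longrightarrow> |B| <o r"
  by (rule ordLeq_ordLess_trans[OF card_of_mono1])

text \<open>
  Vocabularies are sets, so they leave infinitely many symbols of each kind unused.
\<close>

lemma infinite_fresh_names:
  fixes \<sigma> :: "'u symbol set"
  assumes U: "inaccessible |UNIV :: 'u set|" and \<sigma>: "|\<sigma>| <o |UNIV :: 'u set|"
  shows "infinite {a. Symbol k a \<notin> \<sigma>}"
proof
  assume "finite {a. Symbol k a \<notin> \<sigma>}"
  then have fin: "|{a. Symbol k a \<notin> \<sigma>}| <o |UNIV :: 'u set|" by (rule less_universe_finite[OF U])
  have "inj_on (Symbol k) {a. Symbol k a \<in> \<sigma>}" by (simp add: inj_on_def)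
  then have "|{a. Symbol k a \<in> \<sigma>}| \<le>o |\<sigma>|" by (rule card_of_ordLeq_inj) blast
  then have "|{a. Symbol k a \<in> \<sigma>}| <o |UNIV :: 'u set|" using \<sigma> by (rule ordLeq_ordLess_trans)
  then have "|{a. Symbol k a \<in> \<sigma>} \<union> {a. Symbol k a \<notin> \<sigma>}| <o |UNIV :: 'u set|"
    using fin by (rule less_universe_Un[OF U])
  moreover have "{a. Symbol k a \<in> \<sigma>} \<union> {a. Symbol k a \<notin> \<sigma>} = UNIV" by blast
  ultimately show False using ordLess_irreflexive by metis
qed

section \<open>Satisfaction in regular logics\<close>

text \<open>
  Equality of structures up to the insignificant values of \<open>rel\<close> and \<open>fn\<close>.
\<close>

definition same_struct :: "'u struct \<Rightarrow> 'u struct \<Rightarrow> bool" where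
  "same_struct A B \<longleftrightarrow> voc A = voc B \<and> univ A = univ B \<and>
     (\<forall>s\<in>voc A. case kind s of
        Relation n \<Rightarrow> (\<forall>xs\<in>tuples n (univ A). rel A s xs \<longleftrightarrow> rel B s xs)
      | Function n \<Rightarrow> (\<forall>xs\<in>tuples n (univ A). fn A s xs = fn B s xs))"

lemma same_struct_isomorphism: "same_struct A B \<Longrightarrow> is_isomorphism A B id"
  unfolding same_struct_def is_isomorphism_def by (simp split: kind.splits)

lemma sat_same_struct:
  assumes "regular_logic L" "vocabulary \<tau>" "A \<in> structures \<tau>" "B \<in> structures \<tau>"
    "\<phi> \<in> sentences L \<tau>" "same_struct A B"
  shows "sat L A \<phi> \<longleftrightarrow> sat L B \<phi>"
proof -
  have "is_logic L" using assms(1) by (simp add: regular_logic_def)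
  then have "\<forall>\<tau>. vocabulary \<tau> \<longrightarrow>
        (\<forall>A\<in>structures \<tau>. \<forall>B\<in>structures \<tau>. \<forall>\<phi>\<in>sentences L \<tau>.
           (\<exists>h. is_isomorphism A B h) \<longrightarrow> (sat L A \<phi> \<longleftrightarrow> sat L B \<phi>))"
    unfolding is_logic_def by (elim conjE)
  then show ?thesis using assms(2-) same_struct_isomorphism by blast
qed

lemma atomic_sentence:
  assumes "regular_logic L" "vocabulary \<tau>" "wf_atomic \<tau> \<alpha>"
  shows "\<exists>\<psi>\<in>sentences L \<tau>. \<forall>A\<in>structures \<tau>. sat L A \<psi> \<longleftrightarrow> holds_atomic A \<alpha>"
proof -
  have "expresses_atomic L" using assms(1) by (simp add: regular_logic_def)
  then show ?thesis using assms(2,3) unfolding expresses_atomic_def by blast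
qed

lemma negation_sentence:
  assumes "regular_logic L" "vocabulary \<tau>" "\<phi> \<in> sentences L \<tau>"
  shows "\<exists>\<psi>\<in>sentences L \<tau>. \<forall>A\<in>structures \<tau>. sat L A \<psi> \<longleftrightarrow> \<not> sat L A \<phi>"
proof -
  have "closed_negation L" using assms(1) by (simp add: regular_logic_def)
  then show ?thesis using assms(2,3) unfolding closed_negation_def by blast
qed

lemma conjunction_sentence:
  assumes "regular_logic L" "vocabulary \<tau>" "\<phi> \<in> sentences L \<tau>" "\<chi> \<in> sentences L \<tau>"
  shows "\<exists>\<psi>\<in>sentences L \<tau>. \<forall>A\<in>structures \<tau>. sat L A \<psi> \<longleftrightarrow> sat L A \<phi> \<and> sat L A \<chi>"
proof -
  have "closed_conjunction L" using assms(1) by (simp add: regular_logic_def)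
  then show ?thesis using assms(2-) unfolding closed_conjunction_def by blast
qed

lemma implication_sentence:
  assumes L: "regular_logic L" "vocabulary \<tau>" and "\<phi> \<in> sentences L \<tau>" "\<chi> \<in> sentences L \<tau>"
  shows "\<exists>\<psi>\<in>sentences L \<tau>. \<forall>A\<in>structures \<tau>. sat L A \<psi> \<longleftrightarrow> (sat L A \<phi> \<longrightarrow> sat L A \<chi>)"
proof -
  obtain \<chi>' where 1: "\<chi>' \<in> sentences L \<tau>" "\<forall>A\<in>structures \<tau>. sat L A \<chi>' \<longleftrightarrow> \<not> sat L A \<chi>"
    using negation_sentence[OF L assms(4)] by blast
  obtain \<theta> where 2: "\<theta> \<in> sentences L \<tau>"
    "\<forall>A\<in>structures \<tau>. sat L A \<theta> \<longleftrightarrow> sat L A \<phi> \<and> sat L A \<chi>'"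
    using conjunction_sentence[OF L assms(3) 1(1)] by blast
  obtain \<psi> where 3: "\<psi> \<in> sentences L \<tau>" "\<forall>A\<in>structures \<tau>. sat L A \<psi> \<longleftrightarrow> \<not> sat L A \<theta>"
    using negation_sentence[OF L 2(1)] by blast
  show ?thesis using 1(2) 2(2) 3 by (intro bexI[of _ \<psi>]) auto
qed

lemma vocabulary_insert:
  assumes "inaccessible |UNIV :: 'u set|" "vocabulary (\<tau> :: 'u symbol set)" "kind s \<noteq> Relation 0"
  shows "vocabulary (insert s \<tau>)"
  using assms less_universe_Un[OF assms(1), of "{s}" \<tau>] less_universe_finite[OF assms(1), of "{s}"]
  unfolding vocabulary_def by simp

lemma vocabulary_union_constants:
  assumes "inaccessible |UNIV :: 'u set|" "vocabulary (\<tau> :: 'u symbol set)"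
    and "finite C" "\<And>c. c \<in> C \<Longrightarrow> is_constant c"
  shows "vocabulary (\<tau> \<union> C)"
  using assms(2,4) less_universe_Un[OF assms(1), of \<tau> C] less_universe_finite[OF assms(1,3)]
  unfolding vocabulary_def by auto

lemma fn_in_univ:
  assumes "A \<in> structures \<tau>" "s \<in> \<tau>" "kind s = Function n" "length xs = n" "set xs \<subseteq> univ A"
  shows "fn A s xs \<in> univ A"
  using assms unfolding structures_def closed_under_def tuples_def by blast

lemma expand_structures:
  assumes A: "A \<in> structures \<tau>" and len: "length cs = length as"
    and cs: "\<And>c. c \<in> set cs \<Longrightarrow> is_constant c" and as: "set as \<subseteq> univ A"
  shows "expand A cs as \<in> structures (\<tau> \<union> set cs)"
proof -
  have "closed_under (expand A cs as) (\<tau> \<union> set cs) (univ A)"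
    unfolding closed_under_def
  proof (intro ballI allI impI)
    fix s n xs assume s: "s \<in> \<tau> \<union> set cs" "kind s = Function n" "xs \<in> tuples n (univ A)"
    show "fn (expand A cs as) s xs \<in> univ A"
    proof (cases "map_of (zip cs as) s")
      case None
      then have "s \<notin> set cs" using len by (simp add: map_of_zip_is_None)
      then have "fn A s xs \<in> univ A" using s A by (auto intro: fn_in_univ simp: tuples_def)
      then show ?thesis using None by (simp add: expand_def)
    next
      case (Some a)
      then have "a \<in> set as" by (meson map_of_SomeD set_zip_rightD)
      then show ?thesis using Some as by (auto simp: expand_def)
    qed
  qed
  then show ?thesis using A by (simp add: structures_def expand_def)
qed

abbreviation const_term :: "'u symbol \<Rightarrow> 'u closed_term" where
  "const_term c \<equiv> App c []"

section \<open>Fibers\<close>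

fun add_argument :: "kind \<Rightarrow> kind" where
  "add_argument (Relation n) = Relation (Suc n)"
| "add_argument (Function n) = Function (Suc n)"

text \<open>
  The structure coded in \<open>A\<close> at the parameter \<open>c\<close>: each symbol of \<open>\<tau>\<close> is interpreted by one of \<open>A\<close>
  with the parameter as an additional first argument. The universe is the range of the function
  \<open>r\<close> at the parameter, and values of functions are sent into it by \<open>r\<close>. In this way the universe is
  nonempty and closed under the functions in every structure \<open>A\<close> whatsoever, and no axioms about the
  coding need to be transferred to other models.
\<close>

definition fiber ::
  "'u symbol set \<Rightarrow> 'u symbol \<Rightarrow> ('u symbol \<Rightarrow> 'u symbol) \<Rightarrow> 'u symbol \<Rightarrow> 'u struct \<Rightarrow> 'u struct" where
  "fiber \<tau> r t c A =
     \<lparr>voc = \<tau>, univ = (\<lambda>a. fn A r [fn A c [], a]) ` univ A,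
      rel = (\<lambda>s xs. rel A (t s) (fn A c [] # xs)),
      fn = (\<lambda>s xs. fn A r [fn A c [], fn A (t s) (fn A c [] # xs)])\<rparr>"

definition fiber_symbols ::
  "'u symbol set \<Rightarrow> 'u symbol \<Rightarrow> ('u symbol \<Rightarrow> 'u symbol) \<Rightarrow> 'u symbol \<Rightarrow> 'u symbol set \<Rightarrow> bool" where
  "fiber_symbols \<tau> r t c \<sigma> \<longleftrightarrow> is_constant c \<and> c \<in> \<sigma> \<and> kind r = Function 2 \<and> r \<in> \<sigma> \<and>
     (\<forall>s\<in>\<tau>. t s \<in> \<sigma> \<and> kind (t s) = add_argument (kind s))"

lemma fiber_closed:
  assumes sym: "fiber_symbols \<tau> r t c \<sigma>" and A: "A \<in> structures \<sigma>"
  shows "fn A c [] \<in> univ A" "a \<in> univ A \<Longrightarrow> fn A r [fn A c [], a] \<in> univ A"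
    "s \<in> \<tau> \<Longrightarrow> kind s = Function n \<Longrightarrow> xs \<in> tuples n (univ A) \<Longrightarrow> fn A (t s) (fn A c [] # xs) \<in> univ A"
proof -
  show c: "fn A c [] \<in> univ A"
    using fn_in_univ[OF A, of c 0 "[]"] sym by (simp add: fiber_symbols_def)
  show "fn A r [fn A c [], a] \<in> univ A" if "a \<in> univ A"
    using fn_in_univ[OF A, of r 2] sym that c by (simp add: fiber_symbols_def)
  show "fn A (t s) (fn A c [] # xs) \<in> univ A"
    if "s \<in> \<tau>" "kind s = Function n" "xs \<in> tuples n (univ A)"
    using fn_in_univ[OF A, of "t s" "Suc n"] sym that c by (simp add: fiber_symbols_def tuples_def)
qed

lemma fiber_structures:
  assumes sym: "fiber_symbols \<tau> r t c \<sigma>" and A: "A \<in> structures (\<sigma> :: 'u symbol set)"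
  shows "fiber \<tau> r t c A \<in> structures \<tau>"
proof -
  have sub: "(\<lambda>a. fn A r [fn A c [], a]) ` univ A \<subseteq> univ A" using fiber_closed(2)[OF sym A] by blast
  have "closed_under (fiber \<tau> r t c A) \<tau> (univ (fiber \<tau> r t c A))"
    unfolding closed_under_def
  proof (intro ballI allI impI)
    fix s n xs assume s: "s \<in> \<tau>" "kind s = Function n" "xs \<in> tuples n (univ (fiber \<tau> r t c A))"
    then have "xs \<in> tuples n (univ A)" using sub by (auto simp: tuples_def fiber_def)
    then show "fn (fiber \<tau> r t c A) s xs \<in> univ (fiber \<tau> r t c A)"
      using fiber_closed(3)[OF sym A s(1,2)] by (simp add: fiber_def)
  qed
  moreover have "univ A \<noteq> {}" "|univ A| <o |UNIV :: 'u set|" using A by (simp_all add: structures_def)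
  ultimately show ?thesis
    by (simp add: structures_def less_universe_image) (simp add: fiber_def less_universe_image)
qed

lemma fn_expand_parameter:
  assumes "inj w" "length xs = k" "i < k"
  shows "fn (expand A (map w [0..<k]) xs) (w i) ys = xs ! i"
proof -
  have "map_of (zip (map w [0..<k]) xs) (map w [0..<k] ! i) = Some (xs ! i)"
    using assms by (intro map_of_zip_nth) (auto simp: distinct_map inj_on_def inj_def)
  then show ?thesis using assms(3) by (simp add: expand_def)
qed

lemma fn_expand_other:
  assumes "s \<notin> w ` UNIV" "length xs = k"
  shows "fn (expand A (map w [0..<k]) xs) s ys = fn A s ys"
proof -
  have "s \<notin> set (map w [0..<k])" using assms(1) by auto
  then have "map_of (zip (map w [0..<k]) xs) s = None" using assms(2) by (simp add: map_of_zip_is_None)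
  then show ?thesis by (simp add: expand_def)
qed

lemma rel_expand: "rel (expand A cs as) s xs = rel A s xs"
  by (simp add: expand_def)

lemma map_parameters:
  assumes "inj w" "length xs = k" "n \<le> k"
  shows "map (\<lambda>i. fn (expand A (map w [0..<k]) xs) (w i) []) [0..<n] = take n xs"
  using assms by (intro nth_equalityI) (auto simp: fn_expand_parameter)

text \<open>
  The atomic sentences defining the fiber, with the constants \<open>w 0, w 1, \<dots>\<close> as variables. The auxiliary
  unary function symbol \<open>q\<close> stands for \<open>r\<close> at the parameter, so that its range is the universe of the
  fiber.
\<close>

definition fiber_atom ::
  "'u symbol \<Rightarrow> ('u symbol \<Rightarrow> 'u symbol) \<Rightarrow> 'u symbol \<Rightarrow> 'u symbol \<Rightarrow> (nat \<Rightarrow> 'u symbol) \<Rightarrow> 'u symbol \<Rightarrow> 'u atomic"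
where
  "fiber_atom r t c q w s = (case kind s of
     Relation n \<Rightarrow> Rel (t s) (const_term c # map (\<lambda>i. const_term (w i)) [0..<n])
   | Function n \<Rightarrow> Eq (App r [const_term c, if s = q then const_term (w 0)
         else App (t s) (const_term c # map (\<lambda>i. const_term (w i)) [0..<n])]) (const_term (w n)))"

definition graph_value :: "'u symbol \<Rightarrow> ('u symbol \<Rightarrow> 'u symbol) \<Rightarrow> 'u symbol \<Rightarrow> 'u symbol \<Rightarrow> 'u struct \<Rightarrow> 'u symbol \<Rightarrow> 'u list \<Rightarrow> 'u"
where
  "graph_value r t c q A s xs = fn A r [fn A c [], if s = q then hd xs else fn A (t s) (fn A c [] # xs)]"

text \<open>
  What a sentence says about the fiber can be said about the whole structure, by the closure of \<open>L\<close>
  under relativization and substitution: first relativize the sentence to the range of a new unary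
  function \<open>q\<close>, then substitute the parametrized symbols of \<open>A\<close> for the symbols of \<open>\<tau>\<close> and for \<open>q\<close>.
  Function symbols become terms, so the substituted graphs define functions in all structures.
\<close>

lemma fiber_sentence:
  fixes L :: "('u, 'f) logic"
  assumes U: "inaccessible |UNIV :: 'u set|" and L: "regular_logic L"
    and \<tau>: "vocabulary \<tau>" and \<sigma>: "vocabulary \<sigma>" and sym: "fiber_symbols \<tau> r t c \<sigma>"
    and \<phi>: "\<phi> \<in> sentences L \<tau>"
  shows "\<exists>\<psi>\<in>sentences L \<sigma>. \<forall>A\<in>structures \<sigma>. sat L A \<psi> \<longleftrightarrow> sat L (fiber \<tau> r t c A) \<phi>"
proof -
  have \<tau>_less: "|\<tau>| <o |UNIV :: 'u set|" and \<sigma>_less: "|\<sigma>| <o |UNIV :: 'u set|"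
    using \<tau> \<sigma> by (simp_all add: vocabulary_def)
  obtain qn :: 'u where "Symbol (Function 1) qn \<notin> \<tau>"
    using infinite_fresh_names[OF U \<tau>_less, of "Function 1"] by (metis (mono_tags, lifting) Collect_empty_eq finite.emptyI)
  then obtain q where q: "kind q = Function 1" "q \<notin> \<tau>" by (metis symbol.sel(1))
  have \<tau>': "vocabulary (insert q \<tau>)" using q(1) by (intro vocabulary_insert[OF U \<tau>]) simp
  \<comment> \<open>The range of \<open>q\<close> is defined by the formula \<open>\<delta>\<close> in the variable \<open>x\<close> that says \<open>\<exists>z. q z = x\<close>.\<close>
  obtain \<psi>\<^sub>1 where \<psi>\<^sub>1: "\<psi>\<^sub>1 \<in> sentences L (insert q \<tau>)"
    "\<And>A. A \<in> structures (insert q \<tau>) \<Longrightarrow> closed_under A \<tau> ((\<lambda>a. fn A q [a]) ` univ A) \<Longrightarrow>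
       sat L A \<psi>\<^sub>1 \<longleftrightarrow> sat L (substructure (reduct A \<tau>) ((\<lambda>a. fn A q [a]) ` univ A)) \<phi>"
  proof -
    have "|insert q \<tau>| <o |UNIV :: 'u set|" using \<tau>' by (simp add: vocabulary_def)
    from infinite_fresh_names[OF U this, of "Function 0"]
    have inf: "infinite {a. Symbol (Function 0) a \<notin> insert q \<tau>}" .
    obtain xn where xn: "Symbol (Function 0) xn \<notin> insert q \<tau>"
      using inf by (metis (mono_tags, lifting) Collect_empty_eq finite.emptyI)
    have "infinite ({a. Symbol (Function 0) a \<notin> insert q \<tau>} - {xn})" using inf by simp
    then have "{a. Symbol (Function 0) a \<notin> insert q \<tau>} - {xn} \<noteq> {}" by (metis finite.emptyI)
    then obtain zn where zn: "Symbol (Function 0) zn \<notin> insert q \<tau>" "zn \<noteq> xn" by blast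
    define x z where "x = Symbol (Function 0) xn" and "z = Symbol (Function 0) zn"
    have xz: "is_constant x" "is_constant z" "x \<noteq> z" "x \<notin> insert q \<tau>" "z \<notin> insert q \<tau>"
      using xn zn by (simp_all add: x_def z_def)
    have vx: "vocabulary (insert x (insert q \<tau>))" using xz by (intro vocabulary_insert[OF U \<tau>']) simp
    have vzx: "vocabulary (insert z (insert x (insert q \<tau>)))" using xz by (intro vocabulary_insert[OF U vx]) simp
    have "wf_atomic (insert z (insert x (insert q \<tau>))) (Eq (App q [const_term z]) (const_term x))"
      using xz q by simp
    then obtain \<alpha> where \<alpha>: "\<alpha> \<in> sentences L (insert z (insert x (insert q \<tau>)))"
      "\<forall>A\<in>structures (insert z (insert x (insert q \<tau>))). sat L A \<alpha> \<longleftrightarrow>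
         holds_atomic A (Eq (App q [const_term z]) (const_term x))"
      using atomic_sentence[OF L vzx] by blast
    have "closed_existential L" using L by (simp add: regular_logic_def)
    moreover have "z \<notin> insert x (insert q \<tau>)" using xz by simp
    ultimately obtain \<delta> where \<delta>: "\<delta> \<in> sentences L (insert x (insert q \<tau>))"
      "\<forall>A\<in>structures (insert x (insert q \<tau>)). sat L A \<delta> \<longleftrightarrow> (\<exists>a\<in>univ A. sat L (expand A [z] [a]) \<alpha>)"
      using \<alpha>(1) vx xz(2) unfolding closed_existential_def by blast
    have \<delta>_iff: "sat L A \<delta> \<longleftrightarrow> (\<exists>a\<in>univ A. fn A q [a] = fn A x [])"
      if A: "A \<in> structures (insert x (insert q \<tau>))" for A
    proof -
      have "sat L (expand A [z] [a]) \<alpha> \<longleftrightarrow> fn A q [a] = fn A x []" if a: "a \<in> univ A" for a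
      proof -
        have "expand A [z] [a] \<in> structures (insert x (insert q \<tau>) \<union> set [z])"
          using A a xz by (intro expand_structures) auto
        then have "expand A [z] [a] \<in> structures (insert z (insert x (insert q \<tau>)))" by simp
        moreover have "q \<noteq> z" using xz by blast
        ultimately show ?thesis using \<alpha>(2) xz by (simp add: expand_def)
      qed
      then show ?thesis using \<delta>(2) A by blast
    qed
    have "closed_relativization L" using L by (simp add: regular_logic_def)
    moreover have "vocabulary (insert q \<tau>) \<and> \<tau> \<subseteq> insert q \<tau> \<and> is_constant x \<and> x \<notin> insert q \<tau>"
      using \<tau>' xz(1,4) by blast
    ultimately have "\<forall>\<phi>\<in>sentences L \<tau>. \<forall>\<delta>\<in>sentences L (insert x (insert q \<tau>)). \<exists>\<psi>\<in>sentences L (insert q \<tau>).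
           \<forall>A\<in>structures (insert q \<tau>).
             let W = {a \<in> univ A. sat L (expand A [x] [a]) \<delta>}
             in W \<noteq> {} \<and> closed_under A \<tau> W \<longrightarrow>
                (sat L A \<psi> \<longleftrightarrow> sat L (substructure (reduct A \<tau>) W) \<phi>)"
      unfolding closed_relativization_def by (elim allE) (erule (1) mp)
    then obtain \<psi>\<^sub>1 where \<psi>\<^sub>1: "\<psi>\<^sub>1 \<in> sentences L (insert q \<tau>)"
      "\<forall>A\<in>structures (insert q \<tau>). let W = {a \<in> univ A. sat L (expand A [x] [a]) \<delta>}
             in W \<noteq> {} \<and> closed_under A \<tau> W \<longrightarrow>
                (sat L A \<psi>\<^sub>1 \<longleftrightarrow> sat L (substructure (reduct A \<tau>) W) \<phi>)"
      using \<phi> \<delta>(1) by blast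
    show ?thesis
    proof (rule that[OF \<psi>\<^sub>1(1)])
      fix A assume A: "A \<in> structures (insert q \<tau>)"
        and cl: "closed_under A \<tau> ((\<lambda>a. fn A q [a]) ` univ A)"
      have q_in: "fn A q [a] \<in> univ A" if "a \<in> univ A" for a
        using fn_in_univ[OF A _ q(1)] that by simp
      have W: "{a \<in> univ A. sat L (expand A [x] [a]) \<delta>} = (\<lambda>a. fn A q [a]) ` univ A"
      proof -
        have "sat L (expand A [x] [a]) \<delta> \<longleftrightarrow> (\<exists>b\<in>univ A. fn A q [b] = a)" if a: "a \<in> univ A" for a
        proof -
          have "expand A [x] [a] \<in> structures (insert q \<tau> \<union> set [x])"
            using A a xz by (intro expand_structures) auto
          then have "expand A [x] [a] \<in> structures (insert x (insert q \<tau>))" by simp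
          moreover have "q \<noteq> x" using xz by blast
          ultimately show ?thesis using \<delta>_iff by (simp add: expand_def)
        qed
        then show ?thesis using q_in by blast
      qed
      have "univ A \<noteq> {}" using A by (simp add: structures_def)
      then show "sat L A \<psi>\<^sub>1 \<longleftrightarrow> sat L (substructure (reduct A \<tau>) ((\<lambda>a. fn A q [a]) ` univ A)) \<phi>"
        using bspec[OF \<psi>\<^sub>1(2) A, unfolded Let_def W] cl by blast
    qed
  qed
  \<comment> \<open>One sequence \<open>w\<close> of constants outside \<open>\<sigma>\<close> supplies the variables of all substituted formulas.\<close>
  from infinite_fresh_names[OF U \<sigma>_less, of "Function 0"]
  obtain wn :: "nat \<Rightarrow> 'u" where wn: "inj wn" "range wn \<subseteq> {a. Symbol (Function 0) a \<notin> \<sigma>}"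
    using infinite_countable_subset by blast
  define w where "w i = Symbol (Function 0) (wn i)" for i
  have w: "inj w" "\<And>i. is_constant (w i)" "\<And>i. w i \<notin> \<sigma>"
  proof -
    show "inj w" using wn(1) by (simp add: w_def inj_def)
    show "is_constant (w i)" "w i \<notin> \<sigma>" for i using wn(2) by (auto simp: w_def)
  qed
  have w_neq: "s \<notin> range w" if "s \<in> \<sigma>" for s using that w(3) by blast
  define vs where "vs s = map w [0..<num_vars s]" for s :: "'u symbol"
  have vs: "length (vs s) = num_vars s" "distinct (vs s)" "\<And>c. c \<in> set (vs s) \<Longrightarrow> is_constant c \<and> c \<notin> \<sigma>" for s
    using w by (auto simp: vs_def distinct_map inj_on_def inj_def)
  have v\<sigma>: "vocabulary (\<sigma> \<union> set (vs s))" for s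
    using vs(3) by (intro vocabulary_union_constants[OF U \<sigma>]) auto
  have sym': "is_constant c" "c \<in> \<sigma>" "kind r = Function 2" "r \<in> \<sigma>"
    "\<And>s. s \<in> \<tau> \<Longrightarrow> t s \<in> \<sigma>" "\<And>s. s \<in> \<tau> \<Longrightarrow> kind (t s) = add_argument (kind s)"
    using sym by (simp_all add: fiber_symbols_def)
  have "wf_atomic (\<sigma> \<union> set (vs s)) (fiber_atom r t c q w s)" if s: "s \<in> insert q \<tau>" for s
  proof (cases "kind s")
    case (Relation n)
    then have "s \<in> \<tau>" using s q by auto
    then show ?thesis using Relation sym' w
      by (auto simp: fiber_atom_def vs_def num_vars_def)
  next
    case (Function n)
    then show ?thesis using s sym' w q
      by (auto simp: fiber_atom_def vs_def num_vars_def numeral_2_eq_2)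
  qed
  then have "\<forall>s\<in>insert q \<tau>. \<exists>\<delta>. \<delta> \<in> sentences L (\<sigma> \<union> set (vs s)) \<and>
      (\<forall>A\<in>structures (\<sigma> \<union> set (vs s)). sat L A \<delta> \<longleftrightarrow> holds_atomic A (fiber_atom r t c q w s))"
    using atomic_sentence[OF L v\<sigma>] by blast
  from bchoice[OF this] obtain \<delta> where \<delta>: "\<And>s. s \<in> insert q \<tau> \<Longrightarrow> \<delta> s \<in> sentences L (\<sigma> \<union> set (vs s))"
    "\<And>s A. s \<in> insert q \<tau> \<Longrightarrow> A \<in> structures (\<sigma> \<union> set (vs s)) \<Longrightarrow>
        sat L A (\<delta> s) \<longleftrightarrow> holds_atomic A (fiber_atom r t c q w s)"
    by blast
  have tuple_rel: "sat_tuple L A (\<delta> s) (vs s) xs \<longleftrightarrow> rel A (t s) (fn A c [] # xs)"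
    if A: "A \<in> structures \<sigma>" and s: "s \<in> \<tau>" "kind s = Relation n" and xs: "xs \<in> tuples n (univ A)" for A s n xs
  proof -
    have len: "length xs = n" using xs by (simp add: tuples_def)
    have vs_eq: "vs s = map w [0..<n]" using s by (simp add: vs_def num_vars_def)
    have "expand A (vs s) xs \<in> structures (\<sigma> \<union> set (vs s))"
      using A vs s xs by (intro expand_structures) (auto simp: tuples_def num_vars_def)
    then have "sat_tuple L A (\<delta> s) (vs s) xs \<longleftrightarrow> holds_atomic (expand A (vs s) xs) (fiber_atom r t c q w s)"
      unfolding sat_tuple_def using \<delta>(2) s by simp
    also have "\<dots> \<longleftrightarrow> rel A (t s) (fn A c [] # xs)"
      using map_parameters[OF w(1) len order_refl, of A] s len w_neq[OF sym'(2)]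
      by (simp add: fiber_atom_def vs_eq rel_expand fn_expand_other comp_def)
    finally show ?thesis .
  qed
  have tuple_fn: "sat_tuple L A (\<delta> s) (vs s) (xs @ [y]) \<longleftrightarrow> graph_value r t c q A s xs = y"
    if A: "A \<in> structures \<sigma>" and s: "s \<in> insert q \<tau>" "kind s = Function n"
      and xs: "xs \<in> tuples n (univ A)" and y: "y \<in> univ A" for A s n xs y
  proof -
    have len: "length (xs @ [y]) = Suc n" "length xs = n" using xs by (simp_all add: tuples_def)
    have vs_eq: "vs s = map w [0..<Suc n]" using s by (simp add: vs_def num_vars_def)
    have "expand A (vs s) (xs @ [y]) \<in> structures (\<sigma> \<union> set (vs s))"
      using A vs s xs y by (intro expand_structures) (auto simp: tuples_def num_vars_def)
    then have "sat_tuple L A (\<delta> s) (vs s) (xs @ [y]) \<longleftrightarrow>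
        holds_atomic (expand A (vs s) (xs @ [y])) (fiber_atom r t c q w s)"
      unfolding sat_tuple_def using \<delta>(2) s by simp
    also have "\<dots> \<longleftrightarrow> graph_value r t c q A s xs = y"
    proof (cases "s = q")
      case True
      then have "n = 1" using s q by simp
      then obtain a where "xs = [a]" using len by (auto simp: length_Suc_conv)
      moreover have "vs q = map w [0..<Suc n]" using vs_eq True by simp
      ultimately show ?thesis
        using True s w_neq sym' fn_expand_parameter[OF w(1) len(1), of 0 A "[]"] fn_expand_parameter[OF w(1) len(1), of n A "[]"] len
        by (simp add: fiber_atom_def vs_eq fn_expand_other graph_value_def del: upt_Suc)
    next
      case False
      then have "s \<in> \<tau>" using s by simp
      then show ?thesis
        using False s w_neq sym' fn_expand_parameter[OF w(1) len(1), of n A "[]"]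
          map_parameters[OF w(1) len(1), of n A] len
        by (simp add: fiber_atom_def vs_eq fn_expand_other graph_value_def comp_def nth_append del: upt_Suc)
    qed
    finally show ?thesis .
  qed
  have value_in: "graph_value r t c q A s xs \<in> univ A"
    if A: "A \<in> structures \<sigma>" and s: "s \<in> insert q \<tau>" "kind s = Function n" and xs: "xs \<in> tuples n (univ A)" for A s n xs
  proof (cases "s = q")
    case True
    then have "n = 1" using s q by simp
    then obtain a where "xs = [a]" "a \<in> univ A" using xs by (auto simp: tuples_def length_Suc_conv)
    then show ?thesis using True fiber_closed(2)[OF sym A] by (simp add: graph_value_def)
  next
    case False
    then show ?thesis
      using fiber_closed(2)[OF sym A fiber_closed(3)[OF sym A _ s(2) xs]] s by (simp add: graph_value_def)
  qed
  have "closed_substitution L" using L by (simp add: regular_logic_def)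
  moreover have "vocabulary (insert q \<tau>) \<and> vocabulary \<sigma> \<and>
      (\<forall>s\<in>insert q \<tau>. length (vs s) = num_vars s \<and> distinct (vs s) \<and>
         (\<forall>c\<in>set (vs s). is_constant c \<and> c \<notin> \<sigma>) \<and> \<delta> s \<in> sentences L (\<sigma> \<union> set (vs s)))"
    using \<tau>' \<sigma> vs \<delta>(1) by simp
  ultimately have "\<forall>\<phi>\<in>sentences L (insert q \<tau>). \<exists>\<psi>\<in>sentences L \<sigma>.
      \<forall>A\<in>structures \<sigma>.
        (\<forall>s\<in>insert q \<tau>. \<forall>n. kind s = Function n \<longrightarrow>
          (\<forall>xs\<in>tuples n (univ A). \<exists>!y. y \<in> univ A \<and> sat_tuple L A (\<delta> s) (vs s) (xs @ [y]))) \<longrightarrow>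
        (sat L A \<psi> \<longleftrightarrow> sat L (defined_struct L (insert q \<tau>) \<delta> vs A) \<phi>)"
    unfolding closed_substitution_def by (elim allE) (erule (1) mp)
  then obtain \<psi> where \<psi>: "\<psi> \<in> sentences L \<sigma>"
    "\<forall>A\<in>structures \<sigma>.
        (\<forall>s\<in>insert q \<tau>. \<forall>n. kind s = Function n \<longrightarrow>
          (\<forall>xs\<in>tuples n (univ A). \<exists>!y. y \<in> univ A \<and> sat_tuple L A (\<delta> s) (vs s) (xs @ [y]))) \<longrightarrow>
        (sat L A \<psi> \<longleftrightarrow> sat L (defined_struct L (insert q \<tau>) \<delta> vs A) \<psi>\<^sub>1)"
    using \<psi>\<^sub>1(1) by blast
  show ?thesis
  proof (intro bexI[OF _ \<psi>(1)] ballI)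
    fix A assume A: "A \<in> structures \<sigma>"
    let ?C = "defined_struct L (insert q \<tau>) \<delta> vs A"
    have C_fn: "fn ?C s xs = graph_value r t c q A s xs"
      if "s \<in> insert q \<tau>" "kind s = Function n" "xs \<in> tuples n (univ A)" for s n xs
      unfolding defined_struct_def
      using tuple_fn[OF A that] value_in[OF A that] by (simp, intro the_equality) auto
    have C_rel: "rel ?C s xs \<longleftrightarrow> rel A (t s) (fn A c [] # xs)"
      if "s \<in> \<tau>" "kind s = Relation n" "xs \<in> tuples n (univ A)" for s n xs
      unfolding defined_struct_def using tuple_rel[OF A that] by simp
    have C_q: "fn ?C q [a] = fn A r [fn A c [], a]" if "a \<in> univ A" for a
      using C_fn[of q 1 "[a]"] q that by (simp add: tuples_def graph_value_def)
    have C_univ: "univ ?C = univ A" and C_voc: "voc ?C = insert q \<tau>" by (simp_all add: defined_struct_def)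
    have C: "?C \<in> structures (insert q \<tau>)"
    proof -
      have "closed_under ?C (insert q \<tau>) (univ ?C)"
        unfolding closed_under_def using C_fn value_in[OF A] by (simp only: C_univ) metis
      then show ?thesis using A by (simp add: structures_def C_univ C_voc)
    qed
    let ?W = "(\<lambda>a. fn ?C q [a]) ` univ ?C"
    have W: "?W = univ (fiber \<tau> r t c A)" using C_q by (simp add: C_univ fiber_def)
    have W_sub: "?W \<subseteq> univ A" using C_q fiber_closed(2)[OF sym A] by (auto simp: C_univ)
    have fiber_fn: "fn ?C s xs = fn (fiber \<tau> r t c A) s xs"
      if "s \<in> \<tau>" "kind s = Function n" "xs \<in> tuples n ?W" for s n xs
    proof -
      have "xs \<in> tuples n (univ A)" using that(3) W_sub by (auto simp: tuples_def)
      moreover have "s \<noteq> q" using that(1) q(2) by blast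
      ultimately show ?thesis using C_fn[of s n xs] that by (simp add: fiber_def graph_value_def)
    qed
    have fiber: "fiber \<tau> r t c A \<in> structures \<tau>" by (rule fiber_structures[OF sym A])
    have cl: "closed_under ?C \<tau> ?W"
      unfolding closed_under_def
    proof (intro ballI allI impI)
      fix s n xs assume s: "s \<in> \<tau>" "kind s = Function n" "xs \<in> tuples n ?W"
      have "fn (fiber \<tau> r t c A) s xs \<in> univ (fiber \<tau> r t c A)"
        using s(3) by (intro fn_in_univ[OF fiber s(1,2)]) (simp_all add: W tuples_def)
      then show "fn ?C s xs \<in> ?W" using fiber_fn[OF s] W by simp
    qed
    let ?B = "substructure (reduct ?C \<tau>) ?W"
    have B: "same_struct ?B (fiber \<tau> r t c A)"
      unfolding same_struct_def
    proof (intro conjI ballI)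
      show "voc ?B = voc (fiber \<tau> r t c A)" by (simp add: substructure_def reduct_def fiber_def)
      show "univ ?B = univ (fiber \<tau> r t c A)" by (simp add: substructure_def W)
      fix s assume "s \<in> voc ?B"
      then have s: "s \<in> \<tau>" by (simp add: substructure_def reduct_def)
      have tup: "xs \<in> tuples n (univ A)" if "xs \<in> tuples n ?W" for xs n
        using that W_sub by (auto simp: tuples_def)
      show "case kind s of
          Relation n \<Rightarrow> \<forall>xs\<in>tuples n (univ ?B). rel ?B s xs \<longleftrightarrow> rel (fiber \<tau> r t c A) s xs
        | Function n \<Rightarrow> \<forall>xs\<in>tuples n (univ ?B). fn ?B s xs = fn (fiber \<tau> r t c A) s xs"
      proof (cases "kind s")
        case (Relation n)
        then show ?thesis using C_rel[OF s Relation tup]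
          by (simp add: substructure_def reduct_def) (simp add: fiber_def)
      next
        case (Function n)
        then show ?thesis using fiber_fn[OF s Function] by (simp add: substructure_def reduct_def)
      qed
    qed
    have B_str: "?B \<in> structures \<tau>"
      using fiber cl W by (simp add: structures_def substructure_def reduct_def closed_under_def)
    have ex1: "\<forall>s\<in>insert q \<tau>. \<forall>n. kind s = Function n \<longrightarrow>
          (\<forall>xs\<in>tuples n (univ A). \<exists>!y. y \<in> univ A \<and> sat_tuple L A (\<delta> s) (vs s) (xs @ [y]))"
    proof (intro ballI allI impI)
      fix s n xs assume "s \<in> insert q \<tau>" "kind s = Function n" "xs \<in> tuples n (univ A)"
      then show "\<exists>!y. y \<in> univ A \<and> sat_tuple L A (\<delta> s) (vs s) (xs @ [y])"
        using tuple_fn[OF A] value_in[OF A] by (intro ex1I[of _ "graph_value r t c q A s xs"]) auto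
    qed
    have "sat L A \<psi> \<longleftrightarrow> sat L ?C \<psi>\<^sub>1" using \<psi>(2) A ex1 by simp
    also have "\<dots> \<longleftrightarrow> sat L ?B \<phi>" by (rule \<psi>\<^sub>1(2)[OF C cl])
    also have "\<dots> \<longleftrightarrow> sat L (fiber \<tau> r t c A) \<phi>"
      by (rule sat_same_struct[OF L \<tau> B_str fiber \<phi> B])
    finally show "sat L A \<psi> \<longleftrightarrow> sat L (fiber \<tau> r t c A) \<phi>" .
  qed
qed

section \<open>Compactness and ultrafilters\<close>

text \<open>
  The structure \<open>B\<close> plays the part of the ultraproduct, but only one direction of the theorem of
  Los is required of it, and for the sentences of \<open>L\<close>. The other direction follows if \<open>L\<close> has
  negation.
\<close>

definition ultra_compact :: "('u, 'f) logic \<Rightarrow> 'i set \<Rightarrow> 'i set set \<Rightarrow> bool" where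
  "ultra_compact L I D \<longleftrightarrow>
     (\<forall>\<tau> A. vocabulary \<tau> \<and> (\<forall>i\<in>I. A i \<in> structures \<tau>) \<longrightarrow>
        (\<exists>B\<in>structures \<tau>. \<forall>\<phi>\<in>sentences L \<tau>. {i \<in> I. sat L (A i) \<phi>} \<in> D \<longrightarrow> sat L B \<phi>))"

text \<open>
  The regular family assigns to each index fewer than \<open>r\<close> sentences of \<open>\<Sigma>\<close>, and each sentence to
  almost all indices. A limit of models of the assigned sentences is a model of \<open>\<Sigma>\<close>.
\<close>

lemma ultra_compact_compact_logic:
  fixes L :: "('u, 'f) logic" and r :: "'c rel"
  assumes D: "ultrafilter_on I D" and r: "Card_order r" and reg: "regular_ultrafilter r D"
    and uc: "ultra_compact L I D"
  shows "compact_logic r r L"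
  unfolding compact_logic_def
proof (intro allI impI, elim conjE)
  fix \<tau> \<Gamma> \<Sigma>
  assume \<tau>: "vocabulary \<tau>" and \<Gamma>: "\<Gamma> \<subseteq> sentences L \<tau>" and \<Sigma>: "\<Sigma> \<subseteq> sentences L \<tau>" "|\<Sigma>| \<le>o r"
    and fin: "\<forall>\<Sigma>'\<subseteq>\<Sigma>. |\<Sigma>'| <o r \<longrightarrow> has_model L \<tau> (\<Gamma> \<union> \<Sigma>')"
  obtain X where X: "\<And>a. a \<in> Field r \<Longrightarrow> X a \<in> D" "\<And>i. |{a \<in> Field r. i \<in> X a}| <o r"
    using regular_ultrafilter_small_index[OF r reg D] by blast
  obtain k where k: "inj_on k \<Sigma>" "k ` \<Sigma> \<subseteq> Field r"
    using card_of_ordLeq_ex_inj[OF ordLeq_ordIso_trans[OF \<Sigma>(2) card_of_Field_ordIso'[OF r]]] by blast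
  have "has_model L \<tau> (\<Gamma> \<union> {\<phi> \<in> \<Sigma>. i \<in> X (k \<phi>)})" for i
  proof -
    let ?S = "{\<phi> \<in> \<Sigma>. i \<in> X (k \<phi>)}"
    have "k ` ?S \<subseteq> {a \<in> Field r. i \<in> X a}" using k(2) by blast
    moreover have "inj_on k ?S" using k(1) by (rule inj_on_subset) blast
    ultimately have "|?S| \<le>o |{a \<in> Field r. i \<in> X a}|" by (intro card_of_ordLeq_inj)
    then have "|?S| <o r" using X(2) by (rule ordLeq_ordLess_trans)
    then show ?thesis using fin by simp
  qed
  then have "\<forall>i. \<exists>A. A \<in> structures \<tau> \<and> (\<forall>\<phi>\<in>\<Gamma> \<union> {\<phi> \<in> \<Sigma>. i \<in> X (k \<phi>)}. sat L A \<phi>)"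
    unfolding has_model_def by blast
  from choice[OF this] obtain A where A: "\<And>i. A i \<in> structures \<tau>"
      "\<And>i \<phi>. \<phi> \<in> \<Gamma> \<Longrightarrow> sat L (A i) \<phi>" "\<And>i \<phi>. \<phi> \<in> \<Sigma> \<Longrightarrow> i \<in> X (k \<phi>) \<Longrightarrow> sat L (A i) \<phi>"
    by blast
  from uc[unfolded ultra_compact_def, rule_format, of \<tau> A] \<tau> A(1)
  obtain B where B: "B \<in> structures \<tau>"
      "\<And>\<phi>. \<phi> \<in> sentences L \<tau> \<Longrightarrow> {i \<in> I. sat L (A i) \<phi>} \<in> D \<Longrightarrow> sat L B \<phi>"
    by blast
  have "sat L B \<phi>" if \<phi>: "\<phi> \<in> \<Gamma> \<union> \<Sigma>" for \<phi>
  proof (cases "\<phi> \<in> \<Gamma>")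
    case True
    have "I \<in> D" using D unfolding ultrafilter_on_def by (elim conjE)
    then have "{i \<in> I. sat L (A i) \<phi>} \<in> D" using A(2)[OF True] by simp
    then show ?thesis using B(2) True \<Gamma> by blast
  next
    case False
    then have "X (k \<phi>) \<in> D" using X(1) k(2) \<phi> by blast
    then have "{i \<in> I. sat L (A i) \<phi>} \<in> D"
      using A(3)[of \<phi>] False \<phi> by (intro ultrafilter_Collect_mono[OF D, of "X (k \<phi>)"]) auto
    then show ?thesis using B(2) \<Sigma>(1) False \<phi> by blast
  qed
  then show "has_model L \<tau> (\<Gamma> \<union> \<Sigma>)" unfolding has_model_def using B(1) by blast
qed

text \<open>
  Symbols of a vocabulary that codes, for each ultrafilter \<open>D\<close>, a family of structures: predicates
  \<open>Inl X\<close> for sets of indices, the functions \<open>Inr (D, None)\<close> whose ranges at an index are the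
  universes of the family for \<open>D\<close>, and the symbols \<open>Inr (D, Some s)\<close> that interpret \<open>s\<close> at an index.
  The injection \<open>nm\<close> turns these codes into names.
\<close>

fun code_symbol :: "('u set + 'u set set \<times> 'u symbol option \<Rightarrow> 'u) \<Rightarrow> 'u set + 'u set set \<times> 'u symbol option \<Rightarrow> 'u symbol"
where
  "code_symbol nm (Inl X) = Symbol (Relation 1) (nm (Inl X))"
| "code_symbol nm (Inr (D, None)) = Symbol (Function 2) (nm (Inr (D, None)))"
| "code_symbol nm (Inr (D, Some s)) = Symbol (add_argument (kind s)) (nm (Inr (D, Some s)))"

lemma name_code_symbol: "name (code_symbol nm k) = nm k"
  by (cases "(nm, k)" rule: code_symbol.cases) simp_all

lemma kind_code_symbol: "kind (code_symbol nm k) \<noteq> Relation 0" "kind (code_symbol nm k) \<noteq> Function 0"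
proof -
  have "add_argument x \<noteq> Relation 0" "add_argument x \<noteq> Function 0" for x by (cases x; simp)+
  then show "kind (code_symbol nm k) \<noteq> Relation 0" "kind (code_symbol nm k) \<noteq> Function 0"
    by (cases "(nm, k)" rule: code_symbol.cases; simp)+
qed

text \<open>
  The interpretation of the codes, where \<open>A D i\<close> is the structure at index \<open>i\<close> of the family for \<open>D\<close>. The
  symbol \<open>Inr (D, None)\<close> is a retraction onto the universe of \<open>A D i\<close>. Where the arguments make no
  sense, functions return the first argument, to stay inside the universe.
\<close>

fun sum_rel :: "('u set set \<Rightarrow> 'u \<Rightarrow> 'u struct) \<Rightarrow> 'u set + 'u set set \<times> 'u symbol option \<Rightarrow> 'u list \<Rightarrow> bool"
where
  "sum_rel A (Inl X) xs \<longleftrightarrow> hd xs \<in> X"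
| "sum_rel A (Inr (D, None)) xs \<longleftrightarrow> False"
| "sum_rel A (Inr (D, Some s)) xs \<longleftrightarrow> rel (A D (hd xs)) s (tl xs)"

fun sum_fn :: "'u set \<Rightarrow> ('u set set \<Rightarrow> 'u \<Rightarrow> 'u struct) \<Rightarrow> 'u set + 'u set set \<times> 'u symbol option \<Rightarrow> 'u list \<Rightarrow> 'u"
where
  "sum_fn I A (Inl X) xs = hd xs"
| "sum_fn I A (Inr (D, None)) xs =
     (if hd xs \<in> I then if xs ! 1 \<in> univ (A D (hd xs)) then xs ! 1 else SOME a. a \<in> univ (A D (hd xs))
      else hd xs)"
| "sum_fn I A (Inr (D, Some s)) xs =
     (if hd xs \<in> I \<and> set (tl xs) \<subseteq> univ (A D (hd xs)) then fn (A D (hd xs)) s (tl xs) else hd xs)"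

text \<open>
  All families live in one vocabulary and one universe, the union of the universes of their members
  and of the set of indices; \<open>M i\<close> is this structure with the parameter \<open>c\<close> naming \<open>i\<close>. The members
  of the families are recovered as fibers at the parameter.
\<close>

lemma uniform_families:
  fixes I :: "'u set" and \<D> :: "'u set set set" and \<tau> :: "'u set set \<Rightarrow> 'u symbol set"
    and A :: "'u set set \<Rightarrow> 'u \<Rightarrow> 'u struct"
  assumes U: "inaccessible |UNIV :: 'u set|" and I: "|I| <o |UNIV :: 'u set|"
    and \<D>: "|\<D>| <o |UNIV :: 'u set|"
    and \<tau>: "\<And>D. D \<in> \<D> \<Longrightarrow> vocabulary (\<tau> D)"
    and A: "\<And>D i. D \<in> \<D> \<Longrightarrow> i \<in> I \<Longrightarrow> A D i \<in> structures (\<tau> D)"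
  obtains \<sigma> c P r t M where "vocabulary \<sigma>" "is_constant c" "c \<in> \<sigma>"
    "\<And>X. X \<subseteq> I \<Longrightarrow> P X \<in> \<sigma> \<and> kind (P X) = Relation 1"
    "\<And>D. D \<in> \<D> \<Longrightarrow> fiber_symbols (\<tau> D) (r D) (t D) c \<sigma>"
    "\<And>i. i \<in> I \<Longrightarrow> M i \<in> structures \<sigma>"
    "\<And>i X. i \<in> I \<Longrightarrow> X \<subseteq> I \<Longrightarrow> rel (M i) (P X) [fn (M i) c []] \<longleftrightarrow> i \<in> X"
    "\<And>D i. D \<in> \<D> \<Longrightarrow> i \<in> I \<Longrightarrow> same_struct (fiber (\<tau> D) (r D) (t D) c (M i)) (A D i)"
proof -
  let ?U = "|UNIV :: 'u set|"
  let ?K = "Inl ` Pow I \<union> (\<Union>D\<in>\<D>. (\<lambda>s. Inr (D, s)) ` insert None (Some ` \<tau> D))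
      :: ('u set + 'u set set \<times> 'u symbol option) set"
  have \<tau>_less: "|\<tau> D| <o ?U" if "D \<in> \<D>" for D using \<tau>[OF that] by (simp add: vocabulary_def)
  have "|insert None (Some ` \<tau> D)| <o ?U" if "D \<in> \<D>" for D
    using less_universe_Un[OF U less_universe_finite[OF U] less_universe_image[OF \<tau>_less[OF that]], of "{None}" Some]
    by simp
  then have K: "|?K| <o ?U"
    by (intro less_universe_Un[OF U] less_universe_UNION[OF U \<D>] less_universe_image less_universe_Pow[OF U I])
  have "\<exists>nm. inj_on nm ?K \<and> nm ` ?K \<subseteq> (UNIV :: 'u set)"
    by (rule card_of_ordLeq_ex_inj[OF ordLess_imp_ordLeq[OF K]])
  then obtain nm :: "'u set + 'u set set \<times> 'u symbol option \<Rightarrow> 'u" where nm: "inj_on nm ?K"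
    by (elim exE conjE)
  let ?sym = "code_symbol nm"
  have sym_inj: "inj_on ?sym ?K"
  proof (rule inj_onI)
    fix k l assume kl: "k \<in> ?K" "l \<in> ?K" "?sym k = ?sym l"
    then have "nm k = nm l" using name_code_symbol by metis
    then show "k = l" using kl(1,2) by (rule inj_onD[OF nm])
  qed
  define \<sigma>\<^sub>0 where "\<sigma>\<^sub>0 = ?sym ` ?K"
  have \<sigma>\<^sub>0_less: "|\<sigma>\<^sub>0| <o ?U" unfolding \<sigma>\<^sub>0_def by (rule less_universe_image[OF K])
  define code where "code = inv_into ?K ?sym"
  have code: "code (?sym k) = k" if "k \<in> ?K" for k
    unfolding code_def by (rule inv_into_f_f[OF sym_inj that])
  have voc0: "vocabulary \<sigma>\<^sub>0"
    unfolding vocabulary_def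
  proof (intro conjI \<sigma>\<^sub>0_less ballI)
    fix s assume "s \<in> \<sigma>\<^sub>0"
    then show "kind s \<noteq> Relation 0" using kind_code_symbol(1) by (auto simp: \<sigma>\<^sub>0_def)
  qed
  obtain cn where "Symbol (Function 0) cn \<notin> \<sigma>\<^sub>0"
    using infinite_fresh_names[OF U \<sigma>\<^sub>0_less, of "Function 0"]
    by (metis (mono_tags, lifting) Collect_empty_eq finite.emptyI)
  then obtain c where c: "is_constant c" "c \<notin> \<sigma>\<^sub>0" by (metis symbol.sel(1))
  define V where "V = I \<union> (\<Union>D\<in>\<D>. \<Union>i\<in>I. univ (A D i))"
  have "|univ (A D i)| <o ?U" if "D \<in> \<D>" "i \<in> I" for D i
    using A[OF that] by (simp add: structures_def)
  then have V_less: "|V| <o ?U" unfolding V_def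
    by (intro less_universe_Un[OF U] less_universe_UNION[OF U] I \<D>)
  define M\<^sub>0 where "M\<^sub>0 = \<lparr>voc = \<sigma>\<^sub>0, univ = V, rel = (\<lambda>s. sum_rel A (code s)), fn = (\<lambda>s. sum_fn I A (code s))\<rparr>"
  define M where "M i = expand M\<^sub>0 [c] [i]" for i
  have retract: "sum_fn I A (Inr (D, None)) [i, a] \<in> univ (A D i)" if "D \<in> \<D>" "i \<in> I" for D i a
  proof -
    have "univ (A D i) \<noteq> {}" using A[OF that] by (simp add: structures_def)
    then have "(SOME a. a \<in> univ (A D i)) \<in> univ (A D i)" by (simp add: some_in_eq)
    then show ?thesis using that(2) by simp
  qed
  have apply_in: "fn (A D i) s xs \<in> univ (A D i)"
    if "D \<in> \<D>" "i \<in> I" "s \<in> \<tau> D" "kind s = Function n" "length xs = n" "set xs \<subseteq> univ (A D i)" for D i s n xs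
    by (rule fn_in_univ[OF A[OF that(1,2)] that(3-6)])
  have M0_closed: "closed_under M\<^sub>0 \<sigma>\<^sub>0 V"
    unfolding closed_under_def
  proof (intro ballI allI impI)
    fix s n xs assume s: "s \<in> \<sigma>\<^sub>0" "kind s = Function n" "xs \<in> tuples n V"
    from s(1)[unfolded \<sigma>\<^sub>0_def] obtain k where k: "k \<in> ?K" "s = ?sym k" by (elim imageE)
    have "n \<noteq> 0" using kind_code_symbol(2)[of nm k] s(2) k(2) by auto
    have "n = length xs" and V: "set xs \<subseteq> V" using s(3) by (simp_all add: tuples_def)
    then obtain i ys where xs: "xs = i # ys" using \<open>n \<noteq> 0\<close> by (cases xs) auto
    have iV: "i \<in> V" using V xs by simp
    have "sum_fn I A k xs \<in> V"
    proof (cases "\<exists>D. D \<in> \<D> \<and> i \<in> I \<and> (k = Inr (D, None) \<or> (\<exists>s\<in>\<tau> D. k = Inr (D, Some s) \<and> set ys \<subseteq> univ (A D i)))")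
      case True
      then obtain D where D: "D \<in> \<D>" "i \<in> I"
        and cases: "k = Inr (D, None) \<or> (\<exists>s\<in>\<tau> D. k = Inr (D, Some s) \<and> set ys \<subseteq> univ (A D i))"
        by blast
      have "sum_fn I A k xs \<in> univ (A D i)"
        using cases
      proof
        assume k': "k = Inr (D, None)"
        then have "n = 2" using s(2) k(2) by simp
        then obtain a where "ys = [a]" using xs \<open>n = length xs\<close> by (auto simp: length_Suc_conv numeral_2_eq_2)
        then show ?thesis using retract[OF D] xs k' by simp
      next
        assume "\<exists>s\<in>\<tau> D. k = Inr (D, Some s) \<and> set ys \<subseteq> univ (A D i)"
        then obtain s' where s': "s' \<in> \<tau> D" "k = Inr (D, Some s')" "set ys \<subseteq> univ (A D i)" by blast
        then have "kind s' = Function (length ys)"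
          using s(2) k(2) xs \<open>n = length xs\<close> by (cases "kind s'") auto
        then have "fn (A D i) s' ys \<in> univ (A D i)" using apply_in[OF D s'(1)] s'(3) by simp
        then show ?thesis using s' D xs by simp
      qed
      then show ?thesis using D by (auto simp: V_def)
    next
      case False
      then have "sum_fn I A k xs = i" using k(1) xs by auto
      then show ?thesis using iV by simp
    qed
    then show "fn M\<^sub>0 s xs \<in> V" using k code by (simp add: M\<^sub>0_def)
  qed
  have M_struct: "M i \<in> structures (insert c \<sigma>\<^sub>0)" if i: "i \<in> I" for i
  proof -
    have "i \<in> V" using i by (simp add: V_def)
    then have "V \<noteq> {}" by blast
    then have "M\<^sub>0 \<in> structures \<sigma>\<^sub>0" using M0_closed V_less by (simp add: structures_def M\<^sub>0_def)
    then have "M i \<in> structures (\<sigma>\<^sub>0 \<union> set [c])"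
      unfolding M_def using c \<open>i \<in> V\<close> by (intro expand_structures) (auto simp: M\<^sub>0_def)
    then show ?thesis by simp
  qed
  have M_c: "fn (M i) c [] = i" for i by (simp add: M_def expand_def)
  have M_fn: "fn (M i) (?sym k) xs = sum_fn I A k xs" if k: "k \<in> ?K" for i k xs
  proof -
    have "?sym k \<in> \<sigma>\<^sub>0" unfolding \<sigma>\<^sub>0_def by (rule imageI[OF k])
    then have "?sym k \<noteq> c" using c(2) by metis
    then show ?thesis using code[OF k] by (simp add: M_def M\<^sub>0_def expand_def)
  qed
  have M_rel: "rel (M i) (?sym k) xs = sum_rel A k xs" if k: "k \<in> ?K" for i k xs
    using code[OF k] by (simp add: M_def M\<^sub>0_def expand_def)
  have M_univ: "univ (M i) = V" for i by (simp add: M_def M\<^sub>0_def expand_def)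
  define P where "P X = ?sym (Inl X)" for X
  define r where "r D = ?sym (Inr (D, None))" for D
  define t where "t D s = ?sym (Inr (D, Some s))" for D s
  have P_K: "Inl X \<in> ?K" if "X \<subseteq> I" for X using that by blast
  have r_K: "Inr (D, None) \<in> ?K" if "D \<in> \<D>" for D using that by blast
  have t_K: "Inr (D, Some s) \<in> ?K" if "D \<in> \<D>" "s \<in> \<tau> D" for D s using that by blast
  have M_r: "fn (M i) (r D) [i, a] = sum_fn I A (Inr (D, None)) [i, a]" if "D \<in> \<D>" for D i a
    unfolding r_def by (rule M_fn[OF r_K[OF that]])
  show ?thesis
  proof (rule that)
    show "vocabulary (insert c \<sigma>\<^sub>0)" using c(1) by (intro vocabulary_insert[OF U voc0]) simp
    show "is_constant c" "c \<in> insert c \<sigma>\<^sub>0" using c(1) by simp_all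
    show "P X \<in> insert c \<sigma>\<^sub>0 \<and> kind (P X) = Relation 1" if "X \<subseteq> I" for X
      using imageI[OF P_K[OF that], of ?sym] unfolding P_def \<sigma>\<^sub>0_def by simp
    show "fiber_symbols (\<tau> D) (r D) (t D) c (insert c \<sigma>\<^sub>0)" if D: "D \<in> \<D>" for D
      using imageI[OF r_K[OF D], of ?sym] imageI[OF t_K[OF D], of _ ?sym] c(1)
      unfolding fiber_symbols_def r_def t_def \<sigma>\<^sub>0_def by simp
    show "M i \<in> structures (insert c \<sigma>\<^sub>0)" if "i \<in> I" for i by (rule M_struct[OF that])
    show "rel (M i) (P X) [fn (M i) c []] \<longleftrightarrow> i \<in> X" if "X \<subseteq> I" for i X
      unfolding P_def M_rel[OF P_K[OF that]] M_c by simp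
    fix D i assume D: "D \<in> \<D>" "i \<in> I"
    let ?F = "fiber (\<tau> D) (r D) (t D) c (M i)"
    have fix_r: "fn (M i) (r D) [i, a] = a" if "a \<in> univ (A D i)" for a
      using D that by (simp add: M_r)
    have univ_eq: "univ ?F = univ (A D i)"
    proof
      show "univ ?F \<subseteq> univ (A D i)"
        using retract[OF D] by (auto simp: fiber_def M_c M_r[OF D(1)] simp del: sum_fn.simps)
      show "univ (A D i) \<subseteq> univ ?F"
      proof
        fix a assume a: "a \<in> univ (A D i)"
        then have "a \<in> V" using D by (auto simp: V_def)
        then show "a \<in> univ ?F" using fix_r[OF a] by (auto simp: fiber_def M_c M_univ intro!: image_eqI[of _ _ a])
      qed
    qed
    show "same_struct ?F (A D i)"
      unfolding same_struct_def
    proof (intro conjI ballI univ_eq)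
      show "voc ?F = voc (A D i)" using A[OF D] by (simp add: structures_def fiber_def)
      fix s assume "s \<in> voc ?F"
      then have s: "s \<in> \<tau> D" by (simp add: fiber_def)
      show "case kind s of
          Relation n \<Rightarrow> \<forall>xs\<in>tuples n (univ ?F). rel ?F s xs \<longleftrightarrow> rel (A D i) s xs
        | Function n \<Rightarrow> \<forall>xs\<in>tuples n (univ ?F). fn ?F s xs = fn (A D i) s xs"
      proof (cases "kind s")
        case (Relation n)
        have "rel (M i) (t D s) (i # xs) = rel (A D i) s xs" for xs
          unfolding t_def M_rel[OF t_K[OF D(1) s]] by simp
        then show ?thesis using Relation by (simp add: fiber_def M_c)
      next
        case (Function n)
        have "fn ?F s xs = fn (A D i) s xs" if xs: "xs \<in> tuples n (univ (A D i))" for xs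
        proof -
          have "fn (M i) (t D s) (i # xs) = fn (A D i) s xs"
            using xs D(2) unfolding t_def M_fn[OF t_K[OF D(1) s]] by (simp add: tuples_def)
          moreover have "fn (A D i) s xs \<in> univ (A D i)"
            using xs apply_in[OF D s Function] by (simp add: tuples_def)
          ultimately show ?thesis by (simp add: fiber_def M_c fix_r)
        qed
        then show ?thesis using Function by (simp add: univ_eq)
      qed
    qed
  qed
qed

text \<open>
  The indices are (codes of) the subsets of \<open>r\<close> of size less than \<open>r\<close>, and \<open>X a\<close> is the set of
  those that contain \<open>a\<close>; so every ultrafilter containing all \<open>X a\<close> is \<open>(r,r)\<close>-regular. If \<open>L\<close> is
  ultra-compact for none of them, choose a family without limit for each. Let \<open>\<Gamma>\<close> be the set of
  sentences that hold in the coding structure for every value of the parameter, and \<open>\<Sigma>\<close> say that the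
  parameter lies in all \<open>X a\<close>. Fewer than \<open>r\<close> sentences of \<open>\<Sigma>\<close> hold at a suitable index, so
  compactness gives a model \<open>N\<close> of \<open>\<Gamma>\<close> and \<open>\<Sigma>\<close>. The sets to which the parameter belongs in \<open>N\<close>
  are one of the ultrafilters \<open>D\<close>, and the fiber of \<open>N\<close> is a limit of the family chosen for \<open>D\<close>: if
  \<open>\<phi>\<close> holds in the members with indices in \<open>Y \<in> D\<close>, then \<open>\<Gamma>\<close> contains the sentence that the
  fiber satisfies \<open>\<phi>\<close> if the parameter lies in \<open>Y\<close>.
\<close>

lemma compact_logic_regular_ultrafilter:
  fixes L :: "('u, 'f) logic" and r :: "'c rel"
  assumes U: "inaccessible |UNIV :: 'u set|" and L: "regular_logic L"
    and r: "Cinfinite r" "r <o |UNIV :: 'u set|" and comp: "compact_logic r r L"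
  obtains I :: "'u set" and D where "|I| <o |UNIV :: 'u set|" "ultrafilter_on I D"
    "regular_ultrafilter r D" "ultra_compact L I D"
proof -
  let ?U = "|UNIV :: 'u set|"
  define S where "S = {B. B \<subseteq> Field r \<and> |B| <o r}"
  have "|Field r| <o ?U" by (rule ordIso_ordLess_trans[OF card_of_Field_ordIso r(2)]) (use r in simp)
  then have "|Pow (Field r)| <o ?U" by (rule less_universe_Pow[OF U])
  then have S_less: "|S| <o ?U" by (rule less_universe_subset) (auto simp: S_def)
  obtain e :: "'c set \<Rightarrow> 'u" where e: "inj_on e S"
    using card_of_ordLeq_ex_inj[OF ordLess_imp_ordLeq[OF S_less]] by blast
  define I where "I = e ` S"
  have I_less: "|I| <o ?U" unfolding I_def by (rule less_universe_image[OF S_less])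
  define X where "X a = {i \<in> I. \<exists>B\<in>S. i = e B \<and> a \<in> B}" for a
  have X_sub: "X a \<subseteq> I" for a by (auto simp: X_def)
  have eX: "e B \<in> X a \<longleftrightarrow> a \<in> B" if "B \<in> S" for a B
    using that e unfolding X_def I_def inj_on_def by blast
  have X_reg: "regular_ultrafilter r D" if "\<And>a. a \<in> Field r \<Longrightarrow> X a \<in> D" for D
    unfolding regular_ultrafilter_def
  proof (intro exI[of _ X] conjI ballI allI impI that, assumption, elim conjE)
    fix C assume C: "C \<subseteq> Field r" "|C| =o r"
    show "(\<Inter>a\<in>C. X a) = {}"
    proof (rule ccontr)
      assume "(\<Inter>a\<in>C. X a) \<noteq> {}"
      then obtain i where i: "\<And>a. a \<in> C \<Longrightarrow> i \<in> X a" by blast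
      have "infinite C"
        using card_of_ordIso_finite_Field[of r C] ordIso_symmetric[OF C(2)] r(1) unfolding cinfinite_def by simp
      then obtain a0 where "a0 \<in> C" by (metis all_not_in_conv finite.emptyI)
      then obtain B where B: "B \<in> S" "i = e B" using i[of a0] by (auto simp: X_def)
      then have "C \<subseteq> B" using i eX by blast
      then have "|C| \<le>o |B|" by (rule card_of_mono1)
      moreover have "|B| <o r" using B(1) by (simp add: S_def)
      ultimately have "|C| <o r" by (rule ordLeq_ordLess_trans)
      then show False using C(2) by (simp add: not_ordLess_ordIso)
    qed
  qed
  define \<D> where "\<D> = {D. ultrafilter_on I D \<and> (\<forall>a\<in>Field r. X a \<in> D)}"
  show ?thesis
  proof (cases "\<exists>D\<in>\<D>. ultra_compact L I D")
    case True
    then obtain D where "D \<in> \<D>" "ultra_compact L I D" by blast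
    then show ?thesis using that[OF I_less, of D] X_reg[of D] by (simp add: \<D>_def)
  next
    case False
    let ?bad = "\<lambda>D p. vocabulary (fst p) \<and> (\<forall>i\<in>I. snd p i \<in> structures (fst p)) \<and>
        (\<forall>B\<in>structures (fst p). \<exists>\<phi>\<in>sentences L (fst p). {i \<in> I. sat L (snd p i) \<phi>} \<in> D \<and> \<not> sat L B \<phi>)"
    have "\<forall>D. \<exists>p. D \<in> \<D> \<longrightarrow> ?bad D p"
    proof
      fix D
      show "\<exists>p. D \<in> \<D> \<longrightarrow> ?bad D p"
      proof (cases "D \<in> \<D>")
        case True
        then have "\<not> ultra_compact L I D" using False by blast
        then obtain \<tau> A where "vocabulary \<tau>" "\<forall>i\<in>I. A i \<in> structures \<tau>"
            "\<forall>B\<in>structures \<tau>. \<exists>\<phi>\<in>sentences L \<tau>. {i \<in> I. sat L (A i) \<phi>} \<in> D \<and> \<not> sat L B \<phi>"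
          unfolding ultra_compact_def by auto
        then show ?thesis by (intro exI[of _ "(\<tau>, A)"]) simp
      qed simp
    qed
    from choice[OF this] obtain p where "\<forall>D. D \<in> \<D> \<longrightarrow> ?bad D (p D)" by (elim exE)
    then have p: "\<And>D. D \<in> \<D> \<Longrightarrow> vocabulary (fst (p D))"
        "\<And>D i. D \<in> \<D> \<Longrightarrow> i \<in> I \<Longrightarrow> snd (p D) i \<in> structures (fst (p D))"
        "\<And>D B. D \<in> \<D> \<Longrightarrow> B \<in> structures (fst (p D)) \<Longrightarrow> \<exists>\<phi>\<in>sentences L (fst (p D)).
           {i \<in> I. sat L (snd (p D) i) \<phi>} \<in> D \<and> \<not> sat L B \<phi>"
      by simp_all
    define \<tau> where "\<tau> D = fst (p D)" for D
    define A where "A D = snd (p D)" for D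
    have \<tau>A: "\<And>D. D \<in> \<D> \<Longrightarrow> vocabulary (\<tau> D)"
        "\<And>D i. D \<in> \<D> \<Longrightarrow> i \<in> I \<Longrightarrow> A D i \<in> structures (\<tau> D)"
      using p(1,2) by (simp_all add: \<tau>_def A_def)
    have bad: "\<exists>\<phi>\<in>sentences L (\<tau> D). {i \<in> I. sat L (A D i) \<phi>} \<in> D \<and> \<not> sat L B \<phi>"
      if "D \<in> \<D>" "B \<in> structures (\<tau> D)" for D B
      using p(3)[OF that[unfolded \<tau>_def]] by (simp add: \<tau>_def A_def)
    have "\<D> \<subseteq> Pow (Pow I)" by (auto simp: \<D>_def dest: ultrafilter_subset)
    then have \<D>_less: "|\<D>| <o ?U"
      by (rule less_universe_subset[OF less_universe_Pow[OF U less_universe_Pow[OF U I_less]]])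
    obtain \<sigma> c P q t M where \<sigma>: "vocabulary \<sigma>" and c: "is_constant c" "c \<in> \<sigma>"
      and P: "\<And>X. X \<subseteq> I \<Longrightarrow> P X \<in> \<sigma> \<and> kind (P X) = Relation 1"
      and sym: "\<And>D. D \<in> \<D> \<Longrightarrow> fiber_symbols (\<tau> D) (q D) (t D) c \<sigma>"
      and M: "\<And>i. i \<in> I \<Longrightarrow> M i \<in> structures \<sigma>"
      and M_P: "\<And>i X. i \<in> I \<Longrightarrow> X \<subseteq> I \<Longrightarrow> rel (M i) (P X) [fn (M i) c []] \<longleftrightarrow> i \<in> X"
      and M_fiber: "\<And>D i. D \<in> \<D> \<Longrightarrow> i \<in> I \<Longrightarrow> same_struct (fiber (\<tau> D) (q D) (t D) c (M i)) (A D i)"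
      using uniform_families[where \<tau> = \<tau> and A = A, OF U I_less \<D>_less \<tau>A] by blast
    have "\<forall>Y\<in>Pow I. \<exists>\<psi>. \<psi> \<in> sentences L \<sigma> \<and> (\<forall>N\<in>structures \<sigma>. sat L N \<psi> \<longleftrightarrow> rel N (P Y) [fn N c []])"
    proof
      fix Y assume "Y \<in> Pow I"
      then have "wf_atomic \<sigma> (Rel (P Y) [const_term c])" using P[of Y] c by simp
      from atomic_sentence[OF L \<sigma> this]
      show "\<exists>\<psi>. \<psi> \<in> sentences L \<sigma> \<and> (\<forall>N\<in>structures \<sigma>. sat L N \<psi> \<longleftrightarrow> rel N (P Y) [fn N c []])"
        by auto
    qed
    from bchoice[OF this] obtain mem where mem: "\<And>Y. Y \<subseteq> I \<Longrightarrow> mem Y \<in> sentences L \<sigma>"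
        "\<And>Y N. Y \<subseteq> I \<Longrightarrow> N \<in> structures \<sigma> \<Longrightarrow> sat L N (mem Y) \<longleftrightarrow> rel N (P Y) [fn N c []]"
      by blast
    have M_mem: "sat L (M i) (mem Y) \<longleftrightarrow> i \<in> Y" if "i \<in> I" "Y \<subseteq> I" for i Y
      using mem(2)[OF that(2) M[OF that(1)]] M_P[OF that] by simp
    define \<Gamma> where "\<Gamma> = {\<psi> \<in> sentences L \<sigma>. \<forall>i\<in>I. sat L (M i) \<psi>}"
    define \<Sigma> where "\<Sigma> = (\<lambda>a. mem (X a)) ` Field r"
    have "has_model L \<sigma> (\<Gamma> \<union> \<Sigma>)"
    proof (rule comp[unfolded compact_logic_def, rule_format], intro conjI allI impI \<sigma>)
      show "\<Gamma> \<subseteq> sentences L \<sigma>" by (auto simp: \<Gamma>_def)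
      show "\<Sigma> \<subseteq> sentences L \<sigma>" using mem(1)[OF X_sub] by (auto simp: \<Sigma>_def)
      have "|Field r| \<le>o r" using r(1) by (simp add: card_of_Field_ordIso ordIso_imp_ordLeq)
      then show "|\<Sigma>| \<le>o r" unfolding \<Sigma>_def by (rule ordLeq_transitive[OF card_of_image])
    next
      fix \<Sigma>' assume \<Sigma>': "\<Sigma>' \<subseteq> \<Sigma>" "|\<Sigma>'| <o r"
      obtain B where B: "B \<subseteq> Field r" "inj_on (\<lambda>a. mem (X a)) B" "\<Sigma>' = (\<lambda>a. mem (X a)) ` B"
        using \<Sigma>'(1) unfolding \<Sigma>_def by (auto simp: subset_image_inj)
      have "|B| \<le>o |\<Sigma>'|" using B(2,3) by (intro card_of_ordLeq_inj[of "\<lambda>a. mem (X a)"]) simp_all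
      then have BS: "B \<in> S" using \<Sigma>'(2) B(1) ordLeq_ordLess_trans[of "|B|" "|\<Sigma>'|" r] by (simp add: S_def)
      then have eB: "e B \<in> I" by (simp add: I_def)
      have "sat L (M (e B)) \<psi>" if "\<psi> \<in> \<Gamma> \<union> \<Sigma>'" for \<psi>
        using that eB M_mem[OF eB X_sub] eX[OF BS] by (auto simp: \<Gamma>_def B(3))
      then show "has_model L \<sigma> (\<Gamma> \<union> \<Sigma>')" unfolding has_model_def using M[OF eB] by blast
    qed
    then obtain N where N: "N \<in> structures \<sigma>" "\<And>\<psi>. \<psi> \<in> \<Gamma> \<Longrightarrow> sat L N \<psi>" "\<And>\<psi>. \<psi> \<in> \<Sigma> \<Longrightarrow> sat L N \<psi>"
      unfolding has_model_def by blast
    \<comment> \<open>Implications that hold at all indices hold in \<open>N\<close>.\<close>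
    have transfer: "sat L N \<chi>"
      if tr: "\<psi> \<in> sentences L \<sigma>" "\<chi> \<in> sentences L \<sigma>" "sat L N \<psi>"
        "\<And>i. i \<in> I \<Longrightarrow> sat L (M i) \<psi> \<Longrightarrow> sat L (M i) \<chi>" for \<psi> \<chi>
    proof -
      obtain \<theta> where \<theta>: "\<theta> \<in> sentences L \<sigma>" "\<forall>A\<in>structures \<sigma>. sat L A \<theta> \<longleftrightarrow> (sat L A \<psi> \<longrightarrow> sat L A \<chi>)"
        using implication_sentence[OF L \<sigma> tr(1,2)] by blast
      then have "\<theta> \<in> \<Gamma>" using tr(4) M by (auto simp: \<Gamma>_def)
      then show ?thesis using N(1,2) \<theta>(2) tr(3) by blast
    qed
    define D where "D = {Y. Y \<subseteq> I \<and> sat L N (mem Y)}"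
    have "ultrafilter_on I D"
      unfolding ultrafilter_on_def
    proof (intro conjI ballI allI impI)
      show "D \<subseteq> Pow I" by (auto simp: D_def)
      have "mem I \<in> \<Gamma>" using mem(1) M_mem by (simp add: \<Gamma>_def)
      then show "I \<in> D" using N(2) by (simp add: D_def)
      obtain \<theta> where \<theta>: "\<theta> \<in> sentences L \<sigma>" "\<forall>A\<in>structures \<sigma>. sat L A \<theta> \<longleftrightarrow> \<not> sat L A (mem {})"
        using negation_sentence[OF L \<sigma> mem(1)[of "{}"]] by blast
      then have "\<theta> \<in> \<Gamma>" using M M_mem by (auto simp: \<Gamma>_def)
      then have "\<not> sat L N (mem {})" using N(1,2) \<theta>(2) by blast
      then show "{} \<notin> D" by (simp add: D_def)
    next
      fix Y Z assume "Y \<in> D" "Z \<in> D"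
      then have Y: "Y \<subseteq> I" "sat L N (mem Y)" and Z: "Z \<subseteq> I" "sat L N (mem Z)" by (simp_all add: D_def)
      obtain \<theta> where \<theta>: "\<theta> \<in> sentences L \<sigma>"
          "\<forall>A\<in>structures \<sigma>. sat L A \<theta> \<longleftrightarrow> sat L A (mem Y) \<and> sat L A (mem Z)"
        using conjunction_sentence[OF L \<sigma> mem(1)[OF Y(1)] mem(1)[OF Z(1)]] by blast
      have YZ: "Y \<inter> Z \<subseteq> I" using Y by blast
      have "sat L N (mem (Y \<inter> Z))"
        by (rule transfer[OF \<theta>(1) mem(1)[OF YZ]])
          (use \<theta>(2) N(1) Y Z M M_mem[OF _ Y(1)] M_mem[OF _ Z(1)] M_mem[OF _ YZ] in auto)
      then show "Y \<inter> Z \<in> D" using YZ by (simp add: D_def)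
    next
      fix Y Z assume "Y \<in> D" and YZ: "Y \<subseteq> Z \<and> Z \<subseteq> I"
      then have Y: "Y \<subseteq> I" "sat L N (mem Y)" and Z: "Z \<subseteq> I" by (simp_all add: D_def)
      have "sat L N (mem Z)"
        by (rule transfer[OF mem(1)[OF Y(1)] mem(1)[OF Z] Y(2)])
          (use M_mem[OF _ Y(1)] M_mem[OF _ Z] YZ in auto)
      then show "Z \<in> D" using Z by (simp add: D_def)
    next
      fix Y assume Y: "Y \<subseteq> I"
      obtain \<theta> where \<theta>: "\<theta> \<in> sentences L \<sigma>" "\<forall>A\<in>structures \<sigma>. sat L A \<theta> \<longleftrightarrow> \<not> sat L A (mem Y)"
        using negation_sentence[OF L \<sigma> mem(1)[OF Y]] by blast
      have IY: "I - Y \<subseteq> I" by blast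
      have "sat L N (mem (I - Y))" if "\<not> sat L N (mem Y)"
        by (rule transfer[OF \<theta>(1) mem(1)[OF IY]])
          (use \<theta>(2) N(1) that M M_mem[OF _ Y] M_mem[OF _ IY] in auto)
      then show "Y \<in> D \<or> I - Y \<in> D" using Y by (auto simp: D_def)
    qed
    moreover have "X a \<in> D" if "a \<in> Field r" for a
      using N(3) that X_sub by (simp add: D_def \<Sigma>_def)
    ultimately have D: "D \<in> \<D>" by (simp add: \<D>_def)
    have "fiber (\<tau> D) (q D) (t D) c N \<in> structures (\<tau> D)"
      by (rule fiber_structures[OF sym[OF D] N(1)])
    from bad[OF D this] obtain \<phi> where \<phi>: "\<phi> \<in> sentences L (\<tau> D)" "{i \<in> I. sat L (A D i) \<phi>} \<in> D"
        "\<not> sat L (fiber (\<tau> D) (q D) (t D) c N) \<phi>"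
      by blast
    obtain \<psi> where \<psi>: "\<psi> \<in> sentences L \<sigma>"
        "\<forall>A\<in>structures \<sigma>. sat L A \<psi> \<longleftrightarrow> sat L (fiber (\<tau> D) (q D) (t D) c A) \<phi>"
      using fiber_sentence[OF U L \<tau>A(1)[OF D] \<sigma> sym[OF D] \<phi>(1)] by blast
    have Y: "{i \<in> I. sat L (A D i) \<phi>} \<subseteq> I" by blast
    have "sat L N \<psi>"
    proof (rule transfer[OF mem(1)[OF Y] \<psi>(1)])
      show "sat L N (mem {i \<in> I. sat L (A D i) \<phi>})" using \<phi>(2) by (simp add: D_def)
      fix i assume i: "i \<in> I" "sat L (M i) (mem {i \<in> I. sat L (A D i) \<phi>})"
      then have "sat L (A D i) \<phi>" using M_mem[OF i(1) Y] by simp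
      then have "sat L (fiber (\<tau> D) (q D) (t D) c (M i)) \<phi>"
        using sat_same_struct[OF L \<tau>A(1)[OF D] fiber_structures[OF sym[OF D] M[OF i(1)]] \<tau>A(2)[OF D i(1)] \<phi>(1) M_fiber[OF D i(1)]]
        by simp
      then show "sat L (M i) \<psi>" using \<psi>(2) M[OF i(1)] by blast
    qed
    then show ?thesis using \<psi>(2) N(1) \<phi>(3) by blast
  qed
qed

section \<open>Compactness of regular logics\<close>

lemma compact_logic_cong:
  assumes eq: "r =o s" and comp: "compact_logic r r L"
  shows "compact_logic s s L"
  unfolding compact_logic_def
proof (intro allI impI, elim conjE)
  fix \<tau> \<Gamma> \<Sigma>
  assume *: "vocabulary \<tau>" "\<Gamma> \<subseteq> sentences L \<tau>" "\<Sigma> \<subseteq> sentences L \<tau>" "|\<Sigma>| \<le>o s"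
    "\<forall>\<Sigma>'\<subseteq>\<Sigma>. |\<Sigma>'| <o s \<longrightarrow> has_model L \<tau> (\<Gamma> \<union> \<Sigma>')"
  show "has_model L \<tau> (\<Gamma> \<union> \<Sigma>)"
  proof (rule comp[unfolded compact_logic_def, rule_format], intro conjI allI impI *(1-3))
    show "|\<Sigma>| \<le>o r" by (rule ordLeq_ordIso_trans[OF *(4) ordIso_symmetric[OF eq]])
    fix \<Sigma>' assume "\<Sigma>' \<subseteq> \<Sigma>" "|\<Sigma>'| <o r"
    then show "has_model L \<tau> (\<Gamma> \<union> \<Sigma>')"
      using *(5) ordLess_ordIso_trans[OF \<open>|\<Sigma>'| <o r\<close> eq] by blast
  qed
qed

lemma beth_Cinfinite:
  assumes U: "inaccessible |UNIV :: 'u set|" and r: "Cinfinite (r :: 'u rel)" "r <o |UNIV :: 'u set|"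
  shows "Cinfinite (beth m r)"
proof (induction m)
  case 0 then show ?case using r by simp
next
  case (Suc m)
  have "Cinfinite (ctwo ^c beth m r)"
    using Cinfinite_cexp[OF ordLeq_refl[OF Card_order_ctwo] Suc] by simp
  then show ?case by (rule Cinfinite_cong[OF ordIso_symmetric[OF beth_Suc[OF U conjunct2[OF r(1)] r(2)]]])
qed

theorem corollary4p8:
  fixes \<kappa> :: "'u rel" and L :: "('u, 'f) logic" and m n :: nat
  assumes universe: "inaccessible |UNIV :: 'u set|"
    and \<kappa>: "Card_order \<kappa>" "cinfinite \<kappa>" "\<kappa> <o |UNIV :: 'u set|"
    and L: "regular_logic L"
  shows
    "(compact_logic (ctwo ^c (ctwo ^c \<kappa>)) (ctwo ^c (ctwo ^c \<kappa>)) L \<longrightarrow>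
        (\<exists>\<mu>::'u rel. Card_order \<mu> \<and> \<kappa> \<le>o \<mu> \<and> \<mu> \<le>o ctwo ^c \<kappa> \<and> compact_logic \<mu> \<mu> L))
   \<and> (m \<ge> 1 \<longrightarrow>
        compact_logic (beth m (succ_card n \<kappa>)) (beth m (succ_card n \<kappa>)) L \<longrightarrow>
        (\<exists>\<mu>::'u rel. Card_order \<mu> \<and> \<kappa> \<le>o \<mu> \<and> \<mu> \<le>o ctwo ^c \<kappa> \<and> compact_logic \<mu> \<mu> L))
   \<and> (strong_limit \<kappa> \<and> U' \<kappa> \<longrightarrow>
        (compact_logic (ctwo ^c \<kappa>) (ctwo ^c \<kappa>) L \<longrightarrow> compact_logic \<kappa> \<kappa> L) \<and>
        (compact_logic (beth m (succ_card n \<kappa>)) (beth m (succ_card n \<kappa>)) L \<longrightarrow>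
           compact_logic \<kappa> \<kappa> L))"
proof -
  have inf: "Cinfinite \<kappa>" using \<kappa>(1,2) by simp
  have ultrafilter: "\<exists>(I :: 'u set) D. |I| <o |UNIV :: 'u set| \<and> ultrafilter_on I D \<and>
      regular_ultrafilter (beth m (succ_card n \<kappa>)) D \<and> ultra_compact L I D"
    if comp: "compact_logic (beth m (succ_card n \<kappa>)) (beth m (succ_card n \<kappa>)) L" for m n
  proof -
    note facts = succ_card_facts[OF universe inf \<kappa>(3), of n]
    have less: "beth m (succ_card n \<kappa>) <o |UNIV :: 'u set|"
      by (rule conjunct2[OF beth_less_universe[OF universe conjunct2[OF facts(1)] facts(2)]])
    show ?thesis
      using compact_logic_regular_ultrafilter[OF universe L beth_Cinfinite[OF universe facts(1,2)] less comp] by metis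
  qed
  have interval: "\<exists>\<mu>::'u rel. Card_order \<mu> \<and> \<kappa> \<le>o \<mu> \<and> \<mu> \<le>o ctwo ^c \<kappa> \<and> compact_logic \<mu> \<mu> L"
    if m: "m \<noteq> 0" and comp: "compact_logic (beth m (succ_card n \<kappa>)) (beth m (succ_card n \<kappa>)) L" for m n
  proof -
    obtain I :: "'u set" and D where D: "ultrafilter_on I D"
        "regular_ultrafilter (beth m (succ_card n \<kappa>)) D" "ultra_compact L I D"
      using ultrafilter[OF comp] by auto
    obtain \<mu> :: "'u rel" where \<mu>: "Card_order \<mu>" "\<kappa> \<le>o \<mu>" "\<mu> \<le>o ctwo ^c \<kappa>" "regular_ultrafilter \<mu> D"
      using regular_ultrafilter_below_exponential[OF universe inf \<kappa>(3) D(1) m D(2)] by auto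
    show ?thesis using \<mu>(1-3) ultra_compact_compact_logic[OF D(1) \<mu>(1,4) D(3)] by auto
  qed
  have at_limit: "compact_logic \<kappa> \<kappa> L"
    if lim: "strong_limit \<kappa>" "U' \<kappa>" and comp: "compact_logic (beth m (succ_card n \<kappa>)) (beth m (succ_card n \<kappa>)) L" for m n
  proof -
    obtain I :: "'u set" and D where D: "|I| <o |UNIV :: 'u set|" "ultrafilter_on I D"
        "regular_ultrafilter (beth m (succ_card n \<kappa>)) D" "ultra_compact L I D"
      using ultrafilter[OF comp] by auto
    have "regular_ultrafilter \<kappa> D"
      by (rule regular_ultrafilter_strong_limit[OF universe \<kappa>(3) lim D(1-3)])
    then show ?thesis by (rule ultra_compact_compact_logic[OF D(2) \<kappa>(1) _ D(4)])
  qed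
  have beth_1: "ctwo ^c \<kappa> =o beth 1 (succ_card 0 \<kappa>)"
    using ordIso_symmetric[OF beth_Suc[OF universe \<kappa>(1,3), of 0]] by simp
  have "ctwo ^c (ctwo ^c \<kappa>) =o ctwo ^c beth 1 \<kappa>"
    using beth_1 by (intro cexp_cong2 Card_order_ctwo Card_order_cexp) simp
  then have beth_2: "ctwo ^c (ctwo ^c \<kappa>) =o beth 2 (succ_card 0 \<kappa>)"
    using ordIso_transitive[OF _ ordIso_symmetric[OF beth_Suc[OF universe \<kappa>(1,3), of 1]]]
    by (simp add: numeral_2_eq_2)
  show ?thesis
  proof (intro conjI impI, goal_cases)
    case 1
    show ?case by (rule interval[of 2, OF _ compact_logic_cong[OF beth_2 1]]) simp
  next
    case 2
    then show ?case by (intro interval[of m]) simp_all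
  next
    case 3
    show ?case by (rule at_limit[OF _ _ compact_logic_cong[OF beth_1 3(2)]]) (use 3(1) in simp_all)
  next
    case 4
    show ?case by (rule at_limit[OF _ _ 4(2)]) (use 4(1) in simp_all)
  qed
qed

end
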